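(* For any $t_0>0$, integer $K_1\ge N$, and all $x\in\mathbb Z$ and $t\ge t_0$, the second discrete Green function $\mathbf v$ satisfies $$\mathbf v(x,t)=\sqrt t\,f_0\!\left(\frac{x}{\sqrt t}\right)+\Omega(x)+\sum_{n=N}^{K_1}\frac{1}{t^{n-1}\sqrt t}\,f_n\!\left(\frac{x}{\sqrt t}\right)+\mathbf r_{\mathbf v}(K_1;x,t)\quad\text{for }x\ge0,$$ $$\mathbf v(x,t)=\mathbf v(-x,t)\quad\text{for }x\le-1,$$ where $$\Omega(x)=\frac1{2\pi}\left(\int_{-\pi}^{\pi}\left(\frac{\cos(x\xi)}{A(\xi)}-\frac1{\xi^2}\right)d\xi-\frac2\pi\right)+\frac x2,$$ $$|\mathbf r_{\mathbf v}(K_1;x,t)|\le\frac{R_{\mathbf v}(K_1,t_0)}{t^{K_1}\sqrt t},$$ and $R_{\mathbf v}(K_1,t_0)\ge0$ does not depend on $t\ge t_0$ and $x\ge0$. Moreover, if $N=1$, then $\Omega(x)=0$ for all integers $x\ge0$.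
   Context: Fix $N\in\mathbb N$. Let $a_1,\dots,a_N\in\mathbb R$ be the unique solution of $\sum_{\nu=1}^Na_\nu\nu^2=1$, $\sum_{\nu=1}^Na_\nu\nu^{2m}=0$ for $m=2,\dots,N$. For functions $\mathbf u$ on $\mathbb Z$ let $\boldsymbol\Delta_1\mathbf u(x)=\sum_{\nu=1}^Na_\nu(\mathbf u(x-\nu)-2\mathbf u(x)+\mathbf u(x+\nu))$, and let $A(\theta)=2\sum_{\nu=1}^Na_\nu(1-\cos\nu\theta)$ be the symbol of $-\boldsymbol\Delta_1$. Second discrete Green function: $\mathbf v(x,t)$, $x\in\mathbb Z$, $t\ge0$, is the function that is rapidly decreasing in $x$, $C^1$ in $t\in[0,\infty)$, and satisfies $\dot{\mathbf v}-\boldsymbol\Delta_1\mathbf v=\boldsymbol\delta$ for $t>0$, $\mathbf v(x,0)=0$, where $\boldsymbol\delta(0)=1$ and $\boldsymbol\delta(x)=0$ for $x\neq0$. It is given by $\mathbf v(x,t)=\frac1{2\pi}\int_{-\pi}^\pi\frac{1-e^{-tA(\theta)}}{A(\theta)}e^{ix\theta}\,d\theta$. Let $h(y)=\frac{1}{2\sqrt\pi}e^{-y^2/4}$. For $n\ge N$ set $$b_n=\frac{2(-1)^{n+1}}{(2(n+1))!}\sum_{\nu=1}^Na_\nu\nu^{2(n+1)},\quad c_{nm}=\sum_{\substack{l_1,\dots,l_m\ge N\\l_1+\dots+l_m=n}}b_{l_1}\cdots b_{l_m}\ (m\ge1),\quad \mathcal P_n(\xi)=\sum_{1\le m\le n/N}\frac{c_{nm}\xi^{2(n+m)}}{m!},$$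 and $h_{0n}(y)=\mathcal P_n\!\left(-i\frac{d}{dy}\right)h(y)$. For $y\ge0$ set $$f_0(y)=2y\int_y^\infty\rho^{-2}h(\rho)\,d\rho,\qquad f_n(y)=-\frac{2}{y^{2n-1}}\int_0^y\rho^{2n-2}h_{0n}(\rho)\,d\rho\quad(n\ge N),$$ with the values at $y=0$ understood as the limits $y\to0+$ (these functions are real analytic on $[0,\infty)$). *)

theory Defs
  imports "HOL-Analysis.Analysis" "HOL-Computational_Algebra.Polynomial"
begin

text \<open>The weights \<open>a\<^sub>1, \<dots>, a\<^sub>N\<close> are passed as a function \<open>a :: nat \<Rightarrow> real\<close>, of which only the
  values on \<open>{1..N}\<close> are used.\<close>

definition stencil_weights :: "nat \<Rightarrow> (nat \<Rightarrow> real) \<Rightarrow> bool" where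
  "stencil_weights N a \<longleftrightarrow>
     (\<Sum>\<nu>=1..N. a \<nu> * real \<nu> ^ 2) = 1 \<and>
     (\<forall>m\<in>{2..N}. (\<Sum>\<nu>=1..N. a \<nu> * real \<nu> ^ (2 * m)) = 0)"

definition discrete_laplacian :: "nat \<Rightarrow> (nat \<Rightarrow> real) \<Rightarrow> (int \<Rightarrow> real) \<Rightarrow> int \<Rightarrow> real" where
  "discrete_laplacian N a u x =
     (\<Sum>\<nu>=1..N. a \<nu> * (u (x - int \<nu>) - 2 * u x + u (x + int \<nu>)))"

definition laplacian_symbol :: "nat \<Rightarrow> (nat \<Rightarrow> real) \<Rightarrow> real \<Rightarrow> real" where
  "laplacian_symbol N a \<theta> = 2 * (\<Sum>\<nu>=1..N. a \<nu> * (1 - cos (real \<nu> * \<theta>)))"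

definition rapidly_decreasing :: "(int \<Rightarrow> real) \<Rightarrow> bool" where
  "rapidly_decreasing u \<longleftrightarrow> (\<forall>k::nat. \<exists>C. \<forall>x. \<bar>real_of_int x\<bar> ^ k * \<bar>u x\<bar> \<le> C)"

definition C1_halfline :: "(real \<Rightarrow> real) \<Rightarrow> (real \<Rightarrow> real) \<Rightarrow> bool" where
  "C1_halfline g g' \<longleftrightarrow>
     (\<forall>t\<ge>0. (g has_real_derivative g' t) (at t within {0..})) \<and> continuous_on {0..} g'"

text \<open>Rapid decrease is required for each fixed \<open>t\<close>, with no uniformity in \<open>t\<close>. The values
  \<open>v x t\<close> for \<open>t < 0\<close> are unconstrained.\<close>

definition second_green_function :: "nat \<Rightarrow> (nat \<Rightarrow> real) \<Rightarrow> (int \<Rightarrow> real \<Rightarrow> real) \<Rightarrow> bool" where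
  "second_green_function N a v \<longleftrightarrow>
     (\<forall>t\<ge>0. rapidly_decreasing (\<lambda>x. v x t)) \<and>
     (\<exists>v'. (\<forall>x. C1_halfline (v x) (v' x)) \<and>
           (\<forall>x. \<forall>t>0. v' x t - discrete_laplacian N a (\<lambda>y. v y t) x = (if x = 0 then 1 else 0))) \<and>
     (\<forall>x. v x 0 = 0)"

definition heat_kernel :: "real \<Rightarrow> real" where
  "heat_kernel y = 1 / (2 * sqrt pi) * exp (- (y ^ 2 / 4))"

definition b_coeff :: "nat \<Rightarrow> (nat \<Rightarrow> real) \<Rightarrow> nat \<Rightarrow> real" where
  "b_coeff N a n =
     2 * (- 1) ^ (n + 1) / fact (2 * (n + 1)) * (\<Sum>\<nu>=1..N. a \<nu> * real \<nu> ^ (2 * (n + 1)))"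

text \<open>The summation index \<open>(l\<^sub>1, \<dots>, l\<^sub>m)\<close> is a list of length \<open>m\<close>; the index set is finite.\<close>

definition c_coeff :: "nat \<Rightarrow> (nat \<Rightarrow> real) \<Rightarrow> nat \<Rightarrow> nat \<Rightarrow> real" where
  "c_coeff N a n m =
     (\<Sum>l | length l = m \<and> (\<forall>i\<in>set l. N \<le> i) \<and> sum_list l = n. prod_list (map (b_coeff N a) l))"

definition P_poly :: "nat \<Rightarrow> (nat \<Rightarrow> real) \<Rightarrow> nat \<Rightarrow> real poly" where
  "P_poly N a n = (\<Sum>m=1..n div N. monom (c_coeff N a n m / fact m) (2 * (n + m)))"

text \<open>\<open>p(-i d/dy) g\<close> for a real polynomial \<open>p\<close> and a real function \<open>g\<close>.\<close>

definition diff_operator :: "real poly \<Rightarrow> (real \<Rightarrow> real) \<Rightarrow> real \<Rightarrow> complex" where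
  "diff_operator p g y =
     (\<Sum>k\<le>degree p. complex_of_real (coeff p k) * (- \<i>) ^ k * complex_of_real ((deriv ^^ k) g y))"

text \<open>\<open>P_poly\<close> contains even powers only, so the value of the operator is real and \<open>Re\<close> is only a
  change of type.\<close>

definition h0 :: "nat \<Rightarrow> (nat \<Rightarrow> real) \<Rightarrow> nat \<Rightarrow> real \<Rightarrow> real" where
  "h0 N a n y = Re (diff_operator (P_poly N a n) heat_kernel y)"

definition extend_at_0 :: "(real \<Rightarrow> real) \<Rightarrow> real \<Rightarrow> real" where
  "extend_at_0 g y = (if y = 0 then Lim (at_right 0) g else g y)"

definition f_zero :: "real \<Rightarrow> real" where
  "f_zero = extend_at_0 (\<lambda>y. 2 * y * integral {y..} (\<lambda>\<rho>. heat_kernel \<rho> / \<rho> ^ 2))"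

text \<open>The natural number subtractions below do not truncate, as \<open>n \<ge> N \<ge> 1\<close>.\<close>

definition f_term :: "nat \<Rightarrow> (nat \<Rightarrow> real) \<Rightarrow> nat \<Rightarrow> real \<Rightarrow> real" where
  "f_term N a n = extend_at_0
     (\<lambda>y. - (2 / y ^ (2 * n - 1)) * integral {0..y} (\<lambda>\<rho>. \<rho> ^ (2 * n - 2) * h0 N a n \<rho>))"

text \<open>The integrand has a removable singularity at \<open>\<xi> = 0\<close>; its HOL value there is irrelevant to
  the integral.\<close>

definition Omega :: "nat \<Rightarrow> (nat \<Rightarrow> real) \<Rightarrow> int \<Rightarrow> real" where
  "Omega N a x =
     1 / (2 * pi) *
       (integral {- pi..pi}
          (\<lambda>\<xi>. cos (real_of_int x * \<xi>) / laplacian_symbol N a \<xi> - 1 / \<xi> ^ 2) - 2 / pi)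
     + real_of_int x / 2"

end

theory Submission
  imports Defs "HOL-Probability.Probability" "HOL-Real_Asymp.Real_Asymp"
begin

text \<open>
  The difference \<open>w\<close> of two second Green functions solves \<open>w' = \<Delta> w\<close> with \<open>w = 0\<close> at
  \<open>t = 0\<close>, and \<open>\<bar>w'\<bar>\<close> is at most a constant times the supremum of \<open>\<bar>w\<bar>\<close> over \<open>x\<close>. Boundedness in
  \<open>x\<close> for each \<open>t\<close> becomes locally uniform in \<open>t\<close> by Baire's theorem, so \<open>w = 0\<close> and the Green
  function is the Fourier integral of \<open>(1 - exp (- t A)) / A\<close>. This needs \<open>A > 0\<close> on \<open>(0, pi]\<close>: the
  moment conditions force \<open>2 - A'' = c (1 - cos \<theta>)\<^sup>N\<close> with \<open>c > 0\<close>, hence \<open>A'\<close> is concave on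
  \<open>[0, pi]\<close> and vanishes at both ends.

  The time derivative of the Green function is the Fourier integral of \<open>exp (- t A)\<close>. With
  \<open>A = \<theta>\<^sup>2 - \<theta>\<^sup>2 B\<close> and \<open>B = (\<Sum>n\<ge>N. b\<^sub>n \<theta>\<^sup>2\<^sup>n)\<close>, expanding \<open>exp (t \<theta>\<^sup>2 B)\<close> and substituting
  \<open>\<theta> = \<xi> / sqrt t\<close> gives its expansion in \<open>h\<close> and the \<open>h\<^sub>0\<^sub>n\<close>, uniformly in \<open>x\<close>. Each term is the
  \<open>t\<close>-derivative of the corresponding term of the asserted expansion, so the difference of the two
  sides converges as \<open>t\<close> tends to infinity, at the asserted rate; its limit is \<open>\<Omega>(x)\<close> by dominated
  convergence. For \<open>N = 1\<close>, the second difference of \<open>\<Omega>\<close> vanishes for \<open>x \<ge> 1\<close>, and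
  \<open>\<Omega>(0) = \<Omega>(1) = 0\<close>.
\<close>

section \<open>Uniqueness for evolutions of bounded rate\<close>

text \<open>Rapid decrease is assumed for each \<open>t\<close> separately, so the supremum over
  \<open>x\<close> of the difference is not known to be finite on any time interval, and a Gronwall
  estimate has nothing to start from; this is the obstacle that Baire's theorem removes. Only the
  size of \<open>w'\<close> is controlled, so all estimates run backwards in time as well as
  forwards. The time derivative is expanded because exp (- t A) decays like a Gaussian, while
  splitting (1 - exp (- t A)) / A would produce 1 / A, which is not integrable at 0. Integrating its
  error from \<open>t\<close> to infinity turns the order t^(-K-3/2) into t^(-K-1/2), uniformly in
  \<open>x\<close>; the convergence to \<Omega>(x) is needed only for each fixed \<open>x\<close>.
  Both sides grow like sqrt (t / pi), which is subtracted before the limit is taken. For the Green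
  function this is done by comparing \<open>A\<close> with \<theta>^2: the boundary terms of the
  comparison integral over [-pi, pi] are the origin of - 2 / pi in \<Omega>, and the constant - x /
  2 left over by \<open>f_zero\<close> is the origin of + x / 2.\<close>

locale bounded_rate_evolution =
  fixes w w' :: "'i \<Rightarrow> real \<Rightarrow> real" and C :: real
  assumes deriv: "\<And>x t. t > 0 \<Longrightarrow> (w x has_real_derivative w' x t) (at t)"
    and cont: "\<And>x. continuous_on {0..} (w x)"
    and rate: "\<And>x t M. t > 0 \<Longrightarrow> (\<And>y. \<bar>w y t\<bar> \<le> M) \<Longrightarrow> \<bar>w' x t\<bar> \<le> C * M"
    and C_pos: "C > 0"
begin

definition bounded_over :: "real set \<Rightarrow> bool" where
  "bounded_over S \<longleftrightarrow> (\<exists>B. \<forall>x. \<forall>t\<in>S. \<bar>w x t\<bar> \<le> B)"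

lemma bounded_over_subset: "bounded_over T \<Longrightarrow> S \<subseteq> T \<Longrightarrow> bounded_over S"
  unfolding bounded_over_def by blast

lemma increment_le:
  assumes "0 \<le> p" "p \<le> q" "\<And>x t. t \<in> {p..q} \<Longrightarrow> \<bar>w x t\<bar> \<le> B"
  shows "\<bar>w x q - w x p\<bar> \<le> C * B * (q - p)"
proof (cases "p = q")
  case False
  with assms have "p < q" by simp
  have "\<exists>l z. z > p \<and> z < q \<and> (w x has_real_derivative l) (at z) \<and> w x q - w x p = (q - p) * l"
  proof (rule MVT)
    show "continuous_on {p..q} (w x)"
      using continuous_on_subset[OF cont] assms by auto
    show "w x differentiable (at z)" if "p < z" "z < q" for z
      using deriv[of z x] that assms by (auto simp: real_differentiable_def)
  qed fact
  then obtain l z where z: "p < z" "z < q" "(w x has_real_derivative l) (at z)"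
    "w x q - w x p = (q - p) * l" by blast
  have "l = w' x z"
    using DERIV_unique[OF z(3) deriv] z assms by auto
  moreover have "\<bar>w' x z\<bar> \<le> C * B"
    using rate[of z B x] z assms by auto
  ultimately show ?thesis
    using z \<open>p < q\<close> by (simp add: abs_mult mult.commute mult_left_mono)
qed auto

text \<open>On a window this short, any bound \<open>B'\<close> valid throughout improves to M + B'
  / 2. Iteration drives it to the fixed point 2 * M, but it needs some finite bound to begin with,
  which is what \<open>bounded_over\<close> supplies.\<close>

lemma window_interval:
  assumes "0 \<le> s" "C * (t - s) \<le> 1/2" "bounded_over {s..t}"
    and q: "q \<in> {s..t}" "\<And>x. \<bar>w x q\<bar> \<le> M" and r: "r \<in> {s..t}"
  shows "\<bar>w x r\<bar> \<le> 2 * M"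
proof -
  obtain B where B: "\<And>x t'. t' \<in> {s..t} \<Longrightarrow> \<bar>w x t'\<bar> \<le> B"
    using assms(3) unfolding bounded_over_def by blast
  \<comment> \<open>The index type is nonempty; \<open>undefined\<close> is just some index at which
    the bound can be read.\<close>
  have "0 \<le> M" using q(2)[of undefined] by linarith
  have "0 \<le> B" using B[OF q(1), of undefined] by linarith
  have improve: "\<bar>w x r\<bar> \<le> M + B' / 2"
    if B': "\<And>x t'. t' \<in> {s..t} \<Longrightarrow> \<bar>w x t'\<bar> \<le> B'" and r: "r \<in> {s..t}" for B' x r
  proof -
    have "0 \<le> B'" using B'[OF q(1), of undefined] by linarith
    have "\<bar>w x r - w x q\<bar> \<le> C * B' * \<bar>r - q\<bar>"
    proof (cases "q \<le> r")
      case True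
      then show ?thesis using increment_le[of q r B' x] B' q r assms(1) by auto
    next
      case False
      then show ?thesis using increment_le[of r q B' x] B' q r assms(1)
        by (auto simp: abs_minus_commute)
    qed
    also have "\<dots> = (C * \<bar>r - q\<bar>) * B'" by simp
    also have "\<dots> \<le> (C * (t - s)) * B'"
      using q r C_pos \<open>0 \<le> B'\<close> by (intro mult_right_mono mult_left_mono) auto
    also have "\<dots> \<le> B' / 2"
      using mult_right_mono[OF assms(2) \<open>0 \<le> B'\<close>] by simp
    finally show ?thesis using q(2)[of x] by linarith
  qed
  have iter: "\<forall>x. \<forall>r\<in>{s..t}. \<bar>w x r\<bar> \<le> 2 * M + B / 2 ^ n" for n :: nat
  proof (induction n)
    case 0
    show ?case
    proof (intro allI ballI)
      fix x r assume "r \<in> {s..t}"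
      then show "\<bar>w x r\<bar> \<le> 2 * M + B / 2 ^ 0" using B[of r x] \<open>0 \<le> M\<close> by simp
    qed
  next
    case (Suc n)
    then show ?case using improve[of "2 * M + B / 2 ^ n"] by (fastforce simp: field_simps)
  qed
  have "(\<lambda>n. 2 * M + B * (1/2) ^ n) \<longlonglongrightarrow> 2 * M + B * 0"
    by (intro tendsto_intros LIMSEQ_power_zero) auto
  moreover have "\<bar>w x r\<bar> \<le> 2 * M + B * (1/2) ^ n" for n
    using iter[of n] r by (simp add: power_divide)
  ultimately show ?thesis
    by (intro LIMSEQ_le_const[of _ "2 * M"]) auto
qed

text \<open>The segment form lets the bound travel in either direction of time; the backward
  direction is essential for excluding blow-up.\<close>

lemma window:
  assumes "0 \<le> s" "0 \<le> t" "C * \<bar>t - s\<bar> \<le> 1/2" "bounded_over (closed_segment s t)"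
    and q: "q \<in> closed_segment s t" "\<And>x. \<bar>w x q\<bar> \<le> M" and r: "r \<in> closed_segment s t"
  shows "\<bar>w x r\<bar> \<le> 2 * M"
  using window_interval[of s t q M r x] window_interval[of t s q M r x] assms
  by (cases "s \<le> t") (auto simp: closed_segment_eq_real_ivl)

text \<open>The obstruction to local boundedness uniform in the index. Neighbourhoods are cut down
  to {0..} because the functions are unconstrained at negative times.\<close>

definition blowup_times :: "real set" where
  "blowup_times = {t. t \<ge> 0 \<and> (\<forall>e>0. \<not> bounded_over ({0..} \<inter> ball t e))}"

lemma closed_blowup_times: "closed blowup_times"
proof -
  have "open (- blowup_times)"
    unfolding open_contains_ball
  proof
    fix t assume t: "t \<in> - blowup_times"
    show "\<exists>e>0. ball t e \<subseteq> - blowup_times"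
    proof (cases "t < 0")
      case True
      then show ?thesis
        by (intro exI[of _ "-t"]) (auto simp: blowup_times_def dist_real_def)
    next
      case False
      then obtain e where e: "e > 0" "bounded_over ({0..} \<inter> ball t e)"
        using t unfolding blowup_times_def by auto
      have "s \<notin> blowup_times" if "s \<in> ball t e" for s
      proof -
        have "ball s (e - dist t s) \<subseteq> ball t e"
          by (simp add: ball_subset_ball_iff dist_commute)
        then have "bounded_over ({0..} \<inter> ball s (e - dist t s))"
          using e by (auto intro: bounded_over_subset)
        moreover have "e - dist t s > 0" using that by simp
        ultimately show ?thesis unfolding blowup_times_def by blast
      qed
      then show ?thesis using e by auto
    qed
  qed
  then show ?thesis by (simp add: open_closed)
qed

text \<open>Compactness of the interval, in the form of the bisection principle: boundedness is
  local and passes to the union of adjacent intervals.\<close>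

lemma bounded_over_interval:
  assumes "0 \<le> s" "{s..t} \<inter> blowup_times = {}"
  shows "bounded_over {s..t}"
proof (cases "s \<le> t")
  case True
  define P where "P a b \<longleftrightarrow> (s \<le> a \<and> b \<le> t \<longrightarrow> bounded_over {a..b})" for a b
  have "P s t"
  proof (rule Bolzano[OF True])
    fix a b c assume *: "P a b" "P b c" "a \<le> b" "b \<le> c"
    show "P a c"
      unfolding P_def
    proof
      assume ac: "s \<le> a \<and> c \<le> t"
      then obtain B1 B2 where "\<forall>x. \<forall>t\<in>{a..b}. \<bar>w x t\<bar> \<le> B1" "\<forall>x. \<forall>t\<in>{b..c}. \<bar>w x t\<bar> \<le> B2"
        using * unfolding P_def bounded_over_def by (metis order_trans)
      then have "\<forall>x. \<forall>t\<in>{a..c}. \<bar>w x t\<bar> \<le> max B1 B2"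
        by (metis atLeastAtMost_iff le_max_iff_disj linear)
      then show "bounded_over {a..c}"
        unfolding bounded_over_def by blast
    qed
  next
    fix x assume x: "s \<le> x" "x \<le> t"
    then have "x \<notin> blowup_times" "0 \<le> x" using assms by auto
    then obtain e where e: "e > 0" "bounded_over ({0..} \<inter> ball x e)"
      unfolding blowup_times_def by auto
    have "P a b" if "a \<le> x" "x \<le> b" "b - a < e" for a b
    proof -
      have "{a..b} \<subseteq> {0..} \<inter> ball x e" if "s \<le> a"
        using \<open>a \<le> x\<close> \<open>x \<le> b\<close> \<open>b - a < e\<close> that assms(1) by (auto simp: dist_real_def)
      then show ?thesis using e(2) unfolding P_def by (metis bounded_over_subset)
    qed
    then show "\<exists>d>0. \<forall>a b. a \<le> x \<and> x \<le> b \<and> b - a < d \<longrightarrow> P a b"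
      using e by blast
  qed
  then show ?thesis by (simp add: P_def)
qed (auto simp: bounded_over_def)

lemma bounded_over_segment:
  assumes "0 \<le> s" "0 \<le> t" "closed_segment s t \<inter> blowup_times = {}"
  shows "bounded_over (closed_segment s t)"
  using bounded_over_interval[of s t] bounded_over_interval[of t s] assms
  by (auto simp: closed_segment_eq_real_ivl split: if_splits)

text \<open>The bound is transported from the end point \<open>p\<close>, where the solution need not be locally
  bounded a priori: running backwards from \<open>t\<close> shows that no blow-up occurs on the way to \<open>p\<close>.\<close>

lemma bound_from_endpoint:
  assumes "0 \<le> p" "0 \<le> t" "C * \<bar>t - p\<bar> \<le> 1/2"
    and no_blowup: "(closed_segment p t - {p}) \<inter> blowup_times = {}"
    and M: "\<And>x. \<bar>w x p\<bar> \<le> M" and bt: "\<exists>B. \<forall>x. \<bar>w x t\<bar> \<le> B"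
  shows "\<bar>w x t\<bar> \<le> 2 * M"
proof -
  obtain B where B: "\<And>x. \<bar>w x t\<bar> \<le> B" using bt by blast
  \<comment> \<open>Transport from \<open>t\<close> back to \<open>s\<close>. The constant is the
    same for all \<open>s\<close>, so the bound persists as \<open>s\<close> approaches
    \<open>p\<close>, even if \<open>p\<close> is itself a blow-up time.\<close>
  have *: "\<bar>w x s\<bar> \<le> 2 * B" if s: "s \<in> closed_segment p t" "s \<noteq> p" for s x
  proof (rule window[of s t t B s])
    have seg: "closed_segment s t \<subseteq> closed_segment p t - {p}"
      using s by (auto simp: closed_segment_eq_real_ivl split: if_splits)
    show s0: "0 \<le> s"
      using assms(1,2) s by (auto simp: closed_segment_eq_real_ivl split: if_splits)
    show "bounded_over (closed_segment s t)"
      using bounded_over_segment[of s t] s0 assms(2) no_blowup seg by blast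
    have "\<bar>t - s\<bar> \<le> \<bar>t - p\<bar>"
      using s by (auto simp: closed_segment_eq_real_ivl split: if_splits)
    then show "C * \<bar>t - s\<bar> \<le> 1/2"
      using mult_left_mono[of "\<bar>t - s\<bar>" "\<bar>t - p\<bar>" C] C_pos assms(3) by linarith
  qed (use B assms in auto)
  have "bounded_over (closed_segment p t)"
    unfolding bounded_over_def
  proof (intro exI allI ballI)
    fix x s assume "s \<in> closed_segment p t"
    then show "\<bar>w x s\<bar> \<le> max (2 * B) M"
      using *[of s x] M[of x] by (cases "s = p") auto
  qed
  then show ?thesis
    using window[of p t p M t x] assms by auto
qed

text \<open>The bounds in \<open>x\<close> are not uniform in \<open>t\<close>; Baire's theorem, applied to the closed set of
  blow-up times itself, provides a relatively open part of it on which they are.\<close>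

lemma blowup_times_empty:
  assumes bounded: "\<And>t. t \<ge> 0 \<Longrightarrow> \<exists>B. \<forall>x. \<bar>w x t\<bar> \<le> B"
  shows "blowup_times = {}"
proof (rule ccontr)
  assume "blowup_times \<noteq> {}"
  define F where "F n = {t\<in>blowup_times. \<forall>x. \<bar>w x t\<bar> \<le> real n}" for n :: nat
  have sub: "blowup_times \<subseteq> {0..}" by (auto simp: blowup_times_def)
  have closedF: "closed (F n)" for n
  proof -
    have "F n = blowup_times \<inter> (\<Inter>x. {t\<in>{0..}. w x t \<in> {- real n..real n}})"
      using sub unfolding F_def by (auto simp: abs_le_iff minus_le_iff)
    moreover have "closed {t\<in>{0..}. w x t \<in> {- real n..real n}}" for x
      using continuous_closed_preimage[OF cont, of "{- real n..real n}" x]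
      by (simp add: vimage_def Int_def)
    ultimately show ?thesis using closed_blowup_times by (auto intro!: closed_Int closed_INT)
  qed
  have cover: "blowup_times \<subseteq> (\<Union>n. F n)"
  proof
    fix t assume t: "t \<in> blowup_times"
    then obtain B where B: "\<forall>x. \<bar>w x t\<bar> \<le> B" using bounded sub by blast
    obtain n where "B \<le> real n" using real_arch_simple by blast
    then have "t \<in> F n" using t B unfolding F_def by (auto intro: order_trans)
    then show "t \<in> (\<Union>n. F n)" by blast
  qed
  \<comment> \<open>If every relatively open set blowup_times - F n were dense in blowup_times, so
    would be their intersection, which is empty because the \<open>F n\<close> cover.\<close>
  have "\<exists>n. \<not> blowup_times \<subseteq> closure (blowup_times - F n)"
  proof (rule ccontr)
    assume "\<not> ?thesis"
    then have dense: "blowup_times \<subseteq> closure (blowup_times - F n)" for n by blast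
    have "openin (top_of_set blowup_times) (blowup_times - F n)" for n
      by (intro openin_diff openin_subtopology_self closed_subset closedF) (auto simp: F_def)
    then have "blowup_times \<subseteq> closure (\<Inter> (range (\<lambda>n. blowup_times - F n)))"
      using dense by (intro Baire closed_blowup_times) auto
    moreover have "\<Inter> (range (\<lambda>n. blowup_times - F n)) = {}" using cover by auto
    ultimately show False
      using \<open>blowup_times \<noteq> {}\<close> by (metis closure_empty subset_empty)
  qed
  then obtain n p where p: "p \<in> blowup_times" "p \<notin> closure (blowup_times - F n)" by blast
  then obtain e where e: "e > 0" "\<And>t. t \<in> blowup_times \<Longrightarrow> dist t p < e \<Longrightarrow> t \<in> F n"
    unfolding closure_approachable by blast
  \<comment> \<open>The first entry keeps blow-up times near \<open>p\<close> inside
    \<open>F n\<close>; the second makes every window of length \<open>d\<close> short enough for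
    the doubling bound.\<close>
  define d where "d = min e (1 / (2 * C))"
  have "d > 0" using e C_pos by (simp add: d_def)
  have "\<bar>w x t\<bar> \<le> 2 * real n" if t: "t \<ge> 0" "dist t p < d" for x t
  proof -
    have p0: "p \<ge> 0" using p sub by auto
    \<comment> \<open>The blow-up time nearest to \<open>t\<close> on the way from \<open>p\<close>:
      lying in \<open>F n\<close> it carries the bound \<open>n\<close>, and nothing blows up
      between it and \<open>t\<close>. So 2 * n bounds a whole neighbourhood of \<open>p\<close>,
      contradicting that \<open>p\<close> is a blow-up time.\<close>
    obtain q where q: "q \<in> blowup_times \<inter> closed_segment p t"
      "\<And>y. y \<in> blowup_times \<inter> closed_segment p t \<Longrightarrow> dist t q \<le> dist t y"
      using distance_attains_inf[of "blowup_times \<inter> closed_segment p t" t] closed_blowup_times p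
      by (metis IntI closed_Int closed_segment ends_in_segment(1) emptyE)
    have qd: "\<bar>q - p\<bar> < d" "\<bar>t - q\<bar> < d" "q \<ge> 0"
      using q(1) t p0 by (auto simp: closed_segment_eq_real_ivl dist_real_def split: if_splits)
    then have "q \<in> F n" using e(2)[of q] q(1) by (auto simp: d_def dist_real_def)
    show ?thesis
    proof (rule bound_from_endpoint[of q t])
      have "C * \<bar>t - q\<bar> \<le> C * (1 / (2 * C))"
        using qd C_pos by (intro mult_left_mono) (auto simp: d_def)
      then show "C * \<bar>t - q\<bar> \<le> 1/2" using C_pos by simp
      have "y \<notin> blowup_times" if y: "y \<in> closed_segment q t" "y \<noteq> q" for y
      proof
        assume "y \<in> blowup_times"
        moreover have "y \<in> closed_segment p t"
          using y(1) q(1) by (auto simp: closed_segment_eq_real_ivl split: if_splits)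
        ultimately have "dist t q \<le> dist t y" using q(2) by auto
        with y show False
          by (auto simp: closed_segment_eq_real_ivl dist_real_def split: if_splits)
      qed
      then show "(closed_segment q t - {q}) \<inter> blowup_times = {}" by auto
      show "\<exists>B. \<forall>x. \<bar>w x t\<bar> \<le> B" using bounded t by blast
    qed (use \<open>q \<in> F n\<close> qd t in \<open>auto simp: F_def\<close>)
  qed
  then have "bounded_over ({0..} \<inter> ball p d)"
    unfolding bounded_over_def by (auto simp: dist_commute intro!: exI[of _ "2 * real n"])
  then show False using p(1) \<open>d > 0\<close> by (auto simp: blowup_times_def)
qed

text \<open>Induction over successive windows of length 1 / (2 C): with zero data at the left end,
  the doubling bound on each window is 2 * 0.\<close>

lemma eq_zero:
  assumes bounded: "\<And>t. t \<ge> 0 \<Longrightarrow> \<exists>B. \<forall>x. \<bar>w x t\<bar> \<le> B"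
    and init: "\<And>x. w x 0 = 0" and "t \<ge> 0"
  shows "w x t = 0"
proof -
  define d where "d = 1 / (2 * C)"
  have "d > 0" using C_pos by (simp add: d_def)
  have "\<forall>x. \<forall>t\<in>{0..real n * d}. w x t = 0" for n
  proof (induction n)
    case 0
    then show ?case using init by simp
  next
    case (Suc n)
    have "\<bar>w x t\<bar> \<le> 2 * 0" if "t \<in> {real n * d..real (Suc n) * d}" for x t
    proof (rule window_interval[of "real n * d" "real (Suc n) * d" "real n * d"])
      show "bounded_over {real n * d..real (Suc n) * d}"
        using bounded_over_interval blowup_times_empty[OF bounded] \<open>d > 0\<close> by auto
      show "C * (real (Suc n) * d - real n * d) \<le> 1/2"
        using C_pos by (simp add: d_def field_simps)
    qed (use \<open>d > 0\<close> Suc that in \<open>auto simp: algebra_simps\<close>)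
    then show ?case using Suc by (metis abs_le_zero_iff atLeastAtMost_iff linear mult_zero_right)
  qed
  moreover obtain n where "t \<le> real n * d"
    using real_arch_simple[of "t / d"] \<open>d > 0\<close> by (auto simp: field_simps)
  ultimately show ?thesis using \<open>t \<ge> 0\<close> by auto
qed

end

section \<open>The symbol\<close>

text \<open>Chebyshev's recursion, in the variable 1 - cos \<theta> so that the order of vanishing
  at \<theta> = 0 can be read off at the origin of the polynomial variable.\<close>

lemma cos_multiple_poly:
  "\<exists>p :: real poly. degree p \<le> n \<and> (\<forall>\<theta>. cos (real n * \<theta>) = poly p (1 - cos \<theta>))"
proof (induction n rule: induct_nat_012)
  case 0
  then show ?case by (intro exI[of _ 1]) auto
next
  case 1
  then show ?case by (intro exI[of _ "[:1, -1:]"]) auto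
next
  case (ge2 n)
  then obtain p q :: "real poly" where p: "degree p \<le> n" "\<And>\<theta>. cos (real n * \<theta>) = poly p (1 - cos \<theta>)"
    and q: "degree q \<le> Suc n" "\<And>\<theta>. cos (real (Suc n) * \<theta>) = poly q (1 - cos \<theta>)" by blast
  have "cos (real (Suc (Suc n)) * \<theta>) = 2 * cos \<theta> * cos (real (Suc n) * \<theta>) - cos (real n * \<theta>)" for \<theta>
  proof -
    have "cos (real (Suc n) * \<theta> + \<theta>) + cos (real (Suc n) * \<theta> - \<theta>) = 2 * cos \<theta> * cos (real (Suc n) * \<theta>)"
      by (simp add: cos_add cos_diff)
    then show ?thesis by (simp add: algebra_simps)
  qed
  then have "cos (real (Suc (Suc n)) * \<theta>) = poly ([:2, -2:] * q - p) (1 - cos \<theta>)" for \<theta>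
    by (simp only: p q) (simp add: algebra_simps)
  moreover have "degree ([:2, -2:] * q - p) \<le> Suc (Suc n)"
  proof (rule degree_diff_le)
    show "degree ([:2, -2:] * q) \<le> Suc (Suc n)"
      using degree_mult_le[of "[:2,-2:] :: real poly" q] q(1) by simp
  qed (use p in simp)
  ultimately show ?case by blast
qed

text \<open>The estimate forces a zero of order \<open>N\<close> at the origin, and the degree
  leaves room for the top coefficient only. The induction strips one factor of the variable at a
  time.\<close>

lemma poly_flat_at_zero:
  fixes q :: "real poly"
  assumes "degree q \<le> N" "\<delta> > 0"
    and flat: "\<And>y. 0 < y \<Longrightarrow> y \<le> \<delta> \<Longrightarrow> \<bar>poly q y\<bar> \<le> C * y ^ N"
  shows "\<exists>c. q = monom c N"
  using assms(1,3)
proof (induction N arbitrary: q)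
  case 0
  then show ?case by (metis degree_0_id le_zero_eq monom_0)
next
  case (Suc N)
  have ev: "eventually (\<lambda>y. y \<in> {0<..<\<delta>}) (at_right 0)"
    using \<open>\<delta> > 0\<close> eventually_at_right_field by auto
  have "((\<lambda>y. poly q y) \<longlongrightarrow> poly q 0) (at_right 0)"
    by (intro tendsto_intros)
  moreover have "((\<lambda>y. poly q y) \<longlongrightarrow> 0) (at_right 0)"
  proof (rule Lim_null_comparison)
    show "eventually (\<lambda>y. norm (poly q y) \<le> C * y ^ Suc N) (at_right 0)"
      using ev by eventually_elim (use Suc.prems in auto)
    have "((\<lambda>y. C * y ^ Suc N) \<longlongrightarrow> C * 0 ^ Suc N) (at_right 0)"
      by (intro tendsto_intros)
    then show "((\<lambda>y. C * y ^ Suc N) \<longlongrightarrow> 0) (at_right 0)" by simp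
  qed
  ultimately have "poly q 0 = 0"
    using tendsto_unique trivial_limit_at_right_real by blast
  then obtain r where r: "q = pCons 0 r"
    by (cases q) auto
  have "\<exists>c. r = monom c N"
  proof (rule Suc.IH)
    show "degree r \<le> N" using Suc.prems(1) by (auto simp: r split: if_splits)
    fix y :: real assume y: "0 < y" "y \<le> \<delta>"
    then have "y * \<bar>poly r y\<bar> \<le> y * (C * y ^ N)"
      using Suc.prems(2)[OF y] by (simp add: r abs_mult algebra_simps)
    then show "\<bar>poly r y\<bar> \<le> C * y ^ N" using y by simp
  qed
  then show ?case using r by (auto simp: monom_Suc)
qed

lemma cos_taylor:
  fixes x :: real
  shows "\<bar>cos x - (\<Sum>k<n. (-1) ^ k * x ^ (2 * k) / fact (2 * k))\<bar> \<le> \<bar>x\<bar> ^ (2 * n) / fact (2 * n)"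
proof -
  obtain t where t: "cos x = (\<Sum>m<2 * n. cos_coeff m * x ^ m) + cos (t + 1/2 * real (2 * n) * pi) / fact (2 * n) * x ^ (2 * n)"
    using Maclaurin_cos_expansion[of x "2 * n"] by blast
  have "(\<Sum>m<2 * n. cos_coeff m * x ^ m) = (\<Sum>k<n. (-1) ^ k * x ^ (2 * k) / fact (2 * k))"
    by (induction n) (auto simp: cos_coeff_def)
  with t have "\<bar>cos x - (\<Sum>k<n. (-1) ^ k * x ^ (2 * k) / fact (2 * k))\<bar>
      = \<bar>cos (t + 1/2 * real (2 * n) * pi)\<bar> * (\<bar>x\<bar> ^ (2 * n) / fact (2 * n))"
    by (simp add: abs_mult power_abs)
  also have "\<dots> \<le> 1 * (\<bar>x\<bar> ^ (2 * n) / fact (2 * n))"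
    by (intro mult_right_mono) auto
  finally show ?thesis by simp
qed

text \<open>The constant terms of 1 - cos cancel, so the term with index n has order 2 (n + 1). This
  is the indexing of \<open>b_coeff\<close>, with the opposite sign.\<close>

lemma symbol_taylor:
  "\<bar>laplacian_symbol N a \<theta> -
     (\<Sum>n\<le>K. 2 * (-1) ^ n / fact (2 * (n + 1)) * (\<Sum>\<nu>=1..N. a \<nu> * real \<nu> ^ (2 * (n + 1))) * \<theta> ^ (2 * (n + 1)))\<bar>
   \<le> 2 * (\<Sum>\<nu>=1..N. \<bar>a \<nu>\<bar> * real \<nu> ^ (2 * (K + 2))) * \<bar>\<theta>\<bar> ^ (2 * (K + 2))"
proof -
  let ?T = "\<lambda>x::real. (\<Sum>k<K+2. (-1) ^ k * x ^ (2 * k) / fact (2 * k))"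
  have T: "?T x = 1 - (\<Sum>n\<le>K. (-1) ^ n * x ^ (2 * (n + 1)) / fact (2 * (n + 1)))" for x
    by (induction K) (simp_all add: numeral_2_eq_2)
  have "(\<Sum>n\<le>K. 2 * (-1) ^ n / fact (2 * (n + 1)) * (\<Sum>\<nu>=1..N. a \<nu> * real \<nu> ^ (2 * (n + 1))) * \<theta> ^ (2 * (n + 1)))
    = (\<Sum>n\<le>K. \<Sum>\<nu>=1..N. 2 * (a \<nu> * ((-1) ^ n * (real \<nu> * \<theta>) ^ (2 * (n + 1)) / fact (2 * (n + 1)))))"
    unfolding sum_distrib_left sum_distrib_right power_mult_distrib
    by (intro sum.cong refl) (simp add: mult_ac)
  also have "\<dots> = 2 * (\<Sum>\<nu>=1..N. a \<nu> * (1 - ?T (real \<nu> * \<theta>)))"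
    unfolding T by (subst sum.swap) (simp only: sum_distrib_left diff_diff_eq2 add_diff_cancel_left')
  finally have eq: "laplacian_symbol N a \<theta> -
     (\<Sum>n\<le>K. 2 * (-1) ^ n / fact (2 * (n + 1)) * (\<Sum>\<nu>=1..N. a \<nu> * real \<nu> ^ (2 * (n + 1))) * \<theta> ^ (2 * (n + 1)))
    = 2 * (\<Sum>\<nu>=1..N. a \<nu> * (?T (real \<nu> * \<theta>) - cos (real \<nu> * \<theta>)))"
    unfolding laplacian_symbol_def right_diff_distrib sum_subtractf by simp
  have "\<bar>2 * (\<Sum>\<nu>=1..N. a \<nu> * (?T (real \<nu> * \<theta>) - cos (real \<nu> * \<theta>)))\<bar> \<le> 2 * (\<Sum>\<nu>=1..N. \<bar>a \<nu>\<bar> * (\<bar>real \<nu> * \<theta>\<bar> ^ (2 * (K + 2))))"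
  proof -
    have "\<bar>\<Sum>\<nu>=1..N. a \<nu> * (?T (real \<nu> * \<theta>) - cos (real \<nu> * \<theta>))\<bar>
       \<le> (\<Sum>\<nu>=1..N. \<bar>a \<nu>\<bar> * \<bar>?T (real \<nu> * \<theta>) - cos (real \<nu> * \<theta>)\<bar>)"
      unfolding abs_mult[symmetric] by (rule sum_abs)
    also have "\<dots> \<le> (\<Sum>\<nu>=1..N. \<bar>a \<nu>\<bar> * (\<bar>real \<nu> * \<theta>\<bar> ^ (2 * (K + 2))))"
    proof (intro sum_mono mult_left_mono)
      fix \<nu>
      have "\<bar>?T (real \<nu> * \<theta>) - cos (real \<nu> * \<theta>)\<bar> \<le> \<bar>real \<nu> * \<theta>\<bar> ^ (2 * (K + 2)) / fact (2 * (K + 2))"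
        using cos_taylor[of "real \<nu> * \<theta>" "K + 2"] by (simp only: abs_minus_commute)
      also have "\<dots> \<le> \<bar>real \<nu> * \<theta>\<bar> ^ (2 * (K + 2)) / 1"
        by (intro divide_left_mono fact_ge_1) auto
      finally show "\<bar>?T (real \<nu> * \<theta>) - cos (real \<nu> * \<theta>)\<bar> \<le> \<bar>real \<nu> * \<theta>\<bar> ^ (2 * (K + 2))" by simp
    qed auto
    finally show ?thesis by (simp add: abs_mult)
  qed
  also have "2 * (\<Sum>\<nu>=1..N. \<bar>a \<nu>\<bar> * (\<bar>real \<nu> * \<theta>\<bar> ^ (2 * (K + 2))))
      = 2 * (\<Sum>\<nu>=1..N. \<bar>a \<nu>\<bar> * real \<nu> ^ (2 * (K + 2))) * \<bar>\<theta>\<bar> ^ (2 * (K + 2))"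
    unfolding sum_distrib_left sum_distrib_right
    by (intro sum.cong refl) (simp add: abs_mult power_mult_distrib)
  finally show ?thesis unfolding eq .
qed

section \<open>Positivity of the symbol away from the origin\<close>

locale stencil =
  fixes N :: nat and a :: "nat \<Rightarrow> real"
  assumes N_pos: "N \<ge> 1" and weights: "stencil_weights N a"
begin

abbreviation A :: "real \<Rightarrow> real" where
  "A \<equiv> laplacian_symbol N a"

lemma moments: "m \<in> {2..N} \<Longrightarrow> (\<Sum>\<nu>=1..N. a \<nu> * real \<nu> ^ (2 * m)) = 0"
  and moment_1: "(\<Sum>\<nu>=1..N. a \<nu> * real \<nu> ^ 2) = 1"
  using weights unfolding stencil_weights_def by blast+

definition A' :: "real \<Rightarrow> real" where
  "A' \<theta> = 2 * (\<Sum>\<nu>=1..N. a \<nu> * real \<nu> * sin (real \<nu> * \<theta>))"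

definition A'' :: "real \<Rightarrow> real" where
  "A'' \<theta> = 2 * (\<Sum>\<nu>=1..N. a \<nu> * real \<nu> ^ 2 * cos (real \<nu> * \<theta>))"

lemma A_deriv: "(A has_real_derivative A' \<theta>) (at \<theta>)"
  unfolding laplacian_symbol_def A'_def
  by (auto intro!: derivative_eq_intros sum.cong simp: sum_distrib_left mult_ac)

lemma A'_deriv: "(A' has_real_derivative A'' \<theta>) (at \<theta>)"
  unfolding A'_def A''_def
  by (auto intro!: derivative_eq_intros sum.cong simp: sum_distrib_left mult_ac power2_eq_square)

lemma continuous_on_A: "continuous_on S A"
  unfolding laplacian_symbol_def by (intro continuous_intros)

lemma A_minus [simp]: "A (- \<theta>) = A \<theta>"
  by (simp add: laplacian_symbol_def)

lemma A_0 [simp]: "A 0 = 0"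
  by (simp add: laplacian_symbol_def)

text \<open>The Taylor coefficients of \<open>A''\<close> of order 2k are multiples of the moments
  of order 2 (k + 1). For k < N exactly the normalised moment and the N - 1 vanishing ones
  occur.\<close>

lemma A''_flat: "\<exists>C. \<forall>\<theta>. \<bar>2 - A'' \<theta>\<bar> \<le> C * \<theta> ^ (2 * N)"
proof (intro exI allI)
  fix \<theta> :: real
  let ?T = "\<lambda>x::real. \<Sum>k<N. (-1) ^ k * x ^ (2 * k) / fact (2 * k)"
  have "(\<Sum>\<nu>=1..N. a \<nu> * real \<nu> ^ 2 * ?T (real \<nu> * \<theta>))
      = (\<Sum>k<N. (-1) ^ k * \<theta> ^ (2 * k) / fact (2 * k) * (\<Sum>\<nu>=1..N. a \<nu> * real \<nu> ^ (2 * (k + 1))))"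
    unfolding sum_distrib_left
    by (subst sum.swap, intro sum.cong refl) (simp add: power_mult_distrib power_add power2_eq_square mult_ac)
  also have "\<dots> = (\<Sum>k<N. if k = 0 then 1 else 0)"
  proof (intro sum.cong refl)
    fix k assume k: "k \<in> {..<N}"
    show "(-1) ^ k * \<theta> ^ (2 * k) / fact (2 * k) * (\<Sum>\<nu>=1..N. a \<nu> * real \<nu> ^ (2 * (k + 1)))
        = (if k = 0 then 1 else 0)"
      using moment_1 moments[of "k + 1"] k by (cases "k = 0") auto
  qed
  also have "\<dots> = 1" using N_pos by simp
  finally have "2 - A'' \<theta> = 2 * (\<Sum>\<nu>=1..N. a \<nu> * real \<nu> ^ 2 * (?T (real \<nu> * \<theta>) - cos (real \<nu> * \<theta>)))"
    unfolding A''_def right_diff_distrib sum_subtractf by simp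
  then have "\<bar>2 - A'' \<theta>\<bar> = 2 * \<bar>\<Sum>\<nu>=1..N. a \<nu> * real \<nu> ^ 2 * (?T (real \<nu> * \<theta>) - cos (real \<nu> * \<theta>))\<bar>"
    by (simp only: abs_mult abs_numeral)
  also have "\<dots> \<le> 2 * (\<Sum>\<nu>=1..N. \<bar>a \<nu>\<bar> * real \<nu> ^ 2 * (\<bar>real \<nu> * \<theta>\<bar> ^ (2 * N) / fact (2 * N)))"
  proof (rule mult_left_mono[OF order_trans[OF sum_abs sum_mono]])
    fix \<nu>
    have "\<bar>?T (real \<nu> * \<theta>) - cos (real \<nu> * \<theta>)\<bar> \<le> \<bar>real \<nu> * \<theta>\<bar> ^ (2 * N) / fact (2 * N)"
      using cos_taylor[of "real \<nu> * \<theta>" N] by (simp only: abs_minus_commute)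
    then show "\<bar>a \<nu> * real \<nu> ^ 2 * (?T (real \<nu> * \<theta>) - cos (real \<nu> * \<theta>))\<bar>
       \<le> \<bar>a \<nu>\<bar> * real \<nu> ^ 2 * (\<bar>real \<nu> * \<theta>\<bar> ^ (2 * N) / fact (2 * N))"
      unfolding abs_mult by (intro mult_mono) auto
  qed simp
  also have "\<dots> = (2 * (\<Sum>\<nu>=1..N. \<bar>a \<nu>\<bar> * real \<nu> ^ 2 * (real \<nu> ^ (2 * N) / fact (2 * N)))) * \<theta> ^ (2 * N)"
    unfolding sum_distrib_right sum_distrib_left
    by (intro sum.cong refl) (simp add: power_mult_distrib power_mult abs_mult)
  finally show "\<bar>2 - A'' \<theta>\<bar> \<le>
    (2 * (\<Sum>\<nu>=1..N. \<bar>a \<nu>\<bar> * real \<nu> ^ 2 * (real \<nu> ^ (2 * N) / fact (2 * N)))) * \<theta> ^ (2 * N)" .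
qed

text \<open>The left-hand side is a polynomial of degree at most \<open>N\<close> in \<open>1 - cos \<theta>\<close> which
  vanishes to order \<open>N\<close> at \<open>0\<close>; the constant is positive because \<open>A'\<close> vanishes at both \<open>0\<close>
  and \<open>pi\<close>.\<close>

lemma A''_closed_form: "\<exists>c>0. \<forall>\<theta>. 2 - A'' \<theta> = c * (1 - cos \<theta>) ^ N"
proof -
  obtain p where p: "\<And>n. degree (p n) \<le> n" "\<And>n \<theta>. cos (real n * \<theta>) = poly (p n) (1 - cos \<theta>)"
    using cos_multiple_poly by metis
  define q where "q = [:2:] - (\<Sum>\<nu>=1..N. smult (2 * a \<nu> * real \<nu> ^ 2) (p \<nu>))"
  have deg: "degree q \<le> N"
    unfolding q_def
  proof (intro degree_diff_le degree_sum_le)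
    show "degree (smult (2 * a \<nu> * real \<nu> ^ 2) (p \<nu>)) \<le> N" if "\<nu> \<in> {1..N}" for \<nu>
      using that p(1)[of \<nu>] degree_smult_le[of _ "p \<nu>"] by (meson atLeastAtMost_iff order_trans)
  qed auto
  have q: "poly q (1 - cos \<theta>) = 2 - A'' \<theta>" for \<theta>
    by (simp add: q_def A''_def poly_sum p(2)[symmetric] sum_distrib_left mult_ac)
  obtain C where C: "\<And>\<theta>. \<bar>2 - A'' \<theta>\<bar> \<le> C * \<theta> ^ (2 * N)"
    using A''_flat by blast
  have "0 \<le> C" using C[of 1] by auto
  have "\<exists>c. q = monom c N"
  proof (rule poly_flat_at_zero[OF deg])
    show "1 - cos 1 > (0::real)"
      using cos_monotone_0_pi[of 0 1] pi_gt3 by simp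
    fix y :: real assume y: "0 < y" "y \<le> 1 - cos 1"
    define \<theta> where "\<theta> = arccos (1 - y)"
    have y2: "1 - y \<ge> -1" using y cos_ge_minus_one[of 1] by linarith
    have y_eq: "y = 1 - cos \<theta>" using y y2 by (simp add: \<theta>_def)
    have \<theta>: "0 \<le> \<theta>" "\<theta> \<le> 1"
    proof -
      show "0 \<le> \<theta>" unfolding \<theta>_def using y y2 by (intro arccos_lbound) auto
      have "arccos (1 - y) \<le> arccos (cos 1)"
        using y y2 by (intro arccos_le_arccos) auto
      then show "\<theta> \<le> 1" using pi_gt3 by (simp add: \<theta>_def arccos_cos)
    qed
    have "(\<Sum>k<2. (-1) ^ k * \<theta> ^ (2 * k) / fact (2 * k)) = 1 - \<theta>\<^sup>2 / 2"
      by (simp add: numeral_2_eq_2)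
    moreover have "\<bar>\<theta>\<bar> ^ (2 * 2) / fact (2 * 2) = \<theta> ^ 4 / 24"
      by (simp add: fact_numeral)
    \<comment> \<open>On [0, 1] the quartic term is at most \<theta>^2 / 24, so y is at least 11/24
      of \<theta>^2. The resulting \<theta>^2 \<le> 4 * y converts flatness in \<theta> into
      flatness in y and explains the factor 4 ^ N.\<close>
    ultimately have "cos \<theta> \<le> 1 - \<theta>\<^sup>2 / 2 + \<theta> ^ 4 / 24"
      using cos_taylor[of \<theta> 2] by linarith
    moreover have "\<theta> ^ 4 \<le> \<theta>\<^sup>2" using \<theta> by (intro power_decreasing) auto
    ultimately have "\<theta>\<^sup>2 \<le> 4 * y" using y_eq zero_le_power2[of \<theta>] by linarith
    then have "(\<theta>\<^sup>2) ^ N \<le> (4 * y) ^ N" by (intro power_mono) auto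
    then have "C * \<theta> ^ (2 * N) \<le> C * (4 * y) ^ N"
      using \<open>0 \<le> C\<close> by (simp add: power_mult mult_left_mono)
    then show "\<bar>poly q y\<bar> \<le> (C * 4 ^ N) * y ^ N"
      using C[of \<theta>] q[of \<theta>] unfolding y_eq[symmetric] by (simp add: power_mult_distrib mult_ac)
  qed
  then obtain c where "q = monom c N" by blast
  then have c: "2 - A'' \<theta> = c * (1 - cos \<theta>) ^ N" for \<theta>
    using q[of \<theta>] by (simp add: poly_monom)
  have "c > 0"
  proof (rule ccontr)
    assume "\<not> c > 0"
    have "A'' \<theta> > 0" for \<theta>
      using c[of \<theta>] mult_nonpos_nonneg[of c "(1 - cos \<theta>) ^ N"] \<open>\<not> c > 0\<close> by auto
    then have "A' 0 < A' pi"
      by (intro DERIV_pos_imp_increasing[of 0 pi A']) (auto intro: A'_deriv)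
    then show False by (simp add: A'_def)
  qed
  then show ?thesis using c by blast
qed

lemma A''_strict_antimono: "0 \<le> x \<Longrightarrow> x < y \<Longrightarrow> y \<le> pi \<Longrightarrow> A'' y < A'' x"
proof -
  assume xy: "0 \<le> x" "x < y" "y \<le> pi"
  obtain c where c: "c > 0" "\<And>\<theta>. 2 - A'' \<theta> = c * (1 - cos \<theta>) ^ N"
    using A''_closed_form by blast
  have "cos y < cos x" using xy by (intro cos_monotone_0_pi) auto
  then have "(1 - cos x) ^ N < (1 - cos y) ^ N"
    using N_pos by (intro power_strict_mono) auto
  then have "c * (1 - cos x) ^ N < c * (1 - cos y) ^ N" using c(1) by simp
  then show ?thesis using c(2)[of x] c(2)[of y] by linarith
qed

text \<open>\<open>A''\<close> is decreasing. If it is nonnegative at \<theta>, then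
  \<open>A'\<close> has risen from its zero at 0; if it is negative there, then \<open>A'\<close>
  still has to fall to its zero at pi.\<close>

lemma A'_pos:
  assumes "0 < \<theta>" "\<theta> < pi"
  shows "A' \<theta> > 0"
proof (cases "A'' \<theta> \<ge> 0")
  case True
  obtain z where z: "0 < z" "z < \<theta>" "A' \<theta> - A' 0 = (\<theta> - 0) * A'' z"
    using MVT2[of 0 \<theta> A' A''] A'_deriv assms by blast
  have "A'' z > 0" using A''_strict_antimono[of z \<theta>] z assms True by simp
  then show ?thesis using z assms by (simp add: A'_def)
next
  case False
  obtain z where z: "\<theta> < z" "z < pi" "A' pi - A' \<theta> = (pi - \<theta>) * A'' z"
    using MVT2[of \<theta> pi A' A''] A'_deriv assms by blast
  have "A'' z < 0" using A''_strict_antimono[of \<theta> z] z assms False by simp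
  moreover have "A' pi = 0" by (simp add: A'_def)
  ultimately show ?thesis using z assms mult_pos_neg[of "pi - \<theta>" "A'' z"] by simp
qed

lemma A_pos:
  assumes "\<theta> \<noteq> 0" "\<bar>\<theta>\<bar> \<le> pi"
  shows "A \<theta> > 0"
proof -
  have pos: "A \<theta> > 0" if \<theta>: "0 < \<theta>" "\<theta> \<le> pi" for \<theta>
  proof -
    obtain z where z: "0 < z" "z < \<theta>" "A \<theta> - A 0 = (\<theta> - 0) * A' z"
      using MVT2[of 0 \<theta> A A'] A_deriv \<theta> by blast
    then show ?thesis using A'_pos[of z] \<theta> by simp
  qed
  show ?thesis using pos[of \<theta>] pos[of "- \<theta>"] assms by (cases "\<theta> > 0") auto
qed

section \<open>Taylor expansion and quadratic lower bound of the symbol\<close>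

lemma A_taylor:
  "\<exists>C\<ge>0. \<forall>\<theta>. \<bar>\<theta>\<^sup>2 - A \<theta> - (\<Sum>n=N..K. b_coeff N a n * \<theta> ^ (2 * (n + 1)))\<bar> \<le> C * \<theta> ^ (2 * (K + 2))"
proof (intro exI conjI allI)
  fix \<theta> :: real
  let ?f = "\<lambda>n. 2 * (-1) ^ n / fact (2 * (n + 1)) * (\<Sum>\<nu>=1..N. a \<nu> * real \<nu> ^ (2 * (n + 1))) * \<theta> ^ (2 * (n + 1))"
  \<comment> \<open>The first moment turns the term n = 0 into \<theta>^2, the vanishing moments
    remove 0 < n < N, and the remaining terms are those of \<open>b_coeff\<close> with the sign
    reversed.\<close>
  have f: "?f n = (if n = 0 then \<theta>\<^sup>2 else 0) - (if N \<le> n then b_coeff N a n * \<theta> ^ (2 * (n + 1)) else 0)" for n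
  proof (cases "n = 0")
    case True
    then show ?thesis using moment_1 N_pos by simp
  next
    case False
    show ?thesis
    proof (cases "N \<le> n")
      case True
      then show ?thesis using False by (simp add: b_coeff_def)
    next
      case not_le: False
      then have "n + 1 \<in> {2..N}" using False by auto
      then show ?thesis using False not_le by (simp only: moments) simp
    qed
  qed
  have "(\<Sum>n\<le>K. ?f n) = \<theta>\<^sup>2 - (\<Sum>n\<in>{..K} \<inter> {n. N \<le> n}. b_coeff N a n * \<theta> ^ (2 * (n + 1)))"
    unfolding f sum_subtractf by (subst sum.inter_restrict) auto
  also have "{..K} \<inter> {n. N \<le> n} = {N..K}" by auto
  finally have "\<theta>\<^sup>2 - A \<theta> - (\<Sum>n=N..K. b_coeff N a n * \<theta> ^ (2 * (n + 1))) = - (A \<theta> - (\<Sum>n\<le>K. ?f n))"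
    by linarith
  moreover have "\<bar>\<theta>\<bar> ^ (2 * (K + 2)) = \<theta> ^ (2 * (K + 2))"
    by (intro power_even_abs) simp
  ultimately show "\<bar>\<theta>\<^sup>2 - A \<theta> - (\<Sum>n=N..K. b_coeff N a n * \<theta> ^ (2 * (n + 1)))\<bar>
     \<le> (2 * (\<Sum>\<nu>=1..N. \<bar>a \<nu>\<bar> * real \<nu> ^ (2 * (K + 2)))) * \<theta> ^ (2 * (K + 2))"
    using symbol_taylor[of N a \<theta> K] by (simp only: abs_minus_cancel)
qed (auto intro!: sum_nonneg)

lemma A_near: "\<exists>C\<ge>0. \<forall>\<theta>. \<bar>A \<theta> - \<theta>\<^sup>2\<bar> \<le> C * \<theta> ^ 4"
  \<comment> \<open>For K = 0 the range {N..0} is empty, so only the remainder of order 4 is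
    left.\<close>
  using A_taylor[of 0] N_pos by (auto simp: abs_minus_commute)

text \<open>Below \<open>d\<close> the quartic error is at most half of \<theta>^2; beyond
  \<open>d\<close> the positive minimum of \<open>A\<close> on a compact interval is compared with
  pi^2. The condition c \<le> 1 lets exp (- c t \<theta>^2) dominate exp (- t \<theta>^2) as well as
  exp (- t A).\<close>

lemma A_lower: "\<exists>c>0. c \<le> 1 \<and> (\<forall>\<theta>. \<bar>\<theta>\<bar> \<le> pi \<longrightarrow> c * \<theta>\<^sup>2 \<le> A \<theta>)"
proof -
  obtain C where C: "C \<ge> 0" "\<And>\<theta>. \<bar>A \<theta> - \<theta>\<^sup>2\<bar> \<le> C * \<theta> ^ 4" using A_near by blast
  define d where "d = min 1 (1 / (2 * (C + 1)))"
  have d: "0 < d" "d \<le> 1" "d * (2 * (C + 1)) \<le> 1"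
    using C(1) by (auto simp: d_def min_def field_simps)
  have "compact {d..pi}" "{d..pi} \<noteq> {}" using d pi_gt3 by auto
  then obtain z where z: "z \<in> {d..pi}" "\<And>y. y \<in> {d..pi} \<Longrightarrow> A z \<le> A y"
    using continuous_attains_inf[of "{d..pi}" A] continuous_on_A by blast
  have Az: "A z > 0" using A_pos z d by auto
  define c where "c = min (1/2) (A z / pi\<^sup>2)"
  have c: "c > 0" "c \<le> 1/2" "c * pi\<^sup>2 \<le> A z" using Az by (auto simp: c_def min_def field_simps)
  have "c * \<theta>\<^sup>2 \<le> A \<theta>" if \<theta>: "0 \<le> \<theta>" "\<theta> \<le> pi" for \<theta>
  proof (cases "\<theta> \<le> d")
    case True
    have "\<theta>\<^sup>2 * (2 * C) \<le> 1"
    proof -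
      have "\<theta>\<^sup>2 \<le> \<theta> * 1"
        using True d \<theta> unfolding power2_eq_square by (intro mult_left_mono) auto
      then have "\<theta>\<^sup>2 * (2 * C) \<le> d * (2 * (C + 1))"
        using True d \<theta> C by (intro mult_mono) auto
      then show ?thesis using d by linarith
    qed
    then have "\<theta>\<^sup>2 * (\<theta>\<^sup>2 * (2 * C)) \<le> \<theta>\<^sup>2 * 1" by (intro mult_left_mono) auto
    then have "C * \<theta> ^ 4 \<le> \<theta>\<^sup>2 / 2" by (simp add: power2_eq_square power4_eq_xxxx algebra_simps)
    moreover have "c * \<theta>\<^sup>2 \<le> 1/2 * \<theta>\<^sup>2" using c by (intro mult_right_mono) auto
    ultimately show ?thesis using C(2)[of \<theta>] by linarith
  next
    case False
    have "c * \<theta>\<^sup>2 \<le> c * pi\<^sup>2" using \<theta> c by (intro mult_left_mono power_mono) auto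
    then show ?thesis using z(2)[of \<theta>] False \<theta> c(3) by simp
  qed note * = this
  have "c * \<theta>\<^sup>2 \<le> A \<theta>" if "\<bar>\<theta>\<bar> \<le> pi" for \<theta>
    using *[of \<theta>] *[of "- \<theta>"] that by (cases "\<theta> \<ge> 0") auto
  then show ?thesis using c by (intro exI[of _ c]) auto
qed

end

section \<open>The Green functions as Fourier integrals\<close>

text \<open>The integral of exp (- s z) over s from 0 to t, written with its removable singularity
  filled in, so that the zero of \<open>A\<close> at \<theta> = 0 needs no special
  treatment.\<close>

definition exp_kernel :: "real \<Rightarrow> real \<Rightarrow> real" where
  "exp_kernel t z = (if z = 0 then t else (1 - exp (- (t * z))) / z)"

lemma exp_kernel_0 [simp]: "exp_kernel 0 z = 0"
  by (simp add: exp_kernel_def)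

lemma exp_kernel_mult: "z * exp_kernel t z = 1 - exp (- (t * z))"
  by (simp add: exp_kernel_def)

lemma exp_kernel_deriv: "((\<lambda>t. exp_kernel t z) has_real_derivative exp (- (t * z))) (at t)"
proof (cases "z = 0")
  case False
  have "((\<lambda>t. (1 - exp (- (t * z))) / z) has_real_derivative exp (- (t * z))) (at t)"
    by (rule derivative_eq_intros refl | use False in simp)+
  with False show ?thesis by (simp add: exp_kernel_def[abs_def])
qed (simp add: exp_kernel_def[abs_def])

lemma continuous_on_exp_kernel: "continuous_on S (exp_kernel t)"
proof -
  have "isCont (exp_kernel t) z" for z
  proof (cases "z = 0")
    case True
    have "((\<lambda>z. 1 - exp (- (t * z))) has_real_derivative t) (at 0)"
      by (auto intro!: derivative_eq_intros)
    then have "((\<lambda>z. (1 - exp (- (t * z))) / z) \<longlongrightarrow> t) (at 0)"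
      by (simp add: DERIV_def)
    then have "(exp_kernel t \<longlongrightarrow> t) (at 0)"
      by (rule filterlim_cong[THEN iffD1, rotated -1])
         (auto simp: exp_kernel_def eventually_at_filter)
    with True show ?thesis by (simp add: isCont_def exp_kernel_def)
  next
    case False
    have "eventually (\<lambda>z. z \<noteq> (0::real)) (nhds z)"
      using False t1_space_nhds by blast
    then have "eventually (\<lambda>z. exp_kernel t z = (1 - exp (- (t * z))) / z) (nhds z)"
      by eventually_elim (simp add: exp_kernel_def)
    moreover have "isCont (\<lambda>z. (1 - exp (- (t * z))) / z) z"
      using False by (intro continuous_intros)
    ultimately show ?thesis by (subst isCont_cong)
  qed
  then show ?thesis by (simp add: continuous_at_imp_continuous_on)
qed

lemma integral_cos_int:
  "integral {-pi..pi} (\<lambda>\<theta>. cos (real_of_int k * \<theta>)) = (if k = 0 then 2 * pi else 0)"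
proof (cases "k = 0")
  case False
  have "((\<lambda>\<theta>. cos (real_of_int k * \<theta>)) has_integral
      (sin (real_of_int k * pi) / real_of_int k - sin (real_of_int k * (- pi)) / real_of_int k)) {-pi..pi}"
    using False
    by (intro fundamental_theorem_of_calculus)
       (auto intro!: derivative_eq_intros simp: has_real_derivative_iff_has_vector_derivative[symmetric])
  then show ?thesis using False by (auto simp: sin_int_times_real mult.commute dest!: integral_unique)
qed simp

context stencil
begin

text \<open>The solution of the homogeneous equation with datum \<delta>. As \<open>A\<close> is
  even, the Fourier integral takes the real form with a cosine; real \<open>x\<close> is allowed
  because the asymptotic expansion does not depend on integrality.\<close>

definition first_green :: "real \<Rightarrow> real \<Rightarrow> real" where
  "first_green x t = 1 / (2 * pi) * integral {-pi..pi} (\<lambda>\<theta>. exp (- (t * A \<theta>)) * cos (x * \<theta>))"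

definition green_integral :: "real \<Rightarrow> real \<Rightarrow> real" where
  "green_integral x t = 1 / (2 * pi) * integral {-pi..pi} (\<lambda>\<theta>. exp_kernel t (A \<theta>) * cos (x * \<theta>))"

lemma continuous_on_exp_kernel_A: "continuous_on S (\<lambda>\<theta>. exp_kernel t (A \<theta>))"
  using continuous_on_compose2[OF continuous_on_exp_kernel continuous_on_A] by blast

lemma integrable_exp_kernel_A: "(\<lambda>\<theta>. exp_kernel t (A \<theta>) * cos (x * \<theta>)) integrable_on {-pi..pi}"
  by (intro integrable_continuous_real continuous_intros continuous_on_exp_kernel_A)

lemma green_integral_deriv: "(green_integral x has_real_derivative first_green x t) (at t)"
proof -
  have "continuous_on (UNIV \<times> cbox (-pi) pi) (\<lambda>(t::real, \<theta>). exp (- (t * A \<theta>)) * cos (x * \<theta>))"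
    unfolding split_beta
    by (intro continuous_intros continuous_on_compose2[OF continuous_on_A[of UNIV]]) auto
  then have "((\<lambda>t. integral (cbox (-pi) pi) (\<lambda>\<theta>. exp_kernel t (A \<theta>) * cos (x * \<theta>))) has_real_derivative
      integral (cbox (-pi) pi) (\<lambda>\<theta>. exp (- (t * A \<theta>)) * cos (x * \<theta>))) (at t within UNIV)"
    using integrable_exp_kernel_A[of _ x]
    by (intro leibniz_rule_field_derivative DERIV_cmult_right exp_kernel_deriv) auto
  then show ?thesis
    unfolding first_green_def[abs_def] green_integral_def[abs_def]
    by (intro DERIV_cmult) simp
qed

lemma green_integral_minus: "green_integral (- x) t = green_integral x t"
  by (simp add: green_integral_def)

lemma green_integral_0: "green_integral x 0 = 0"
  by (simp add: green_integral_def)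

lemma green_integral_bounded: "\<exists>B. \<forall>x. \<bar>green_integral x t\<bar> \<le> B"
proof (intro exI allI)
  fix x
  have "norm (integral {-pi..pi} (\<lambda>\<theta>. exp_kernel t (A \<theta>) * cos (x * \<theta>)))
      \<le> integral {-pi..pi} (\<lambda>\<theta>. \<bar>exp_kernel t (A \<theta>)\<bar>)"
    using mult_left_mono[OF abs_cos_le_one]
    by (intro integral_norm_bound_integral integrable_exp_kernel_A integrable_continuous_real
          continuous_intros continuous_on_exp_kernel_A) (auto simp: abs_mult mult_left_le)
  then show "\<bar>green_integral x t\<bar> \<le> 1 / (2 * pi) * integral {-pi..pi} (\<lambda>\<theta>. \<bar>exp_kernel t (A \<theta>)\<bar>)"
    by (simp add: green_integral_def abs_mult divide_right_mono)
qed

text \<open>Cosines are eigenfunctions of the discrete Laplacian. Real \<open>x\<close> makes this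
  usable under the integral sign and again for the second difference of \<Omega>.\<close>

lemma laplacian_cos:
  "(\<Sum>\<nu>=1..N. a \<nu> * (cos ((x - real \<nu>) * \<theta>) - 2 * cos (x * \<theta>) + cos ((x + real \<nu>) * \<theta>)))
   = - A \<theta> * cos (x * \<theta>)"
proof -
  have *: "cos ((x - real \<nu>) * \<theta>) - 2 * cos (x * \<theta>) + cos ((x + real \<nu>) * \<theta>)
      = - 2 * (1 - cos (real \<nu> * \<theta>)) * cos (x * \<theta>)" for \<nu>
    by (simp add: left_diff_distrib distrib_right cos_add cos_diff algebra_simps)
  have "(\<Sum>\<nu>=1..N. a \<nu> * (cos ((x - real \<nu>) * \<theta>) - 2 * cos (x * \<theta>) + cos ((x + real \<nu>) * \<theta>)))
      = (\<Sum>\<nu>=1..N. (- 2 * cos (x * \<theta>)) * (a \<nu> * (1 - cos (real \<nu> * \<theta>))))"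
    unfolding * by (intro sum.cong refl) (simp only: mult_ac)
  also have "\<dots> = - A \<theta> * cos (x * \<theta>)"
    unfolding laplacian_symbol_def sum_distrib_left[symmetric] by simp
  finally show ?thesis .
qed

text \<open>The eigenvalue - A cancels the denominator of the kernel. What remains is
  \<open>first_green\<close> minus the integral of a cosine over a full period, which is 2 pi
  \<delta>.\<close>

lemma green_integral_equation:
  "first_green (real_of_int x) t - discrete_laplacian N a (\<lambda>y. green_integral (real_of_int y) t) x
   = (if x = 0 then 1 else 0)"
proof -
  let ?I = "\<lambda>x. integral {-pi..pi} (\<lambda>\<theta>. exp_kernel t (A \<theta>) * cos (x * \<theta>))"
  have "((\<lambda>\<theta>. \<Sum>\<nu>=1..N. a \<nu> * (exp_kernel t (A \<theta>) * cos ((real_of_int x - real \<nu>) * \<theta>)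
         - 2 * (exp_kernel t (A \<theta>) * cos (real_of_int x * \<theta>))
         + exp_kernel t (A \<theta>) * cos ((real_of_int x + real \<nu>) * \<theta>)))
       has_integral (\<Sum>\<nu>=1..N. a \<nu> * (?I (real_of_int x - real \<nu>) - 2 * ?I (real_of_int x) + ?I (real_of_int x + real \<nu>))))
       {-pi..pi}"
    by (intro has_integral_sum has_integral_mult_right has_integral_add has_integral_diff
          integrable_integral integrable_exp_kernel_A) auto
  also have "(\<Sum>\<nu>=1..N. a \<nu> * (?I (real_of_int x - real \<nu>) - 2 * ?I (real_of_int x) + ?I (real_of_int x + real \<nu>)))
     = 2 * pi * discrete_laplacian N a (\<lambda>y. green_integral (real_of_int y) t) x"
    unfolding discrete_laplacian_def sum_distrib_left
    by (intro sum.cong refl) (simp add: green_integral_def field_simps)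
  also have "(\<lambda>\<theta>. \<Sum>\<nu>=1..N. a \<nu> * (exp_kernel t (A \<theta>) * cos ((real_of_int x - real \<nu>) * \<theta>)
         - 2 * (exp_kernel t (A \<theta>) * cos (real_of_int x * \<theta>))
         + exp_kernel t (A \<theta>) * cos ((real_of_int x + real \<nu>) * \<theta>)))
     = (\<lambda>\<theta>. exp (- (t * A \<theta>)) * cos (real_of_int x * \<theta>) - cos (real_of_int x * \<theta>))"
  proof
    fix \<theta>
    have "(\<Sum>\<nu>=1..N. a \<nu> * (exp_kernel t (A \<theta>) * cos ((real_of_int x - real \<nu>) * \<theta>)
         - 2 * (exp_kernel t (A \<theta>) * cos (real_of_int x * \<theta>))
         + exp_kernel t (A \<theta>) * cos ((real_of_int x + real \<nu>) * \<theta>)))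
      = (\<Sum>\<nu>=1..N. exp_kernel t (A \<theta>) * (a \<nu> * (cos ((real_of_int x - real \<nu>) * \<theta>)
         - 2 * cos (real_of_int x * \<theta>) + cos ((real_of_int x + real \<nu>) * \<theta>))))"
      by (intro sum.cong refl) (simp add: ring_distribs mult_ac)
    also have "\<dots> = exp_kernel t (A \<theta>) * (- A \<theta> * cos (real_of_int x * \<theta>))"
      unfolding sum_distrib_left[symmetric] laplacian_cos ..
    also have "\<dots> = - (A \<theta> * exp_kernel t (A \<theta>)) * cos (real_of_int x * \<theta>)" by simp
    also have "\<dots> = exp (- (t * A \<theta>)) * cos (real_of_int x * \<theta>) - cos (real_of_int x * \<theta>)"
      unfolding exp_kernel_mult by (simp add: algebra_simps)
    finally show "(\<Sum>\<nu>=1..N. a \<nu> * (exp_kernel t (A \<theta>) * cos ((real_of_int x - real \<nu>) * \<theta>)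
         - 2 * (exp_kernel t (A \<theta>) * cos (real_of_int x * \<theta>))
         + exp_kernel t (A \<theta>) * cos ((real_of_int x + real \<nu>) * \<theta>)))
      = exp (- (t * A \<theta>)) * cos (real_of_int x * \<theta>) - cos (real_of_int x * \<theta>)" .
  qed
  finally have 1: "((\<lambda>\<theta>. exp (- (t * A \<theta>)) * cos (real_of_int x * \<theta>) - cos (real_of_int x * \<theta>))
    has_integral 2 * pi * discrete_laplacian N a (\<lambda>y. green_integral (real_of_int y) t) x) {-pi..pi}" .
  have "((\<lambda>\<theta>. exp (- (t * A \<theta>)) * cos (real_of_int x * \<theta>) - cos (real_of_int x * \<theta>))
    has_integral integral {-pi..pi} (\<lambda>\<theta>. exp (- (t * A \<theta>)) * cos (real_of_int x * \<theta>))
       - integral {-pi..pi} (\<lambda>\<theta>. cos (real_of_int x * \<theta>))) {-pi..pi}"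
    by (intro has_integral_diff integrable_integral integrable_continuous_real continuous_intros continuous_on_A)
  then have "integral {-pi..pi} (\<lambda>\<theta>. exp (- (t * A \<theta>)) * cos (real_of_int x * \<theta>))
       - (if x = 0 then 2 * pi else 0)
     = 2 * pi * discrete_laplacian N a (\<lambda>y. green_integral (real_of_int y) t) x"
    using has_integral_unique[OF 1] unfolding integral_cos_int by simp
  then show ?thesis
    unfolding first_green_def by (auto simp: field_simps split: if_splits)
qed

lemma discrete_laplacian_bound:
  assumes "\<And>y. \<bar>u y\<bar> \<le> M"
  shows "\<bar>discrete_laplacian N a u x\<bar> \<le> 4 * (\<Sum>\<nu>=1..N. \<bar>a \<nu>\<bar>) * M"
proof -
  have "\<bar>discrete_laplacian N a u x\<bar> \<le> (\<Sum>\<nu>=1..N. \<bar>a \<nu>\<bar> * \<bar>u (x - int \<nu>) - 2 * u x + u (x + int \<nu>)\<bar>)"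
    unfolding discrete_laplacian_def abs_mult[symmetric] by (rule sum_abs)
  also have "\<dots> \<le> (\<Sum>\<nu>=1..N. \<bar>a \<nu>\<bar> * (4 * M))"
  proof (intro sum_mono mult_left_mono)
    fix \<nu> show "\<bar>u (x - int \<nu>) - 2 * u x + u (x + int \<nu>)\<bar> \<le> 4 * M"
      using assms[of "x - int \<nu>"] assms[of x] assms[of "x + int \<nu>"] by linarith
  qed auto
  finally show ?thesis by (simp add: sum_distrib_left sum_distrib_right mult_ac)
qed

lemma discrete_laplacian_diff:
  "discrete_laplacian N a (\<lambda>y. u y - w y) x = discrete_laplacian N a u x - discrete_laplacian N a w x"
  unfolding discrete_laplacian_def sum_subtractf[symmetric]
  by (intro sum.cong refl) (simp add: algebra_simps)

lemma second_green_function_eq: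
  assumes v: "second_green_function N a v" and "t \<ge> 0"
  shows "v x t = green_integral (real_of_int x) t"
proof -
  obtain v' where v': "\<And>x. C1_halfline (v x) (v' x)"
    "\<And>x t. t > 0 \<Longrightarrow> v' x t - discrete_laplacian N a (\<lambda>y. v y t) x = (if x = 0 then 1 else 0)"
    using v unfolding second_green_function_def by blast
  define w where "w x t = v x t - green_integral (real_of_int x) t" for x t
  define w' where "w' x t = v' x t - first_green (real_of_int x) t" for x t
  have deriv: "(w x has_real_derivative w' x t) (at t within {0..})" if "t \<ge> 0" for x t
    unfolding w_def[abs_def] w'_def
    using v'(1)[of x] that
    by (intro DERIV_diff DERIV_subset[OF green_integral_deriv]) (auto simp: C1_halfline_def)
  \<comment> \<open>The summand 1 makes the rate strictly positive, whatever the weights.\<close>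
  interpret bounded_rate_evolution w w' "4 * (\<Sum>\<nu>=1..N. \<bar>a \<nu>\<bar>) + 1"
  proof
    show "(w x has_real_derivative w' x t) (at t)" if "t > 0" for x t
      using deriv[of t x] at_within_interior[of t "{0..}"] that by (simp add: interior_real_atLeast)
    show "continuous_on {0..} (w x)" for x
      unfolding continuous_on_eq_continuous_within using DERIV_continuous[OF deriv] by simp
    show "\<bar>w' x t\<bar> \<le> (4 * (\<Sum>\<nu>=1..N. \<bar>a \<nu>\<bar>) + 1) * M" if "t > 0" "\<And>y. \<bar>w y t\<bar> \<le> M" for x t M
    proof -
      have "w' x t = discrete_laplacian N a (\<lambda>y. w y t) x"
        using v'(2)[OF that(1), of x] green_integral_equation[of x t]
        unfolding w_def w'_def discrete_laplacian_diff by simp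
      moreover have "0 \<le> M" using that(2)[of x] by linarith
      ultimately show ?thesis
        using discrete_laplacian_bound[of "\<lambda>y. w y t" M x, OF that(2)] by (simp add: distrib_right)
    qed
    show "0 < 4 * (\<Sum>\<nu>=1..N. \<bar>a \<nu>\<bar>) + 1"
      by (intro add_nonneg_pos mult_nonneg_nonneg sum_nonneg) auto
  qed
  have "w x t = 0"
  proof (rule eq_zero)
    fix t :: real assume "t \<ge> 0"
    then have "rapidly_decreasing (\<lambda>x. v x t)"
      using v unfolding second_green_function_def by blast
    \<comment> \<open>The exponent 0 in the definition of rapid decrease is plain
      boundedness.\<close>
    then have "\<exists>C. \<forall>x. \<bar>real_of_int x\<bar> ^ 0 * \<bar>v x t\<bar> \<le> C"
      unfolding rapidly_decreasing_def by blast
    then obtain C where C: "\<And>x. \<bar>v x t\<bar> \<le> C" by auto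
    obtain B where B: "\<And>x. \<bar>green_integral x t\<bar> \<le> B" using green_integral_bounded by blast
    have "\<bar>w x t\<bar> \<le> C + B" for x
      using C[of x] B[of x] unfolding w_def by linarith
    then show "\<exists>B. \<forall>x. \<bar>w x t\<bar> \<le> B" by blast
  next
    show "w x 0 = 0" for x
      using v unfolding w_def second_green_function_def by (simp add: green_integral_0)
  qed fact
  then show ?thesis by (simp add: w_def)
qed

end

section \<open>Gaussian integrals\<close>

lemma integrable_gauss_moment:
  assumes "c > 0"
  shows "integrable lborel (\<lambda>x::real. \<bar>x\<bar> ^ k * exp (- (c * x\<^sup>2)))"
proof -
  \<comment> \<open>The standard deviation for which the normal density is a multiple of exp (- c
    x^2).\<close>
  define s where "s = sqrt (1 / (2 * c))"
  have s: "s > 0" "2 * s\<^sup>2 = 1 / c" using assms by (auto simp: s_def)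
  have "integrable lborel (\<lambda>x. sqrt (2 * pi * s\<^sup>2) * (normal_density 0 s x * \<bar>x - 0\<bar> ^ k))"
    using integrable_normal_moment_abs[OF s(1)] by (rule integrable_mult_right)
  also have "(\<lambda>x. sqrt (2 * pi * s\<^sup>2) * (normal_density 0 s x * \<bar>x - 0\<bar> ^ k))
    = (\<lambda>x. \<bar>x\<bar> ^ k * exp (- (c * x\<^sup>2)))"
  proof
    fix x
    have "x\<^sup>2 / (2 * s\<^sup>2) = c * x\<^sup>2" unfolding s(2) by simp
    then show "sqrt (2 * pi * s\<^sup>2) * (normal_density 0 s x * \<bar>x - 0\<bar> ^ k) = \<bar>x\<bar> ^ k * exp (- (c * x\<^sup>2))"
      using s(1) by (simp add: normal_density_def mult_ac)
  qed
  finally show ?thesis .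
qed

text \<open>The phase closes the family under differentiation: a derivative in y raises
  \<open>k\<close> by one and advances \<phi> by pi / 2.\<close>

definition gauss_cos :: "nat \<Rightarrow> real \<Rightarrow> real \<Rightarrow> real" where
  "gauss_cos k \<phi> y = (LINT \<xi>|lborel. \<xi> ^ k * exp (- \<xi>\<^sup>2) * cos (y * \<xi> + \<phi>))"

lemma integrable_gauss_cos:
  fixes y \<phi> :: real
  shows "integrable lborel (\<lambda>\<xi>. \<xi> ^ k * exp (- \<xi>\<^sup>2) * cos (y * \<xi> + \<phi>))"
proof (rule Bochner_Integration.integrable_bound[OF integrable_gauss_moment[of 1 k]])
  show "AE \<xi> in lborel. norm (\<xi> ^ k * exp (- \<xi>\<^sup>2) * cos (y * \<xi> + \<phi>)) \<le> norm (\<bar>\<xi>\<bar> ^ k * exp (- (1 * \<xi>\<^sup>2)))"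
    by (auto simp: abs_mult power_abs mult_left_le)
qed auto

text \<open>The derivative - sin b is written as cos (b + pi / 2) to match the phase shift in
  \<open>gauss_cos\<close>.\<close>

lemma cos_second_order:
  fixes b h :: real
  shows "\<bar>cos (b + h) - cos b - h * cos (b + pi / 2)\<bar> \<le> h\<^sup>2"
proof -
  have sin_le: "\<bar>sin x - sin y\<bar> \<le> \<bar>x - y\<bar>" for x y :: real
    using field_differentiable_bound[of UNIV sin cos 1 x y] by (auto intro: DERIV_sin)
  define g where "g s = cos (b + s) + s * sin b" for s
  have "norm (g h - g 0) \<le> \<bar>h\<bar> * norm (h - 0)"
  proof (rule field_differentiable_bound[of "closed_segment 0 h" g "\<lambda>s. sin b - sin (b + s)"])
    show "(g has_real_derivative sin b - sin (b + s)) (at s within closed_segment 0 h)" for s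
      unfolding g_def by (auto intro!: derivative_eq_intros)
    show "norm (sin b - sin (b + s)) \<le> \<bar>h\<bar>" if "s \<in> closed_segment 0 h" for s
      using sin_le[of b "b + s"] that by (auto simp: closed_segment_eq_real_ivl split: if_splits)
  qed auto
  then show ?thesis
    by (simp add: g_def cos_add power2_eq_square[of h] abs_mult_self_eq algebra_simps)
qed

text \<open>The second-order estimate for the cosine bounds the error of the difference quotient by
  \<bar>h\<bar> times an absolute Gaussian moment of order k + 2.\<close>

lemma gauss_cos_deriv: "(gauss_cos k \<phi> has_real_derivative gauss_cos (Suc k) (\<phi> + pi / 2) y) (at y)"
proof -
  define I where "I = (LINT \<xi>::real|lborel. \<bar>\<xi>\<bar> ^ (k + 2) * exp (- (1 * \<xi>\<^sup>2)))"
  have "\<bar>(gauss_cos k \<phi> (y + h) - gauss_cos k \<phi> y) / h - gauss_cos (Suc k) (\<phi> + pi / 2) y\<bar> \<le> \<bar>h\<bar> * I"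
    if "h \<noteq> 0" for h
  proof -
    let ?d = "\<lambda>\<xi>. \<xi> ^ k * exp (- \<xi>\<^sup>2) * cos ((y + h) * \<xi> + \<phi>) - \<xi> ^ k * exp (- \<xi>\<^sup>2) * cos (y * \<xi> + \<phi>)
      - h * (\<xi> ^ Suc k * exp (- \<xi>\<^sup>2) * cos (y * \<xi> + (\<phi> + pi / 2)))"
    have eq: "gauss_cos k \<phi> (y + h) - gauss_cos k \<phi> y - h * gauss_cos (Suc k) (\<phi> + pi / 2) y = (LINT \<xi>|lborel. ?d \<xi>)"
      unfolding gauss_cos_def
      by (simp only: Bochner_Integration.integral_diff Bochner_Integration.integrable_diff
          integrable_mult_right integrable_gauss_cos integral_mult_right_zero)
    have "\<bar>gauss_cos k \<phi> (y + h) - gauss_cos k \<phi> y - h * gauss_cos (Suc k) (\<phi> + pi / 2) y\<bar> \<le> (LINT \<xi>|lborel. h\<^sup>2 * (\<bar>\<xi>\<bar> ^ (k + 2) * exp (- (1 * \<xi>\<^sup>2))))"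
      unfolding eq
    proof (rule integral_abs_bound_integral)
      show "integrable lborel ?d"
        by (rule Bochner_Integration.integrable_diff[OF Bochner_Integration.integrable_diff[OF
              integrable_gauss_cos integrable_gauss_cos] integrable_mult_right[OF integrable_gauss_cos]])
      show "integrable lborel (\<lambda>\<xi>::real. h\<^sup>2 * (\<bar>\<xi>\<bar> ^ (k + 2) * exp (- (1 * \<xi>\<^sup>2))))"
        by (rule integrable_mult_right[OF integrable_gauss_moment]) simp
      fix \<xi> :: real
      have d: "?d \<xi> = \<xi> ^ k * exp (- \<xi>\<^sup>2) * (cos (y * \<xi> + \<phi> + h * \<xi>) - cos (y * \<xi> + \<phi>)
          - h * \<xi> * cos (y * \<xi> + \<phi> + pi / 2))"
        by (simp add: algebra_simps)
      have "\<bar>?d \<xi>\<bar> \<le> \<bar>\<xi>\<bar> ^ k * exp (- \<xi>\<^sup>2) * (h * \<xi>)\<^sup>2"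
        unfolding d abs_mult power_abs using cos_second_order[of "y * \<xi> + \<phi>" "h * \<xi>"]
        by (intro mult_mono) auto
      also have "\<dots> = h\<^sup>2 * (\<bar>\<xi>\<bar> ^ (k + 2) * exp (- (1 * \<xi>\<^sup>2)))"
        by (simp add: power_add power_mult_distrib power2_eq_square)
      finally show "\<bar>?d \<xi>\<bar> \<le> h\<^sup>2 * (\<bar>\<xi>\<bar> ^ (k + 2) * exp (- (1 * \<xi>\<^sup>2)))" .
    qed
    also have "\<dots> = h\<^sup>2 * I" unfolding I_def by (rule integral_mult_right_zero)
    finally have "\<bar>gauss_cos k \<phi> (y + h) - gauss_cos k \<phi> y - h * gauss_cos (Suc k) (\<phi> + pi / 2) y\<bar> / \<bar>h\<bar>
       \<le> h\<^sup>2 * I / \<bar>h\<bar>"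
      by (intro divide_right_mono) auto
    moreover have "h\<^sup>2 * I / \<bar>h\<bar> = \<bar>h\<bar> * I"
      using that by (simp add: power2_eq_square abs_if)
    ultimately show ?thesis
      using that unfolding abs_divide[symmetric] by (simp add: diff_divide_distrib)
  qed
  then have "((\<lambda>h. (gauss_cos k \<phi> (y + h) - gauss_cos k \<phi> y) / h - gauss_cos (Suc k) (\<phi> + pi / 2) y) \<longlongrightarrow> 0) (at 0)"
    by (intro Lim_null_comparison[OF _ tendsto_mult_left_zero[OF tendsto_rabs_zero[OF tendsto_ident_at],
            where c = I]])
       (auto simp: eventually_at_filter)
  then show ?thesis unfolding DERIV_def by (rule LIM_zero_cancel)
qed

lemma gauss_cos_0_0: "gauss_cos 0 0 y = 2 * pi * heat_kernel y"
proof -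
  have "gauss_cos 0 0 y = (LINT \<xi>|lborel. exp (- \<xi>\<^sup>2) * cos (y * \<xi>))"
    by (simp add: gauss_cos_def)
  \<comment> \<open>Frequency at which the characteristic function of the standard normal law gives
    exp (- y^2 / 4); the substitution by sqrt 2 below changes its density into the weight exp (-
    \<xi>^2).\<close>
  define t where "t = y / sqrt 2"
  interpret real_distribution std_normal_distribution
    by (rule real_dist_normal_dist)
  have "(LINT x|std_normal_distribution. cos (t * x)) = Re (char std_normal_distribution t)"
    unfolding char_def
    by (subst integral_Re[symmetric, OF integrable_iexp]) (auto simp: Re_exp simp del: integral_Re)
  also have "\<dots> = exp (- (y\<^sup>2 / 4))"
    unfolding char_std_normal_distribution by (simp add: t_def power_divide)
  finally have "(LINT x|lborel. std_normal_density x * cos (t * x)) = exp (- (y\<^sup>2 / 4))"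
    by (subst (asm) integral_density) auto
  also have "(LINT x|lborel. std_normal_density x * cos (t * x))
      = \<bar>sqrt 2\<bar> *\<^sub>R (LINT \<xi>|lborel. std_normal_density (0 + sqrt 2 * \<xi>) * cos (t * (0 + sqrt 2 * \<xi>)))"
    by (rule lborel_integral_real_affine) simp
  also have "\<dots> = (LINT \<xi>|lborel. sqrt 2 * (std_normal_density (0 + sqrt 2 * \<xi>) * cos (t * (0 + sqrt 2 * \<xi>))))"
    by simp
  also have "\<dots> = (LINT \<xi>|lborel. 1 / sqrt pi * (\<xi> ^ 0 * exp (- \<xi>\<^sup>2) * cos (y * \<xi> + 0)))"
    by (intro Bochner_Integration.integral_cong refl)
       (simp add: std_normal_density_def t_def power_mult_distrib real_sqrt_mult)
  also have "\<dots> = 1 / sqrt pi * gauss_cos 0 0 y"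
    unfolding gauss_cos_def by (rule integral_mult_right_zero)
  finally have "gauss_cos 0 0 y = sqrt pi * exp (- (y\<^sup>2 / 4))"
    by (simp add: field_simps)
  moreover have "pi = sqrt pi * sqrt pi" by simp
  ultimately show ?thesis by (simp add: heat_kernel_def field_simps)
qed

lemma deriv_heat_kernel: "(deriv ^^ k) heat_kernel = (\<lambda>y. 1 / (2 * pi) * gauss_cos k (real k * (pi / 2)) y)"
proof (induction k)
  case 0
  then show ?case by (auto simp: gauss_cos_0_0)
next
  case (Suc k)
  have "deriv (\<lambda>y. 1 / (2 * pi) * gauss_cos k (real k * (pi / 2)) y) y
    = 1 / (2 * pi) * gauss_cos (Suc k) (real k * (pi / 2) + pi / 2) y" for y
    by (intro DERIV_imp_deriv DERIV_cmult gauss_cos_deriv)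
  moreover have "real k * (pi / 2) + pi / 2 = real (Suc k) * (pi / 2)"
    by (simp add: field_simps)
  ultimately show ?case by (simp only: funpow.simps o_apply Suc)
qed

section \<open>Fourier form of the functions \<open>h0\<close>\<close>

lemma coeff_P_poly_odd:
  assumes "odd k"
  shows "coeff (P_poly N a n) k = 0"
  unfolding P_poly_def coeff_sum using assms by (intro sum.neutral) auto

text \<open>For even k = 2j both (-i)^k and the phase advance k pi / 2 contribute (-1)^j, and these
  cancel. So the operator acts on the Fourier side as multiplication by the polynomial
  itself.\<close>

lemma h0_eq_sum:
  "h0 N a n y = 1 / (2 * pi) * (\<Sum>k\<le>degree (P_poly N a n). coeff (P_poly N a n) k * gauss_cos k 0 y)"
proof -
  have "Re (complex_of_real (coeff (P_poly N a n) k) * (- \<i>) ^ k * complex_of_real ((deriv ^^ k) heat_kernel y))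
     = 1 / (2 * pi) * (coeff (P_poly N a n) k * gauss_cos k 0 y)" for k
  proof (cases "odd k")
    case False
    then obtain j where j: "k = 2 * j" by (auto elim: evenE)
    have "gauss_cos k (real k * (pi / 2)) y = (-1) ^ j * gauss_cos k 0 y"
    proof -
      have "cos (y * \<xi> + real k * (pi / 2)) = (-1) ^ j * cos (y * \<xi>)" for \<xi>
        by (simp add: j cos_add)
      then have "gauss_cos k (real k * (pi / 2)) y = (LINT \<xi>|lborel. (-1) ^ j * (\<xi> ^ k * exp (- \<xi>\<^sup>2) * cos (y * \<xi> + 0)))"
        unfolding gauss_cos_def by (intro Bochner_Integration.integral_cong) (auto simp: mult_ac)
      also have "\<dots> = (-1) ^ j * gauss_cos k 0 y"
        unfolding gauss_cos_def by (rule integral_mult_right_zero)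
      finally show ?thesis .
    qed
    then show ?thesis
      unfolding deriv_heat_kernel by (simp add: j power_mult)
  qed (simp add: coeff_P_poly_odd)
  then show ?thesis
    unfolding h0_def diff_operator_def by (simp only: Re_sum sum_distrib_left)
qed

lemma h0_eq_integral:
  "h0 N a n y = 1 / (2 * pi) * (LINT \<xi>|lborel. poly (P_poly N a n) \<xi> * exp (- \<xi>\<^sup>2) * cos (y * \<xi>))" (is ?thesis1)
  and integrable_h0_integrand:
  "integrable lborel (\<lambda>\<xi>. poly (P_poly N a n) \<xi> * exp (- \<xi>\<^sup>2) * cos (y * \<xi>))" (is ?thesis2)
proof -
  let ?p = "P_poly N a n"
  have eq: "(\<lambda>\<xi>. poly ?p \<xi> * exp (- \<xi>\<^sup>2) * cos (y * \<xi>))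
    = (\<lambda>\<xi>. \<Sum>k\<le>degree ?p. coeff ?p k * (\<xi> ^ k * exp (- \<xi>\<^sup>2) * cos (y * \<xi> + 0)))"
    unfolding poly_altdef sum_distrib_right by (intro ext sum.cong refl) (simp add: mult_ac)
  have int: "integrable lborel (\<lambda>\<xi>. coeff ?p k * (\<xi> ^ k * exp (- \<xi>\<^sup>2) * cos (y * \<xi> + 0)))" for k
    by (intro integrable_mult_right integrable_gauss_cos)
  show ?thesis2 unfolding eq by (intro Bochner_Integration.integrable_sum int)
  show ?thesis1
    unfolding eq h0_eq_sum gauss_cos_def using int by (subst Bochner_Integration.integral_sum) auto
qed

lemma continuous_on_h0: "continuous_on S (h0 N a n)"
  unfolding h0_eq_sum[abs_def]
  by (intro continuous_intros continuous_at_imp_continuous_on ballI DERIV_isCont[OF gauss_cos_deriv])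

lemma heat_kernel_deriv: "(heat_kernel has_real_derivative - (y / 2) * heat_kernel y) (at y)"
  unfolding heat_kernel_def[abs_def] by (auto intro!: derivative_eq_intros simp: field_simps)

lemma heat_kernel_eq_integral:
  "heat_kernel y = 1 / (2 * pi) * (LINT \<xi>|lborel. exp (- \<xi>\<^sup>2) * cos (y * \<xi>))"
  using gauss_cos_0_0[of y] by (simp add: gauss_cos_def)

section \<open>Expansion of the first Green function\<close>

text \<open>The intermediate point lies between 0 and x, hence max 0 x rather than \<bar>x\<bar>:
  multiplied by exp (- s), the factor becomes exp (- s) or exp (- t A), and both decay.\<close>

lemma exp_taylor_bound:
  fixes x :: real
  shows "\<bar>exp x - (\<Sum>m<n. x ^ m / fact m)\<bar> \<le> \<bar>x\<bar> ^ n * exp (max 0 x)"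
proof (cases "n = 0 \<or> x = 0")
  case True
  then show ?thesis
    by (cases n) (auto simp: sum.lessThan_Suc_shift simp del: sum.lessThan_Suc)
next
  case False
  then have n: "n > 0" and x: "x \<noteq> 0" by auto
  have d: "\<forall>m t. DERIV ((\<lambda>_. exp) m) t :> (\<lambda>_. exp) (Suc m) t" for m :: nat by auto
  have "\<exists>t. t \<le> max 0 x \<and> exp x = (\<Sum>m<n. exp 0 / fact m * x ^ m) + exp t / fact n * x ^ n"
  proof (cases "x > 0")
    case True
    then show ?thesis
      using Maclaurin[of x n "\<lambda>_. exp" exp] n by (auto intro: less_imp_le)
  next
    case False
    with x have "x < 0" by simp
    then show ?thesis
      using Maclaurin_minus[of x n "\<lambda>_. exp" exp] n by (auto intro: less_imp_le)
  qed
  then obtain t where t: "t \<le> max 0 x" "exp x - (\<Sum>m<n. x ^ m / fact m) = exp t / fact n * x ^ n"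
    by auto
  have "\<bar>exp t / fact n * x ^ n\<bar> = exp t * \<bar>x\<bar> ^ n / fact n"
    by (simp add: abs_mult power_abs)
  also have "\<dots> \<le> exp (max 0 x) * \<bar>x\<bar> ^ n / 1"
    using t(1) by (intro frac_le mult_right_mono) (auto simp: fact_ge_1)
  finally show ?thesis using t(2) by (simp add: mult.commute)
qed

text \<open>A truncated expansion in powers of \<open>z\<close>, uniform on \<open>X\<close>. The
  formal power series only keeps track of coefficients; no convergence is claimed.\<close>

definition fps_approx :: "'a set \<Rightarrow> ('a \<Rightarrow> real) \<Rightarrow> nat \<Rightarrow> ('a \<Rightarrow> real) \<Rightarrow> real fps \<Rightarrow> bool" where
  "fps_approx X z K f F \<longleftrightarrow>
     (\<exists>C\<ge>0. \<forall>x\<in>X. \<bar>f x - (\<Sum>n\<le>K. fps_nth F n * z x ^ n)\<bar> \<le> C * z x ^ Suc K)"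

lemma fps_approx_mult:
  assumes z: "\<And>x. x \<in> X \<Longrightarrow> 0 \<le> z x \<and> z x \<le> R" and "R \<ge> 0"
    and f: "fps_approx X z K f F" and g: "fps_approx X z K g G"
  shows "fps_approx X z K (\<lambda>x. f x * g x) (F * G)"
proof -
  obtain C where C: "C \<ge> 0" "\<And>x. x \<in> X \<Longrightarrow> \<bar>f x - (\<Sum>n\<le>K. fps_nth F n * z x ^ n)\<bar> \<le> C * z x ^ Suc K"
    using f unfolding fps_approx_def by blast
  obtain D where D: "D \<ge> 0" "\<And>x. x \<in> X \<Longrightarrow> \<bar>g x - (\<Sum>n\<le>K. fps_nth G n * z x ^ n)\<bar> \<le> D * z x ^ Suc K"
    using g unfolding fps_approx_def by blast
  define S where "S H = (\<Sum>n\<le>K. \<bar>fps_nth H n\<bar> * R ^ n)" for H :: "real fps"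
  have S: "\<bar>\<Sum>n\<le>K. fps_nth H n * z x ^ n\<bar> \<le> S H" if "x \<in> X" for x H
    unfolding S_def using z[OF that]
    by (intro order_trans[OF sum_abs] sum_mono) (auto simp: abs_mult power_abs intro!: mult_left_mono power_mono)
  \<comment> \<open>The index pairs that the truncated product keeps in excess of the Cauchy
    product. Each carries at least Suc K factors of \<open>z\<close>, the surplus being bounded by
    powers of \<open>R\<close>.\<close>
  define I where "I = {..K} \<times> {..K} - {(i, j). i + j \<le> K}"
  define T where "T = (\<Sum>(i,j)\<in>I. \<bar>fps_nth F i\<bar> * \<bar>fps_nth G j\<bar> * R ^ (i + j - Suc K))"
  have trunc: "\<bar>(\<Sum>n\<le>K. fps_nth F n * z x ^ n) * (\<Sum>n\<le>K. fps_nth G n * z x ^ n)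
      - (\<Sum>n\<le>K. fps_nth (F * G) n * z x ^ n)\<bar> \<le> T * z x ^ Suc K" if x: "x \<in> X" for x
  proof -
    let ?t = "\<lambda>(i, j). fps_nth F i * fps_nth G j * z x ^ (i + j)"
    have tri: "{(i, j). i + j \<le> K} \<subseteq> {..K} \<times> {..K}" by auto
    have "(\<Sum>n\<le>K. fps_nth F n * z x ^ n) * (\<Sum>n\<le>K. fps_nth G n * z x ^ n) = sum ?t ({..K} \<times> {..K})"
      unfolding sum_product sum.cartesian_product
      by (intro sum.cong refl) (auto simp: power_add)
    also have "\<dots> = sum ?t I + sum ?t {(i, j). i + j \<le> K}"
      unfolding I_def using tri by (intro sum.subset_diff) auto
    also have "sum ?t {(i, j). i + j \<le> K} = (\<Sum>n\<le>K. \<Sum>i\<le>n. fps_nth F i * fps_nth G (n - i) * z x ^ (i + (n - i)))"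
      by (rule sum.triangle_reindex_eq)
    also have "\<dots> = (\<Sum>n\<le>K. fps_nth (F * G) n * z x ^ n)"
      by (intro sum.cong refl) (simp add: fps_mult_nth sum_distrib_right atLeast0AtMost)
    finally have eq: "(\<Sum>n\<le>K. fps_nth F n * z x ^ n) * (\<Sum>n\<le>K. fps_nth G n * z x ^ n)
      - (\<Sum>n\<le>K. fps_nth (F * G) n * z x ^ n) = sum ?t I" by simp
    have "\<bar>sum ?t I\<bar> \<le> (\<Sum>(i,j)\<in>I. \<bar>fps_nth F i\<bar> * \<bar>fps_nth G j\<bar> * R ^ (i + j - Suc K) * z x ^ Suc K)"
    proof (intro order_trans[OF sum_abs] sum_mono, clarify)
      fix i j assume ij: "(i, j) \<in> I"
      then have "z x ^ (i + j) = z x ^ (i + j - Suc K) * z x ^ Suc K"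
        unfolding power_add[symmetric] I_def by auto
      also have "\<dots> \<le> R ^ (i + j - Suc K) * z x ^ Suc K"
        using z[OF x] by (intro mult_right_mono power_mono) auto
      finally have "\<bar>fps_nth F i\<bar> * \<bar>fps_nth G j\<bar> * z x ^ (i + j)
          \<le> \<bar>fps_nth F i\<bar> * \<bar>fps_nth G j\<bar> * (R ^ (i + j - Suc K) * z x ^ Suc K)"
        by (intro mult_left_mono) auto
      then show "\<bar>fps_nth F i * fps_nth G j * z x ^ (i + j)\<bar>
        \<le> \<bar>fps_nth F i\<bar> * \<bar>fps_nth G j\<bar> * R ^ (i + j - Suc K) * z x ^ Suc K"
        using z[OF x] by (simp add: abs_mult mult.assoc)
    qed
    then show ?thesis unfolding eq T_def by (simp add: sum_distrib_right case_prod_unfold)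
  qed
  show ?thesis
    unfolding fps_approx_def
  proof (intro exI conjI ballI)
    have S0: "S H \<ge> 0" for H unfolding S_def using \<open>R \<ge> 0\<close> by (intro sum_nonneg) auto
    have T0: "T \<ge> 0" unfolding T_def using \<open>R \<ge> 0\<close> by (intro sum_nonneg) auto
    show "C * (D * R ^ Suc K + S G) + S F * D + T \<ge> 0"
      using S0 T0 C(1) D(1) \<open>R \<ge> 0\<close> by simp
    fix x assume x: "x \<in> X"
    let ?F = "\<Sum>n\<le>K. fps_nth F n * z x ^ n" and ?G = "\<Sum>n\<le>K. fps_nth G n * z x ^ n"
    let ?w = "z x ^ Suc K"
    have w: "0 \<le> ?w" "?w \<le> R ^ Suc K"
      using z[OF x] power_mono[of "z x" R "Suc K"] by auto
    have "\<bar>g x\<bar> \<le> D * R ^ Suc K + S G"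
      using D(2)[OF x] S[OF x, of G] mult_left_mono[OF w(2) D(1)] by linarith
    then have 1: "\<bar>(f x - ?F) * g x\<bar> \<le> (C * ?w) * (D * R ^ Suc K + S G)"
      unfolding abs_mult using C(2)[OF x] by (intro mult_mono) (auto intro: order_trans)
    have 2: "\<bar>?F * (g x - ?G)\<bar> \<le> S F * (D * ?w)"
      unfolding abs_mult using D(2)[OF x] S[OF x, of F] S0 by (intro mult_mono) auto
    have "f x * g x - (\<Sum>n\<le>K. fps_nth (F * G) n * z x ^ n)
       = (f x - ?F) * g x + ?F * (g x - ?G) + (?F * ?G - (\<Sum>n\<le>K. fps_nth (F * G) n * z x ^ n))"
      by (simp add: left_diff_distrib right_diff_distrib)
    then have "\<bar>f x * g x - (\<Sum>n\<le>K. fps_nth (F * G) n * z x ^ n)\<bar>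
       \<le> (C * ?w) * (D * R ^ Suc K + S G) + S F * (D * ?w) + T * ?w"
      using 1 2 trunc[OF x] by linarith
    also have "\<dots> = (C * (D * R ^ Suc K + S G) + S F * D + T) * ?w"
      by (simp only: distrib_left distrib_right mult_ac)
    finally show "\<bar>f x * g x - (\<Sum>n\<le>K. fps_nth (F * G) n * z x ^ n)\<bar>
       \<le> (C * (D * R ^ Suc K + S G) + S F * D + T) * ?w" .
  qed
qed

lemma fps_approx_power:
  assumes "\<And>x. x \<in> X \<Longrightarrow> 0 \<le> z x \<and> z x \<le> R" "R \<ge> 0" "fps_approx X z K f F"
  shows "fps_approx X z K (\<lambda>x. f x ^ m) (F ^ m)"
proof (induction m)
  case 0
  have "(\<Sum>n\<le>K. fps_nth 1 n * z x ^ n) = 1" for x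
  proof -
    have "(\<Sum>n\<le>K. fps_nth 1 n * z x ^ n) = (\<Sum>n\<le>K. if n = 0 then 1 else 0)"
      by (intro sum.cong) auto
    then show ?thesis by simp
  qed
  then show ?case unfolding fps_approx_def by (auto intro!: exI[of _ 0])
next
  case (Suc m)
  then show ?case using fps_approx_mult[OF assms(1,2,3) Suc] by simp
qed

section \<open>Expansion of exp (- t A) around the Gaussian\<close>

context stencil
begin

text \<open>The series of the defect B in powers of \<theta>^2. The zeros below \<open>N\<close>
  encode the condition that all indices in \<open>c_coeff\<close> are at least
  \<open>N\<close>.\<close>

definition symbol_fps :: "real fps" where
  "symbol_fps = Abs_fps (\<lambda>n. if N \<le> n then b_coeff N a n else 0)"

text \<open>A coefficient of a power of a series is a sum over lists with prescribed length and
  total; a list with an entry below \<open>N\<close> contributes a zero factor.\<close>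

lemma c_coeff_eq: "m \<ge> 1 \<Longrightarrow> c_coeff N a n m = fps_nth (symbol_fps ^ m) n"
proof -
  assume "m \<ge> 1"
  have "fps_nth (symbol_fps ^ m) n = (\<Sum>l\<in>natpermute n m. \<Prod>j = 0..m - 1. fps_nth symbol_fps (l ! j))"
    using \<open>m \<ge> 1\<close> by (simp add: fps_power_nth)
  also have "\<dots> = (\<Sum>l\<in>natpermute n m. prod_list (map (fps_nth symbol_fps) l))"
  proof (intro sum.cong refl)
    fix l assume "l \<in> natpermute n m"
    then have "length l = m" by (simp add: natpermute_def)
    then have "{0..m - 1} = {0..<length l}" using \<open>m \<ge> 1\<close> by auto
    then show "(\<Prod>j = 0..m - 1. fps_nth symbol_fps (l ! j)) = prod_list (map (fps_nth symbol_fps) l)"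
      by (simp add: prod.list_conv_set_nth)
  qed
  also have "\<dots> = (\<Sum>l\<in>{l. length l = m \<and> (\<forall>i\<in>set l. N \<le> i) \<and> sum_list l = n}. prod_list (map (fps_nth symbol_fps) l))"
  proof (intro sum.mono_neutral_right ballI)
    show "finite (natpermute n m)" by (rule natpermute_finite)
    fix l assume "l \<in> natpermute n m - {l. length l = m \<and> (\<forall>i\<in>set l. N \<le> i) \<and> sum_list l = n}"
    then obtain i where "i \<in> set l" "\<not> N \<le> i" unfolding natpermute_def by blast
    then have "0 \<in> set (map (fps_nth symbol_fps) l)"
      unfolding symbol_fps_def by (force simp: image_iff)
    then show "prod_list (map (fps_nth symbol_fps) l) = 0" by (simp add: prod_list_zero_iff)
  qed (auto simp: natpermute_def)
  also have "\<dots> = c_coeff N a n m"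
    unfolding c_coeff_def
    by (intro sum.cong refl arg_cong[where f = prod_list] map_cong) (auto simp: symbol_fps_def)
  finally show ?thesis by simp
qed

text \<open>There is nothing to sum, since \<open>m\<close> entries of size at least
  \<open>N\<close> add up to at least N * m. Hence the ranges 1..n div N can be replaced by a range
  that does not depend on \<open>n\<close>.\<close>

lemma c_coeff_eq_0:
  assumes "n < N * m"
  shows "c_coeff N a n m = 0"
proof -
  have "N * length l \<le> sum_list l" if "\<forall>i\<in>set l. N \<le> i" for l
    using that by (induction l) auto
  then have "{l. length l = m \<and> (\<forall>i\<in>set l. N \<le> i) \<and> sum_list l = n} = {}"
    using assms by force
  then show ?thesis unfolding c_coeff_def by (simp only: sum.empty)
qed

text \<open>The function B with A = \<theta>^2 (1 - B). The value 0 at the origin is the limit, as B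
  is of order \<theta>^(2N).\<close>

definition symbol_defect :: "real \<Rightarrow> real" where
  "symbol_defect \<theta> = (if \<theta> = 0 then 0 else (\<theta>\<^sup>2 - A \<theta>) / \<theta>\<^sup>2)"

lemma A_eq: "A \<theta> = \<theta>\<^sup>2 * (1 - symbol_defect \<theta>)"
  by (cases "\<theta> = 0") (simp_all add: symbol_defect_def field_simps)

lemma fps_approx_symbol_defect: "fps_approx UNIV power2 K symbol_defect symbol_fps"
proof -
  obtain C where C: "C \<ge> 0" "\<And>\<theta>. \<bar>\<theta>\<^sup>2 - A \<theta> - (\<Sum>n=N..K. b_coeff N a n * \<theta> ^ (2 * (n + 1)))\<bar> \<le> C * \<theta> ^ (2 * (K + 2))"
    using A_taylor[of K] by blast
  have sum_eq: "(\<Sum>n\<le>K. fps_nth symbol_fps n * \<theta>\<^sup>2 ^ n) = (\<Sum>n=N..K. b_coeff N a n * \<theta>\<^sup>2 ^ n)" for \<theta> :: real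
    by (rule sum.mono_neutral_cong_right) (auto simp: symbol_fps_def)
  have "\<bar>symbol_defect \<theta> - (\<Sum>n\<le>K. fps_nth symbol_fps n * \<theta>\<^sup>2 ^ n)\<bar> \<le> C * \<theta>\<^sup>2 ^ Suc K" for \<theta>
  proof (cases "\<theta> = 0")
    case True
    then show ?thesis unfolding sum_eq using N_pos by (auto simp: symbol_defect_def intro!: sum.neutral)
  next
    case False
    then have pos: "\<theta>\<^sup>2 > 0" by simp
    have eq: "\<theta>\<^sup>2 - A \<theta> - (\<Sum>n=N..K. b_coeff N a n * \<theta> ^ (2 * (n + 1)))
       = \<theta>\<^sup>2 * (symbol_defect \<theta> - (\<Sum>n=N..K. b_coeff N a n * \<theta>\<^sup>2 ^ n))"
    proof -
      have "\<theta>\<^sup>2 * symbol_defect \<theta> = \<theta>\<^sup>2 - A \<theta>"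
        unfolding A_eq by (simp add: right_diff_distrib)
      moreover have "\<theta> ^ (2 * (n + 1)) = \<theta>\<^sup>2 * \<theta>\<^sup>2 ^ n" for n
        by (simp only: power_mult Suc_eq_plus1[symmetric] power_Suc)
      ultimately show ?thesis
        by (simp only: right_diff_distrib sum_distrib_left mult.left_commute)
    qed
    have "\<theta>\<^sup>2 * \<bar>symbol_defect \<theta> - (\<Sum>n=N..K. b_coeff N a n * \<theta>\<^sup>2 ^ n)\<bar> \<le> \<theta>\<^sup>2 * (C * \<theta>\<^sup>2 ^ Suc K)"
    proof -
      have "\<theta> ^ (2 * (K + 2)) = \<theta>\<^sup>2 * \<theta>\<^sup>2 ^ Suc K"
        by (simp only: power_mult add_2_eq_Suc' power_Suc)
      then show ?thesis
        using C(2)[of \<theta>] unfolding eq abs_mult by (simp add: mult.left_commute)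
    qed
    then show ?thesis unfolding sum_eq using pos by simp
  qed
  then show ?thesis using C(1) unfolding fps_approx_def by blast
qed

text \<open>The double truncation of exp (s B) - 1. The variables s = t \<theta>^2 and z =
  \<theta>^2 are kept apart because after rescaling s is of order one, while each z yields a factor
  1 / t.\<close>

definition correction :: "nat \<Rightarrow> real \<Rightarrow> real \<Rightarrow> real" where
  "correction K s z = (\<Sum>m=1..K. s ^ m / fact m * (\<Sum>n\<le>K. fps_nth (symbol_fps ^ m) n * z ^ n))"

text \<open>Under \<xi> = sqrt t * \<theta> one has \<xi>^(2(n+m)) = s^m z^n t^n, so dividing by t^n
  leaves exactly the monomials of \<open>correction\<close>.\<close>

lemma correction_eq:
  assumes "t > 0"
  shows "(\<Sum>n=N..K. poly (P_poly N a n) (sqrt t * \<theta>) / t ^ n) = correction K (t * \<theta>\<^sup>2) (\<theta>\<^sup>2)"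
proof -
  let ?g = "\<lambda>n m. c_coeff N a n m / fact m * ((t * \<theta>\<^sup>2) ^ m * (\<theta>\<^sup>2) ^ n)"
  have "poly (P_poly N a n) (sqrt t * \<theta>) / t ^ n = (\<Sum>m=1..K. ?g n m)" if n: "n \<in> {N..K}" for n
  proof -
    have "(sqrt t * \<theta>) ^ (2 * (n + m)) = (t * \<theta>\<^sup>2) ^ m * (\<theta>\<^sup>2) ^ n * t ^ n" for m
      unfolding power_mult using assms by (simp add: power_mult_distrib power_add)
    then have "poly (P_poly N a n) (sqrt t * \<theta>) / t ^ n = (\<Sum>m=1..n div N. ?g n m)"
      using assms by (simp add: P_poly_def poly_sum poly_monom sum_divide_distrib)
    also have "\<dots> = (\<Sum>m=1..K. ?g n m)"
    proof (rule sum.mono_neutral_left)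
      show "{1..n div N} \<subseteq> {1..K}" using n by (auto intro: order_trans[OF div_le_dividend])
      show "\<forall>m\<in>{1..K} - {1..n div N}. ?g n m = 0"
      proof
        fix m assume "m \<in> {1..K} - {1..n div N}"
        then have "n < N * m" using N_pos by (auto simp: not_le less_mult_imp_div_less div_less_iff_less_mult mult.commute)
        then show "?g n m = 0" by (simp add: c_coeff_eq_0)
      qed
    qed simp
    finally show ?thesis .
  qed
  then have "(\<Sum>n=N..K. poly (P_poly N a n) (sqrt t * \<theta>) / t ^ n) = (\<Sum>n=N..K. \<Sum>m=1..K. ?g n m)"
    by (intro sum.cong) auto
  also have "\<dots> = (\<Sum>n\<le>K. \<Sum>m=1..K. ?g n m)"
  proof (rule sum.mono_neutral_left)
    show "\<forall>n\<in>{..K} - {N..K}. (\<Sum>m=1..K. ?g n m) = 0"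
    proof
      fix n assume "n \<in> {..K} - {N..K}"
      then have "n < N" by auto
      have "c_coeff N a n m = 0" if "m \<in> {1..K}" for m
      proof (rule c_coeff_eq_0)
        have "N * 1 \<le> N * m" using that by (intro mult_le_mono2) auto
        with \<open>n < N\<close> show "n < N * m" by linarith
      qed
      then show "(\<Sum>m=1..K. ?g n m) = 0" by (intro sum.neutral) auto
    qed
  qed auto
  also have "\<dots> = (\<Sum>m=1..K. \<Sum>n\<le>K. ?g n m)"
    by (rule sum.swap)
  also have "\<dots> = correction K (t * \<theta>\<^sup>2) (\<theta>\<^sup>2)"
    unfolding correction_def sum_distrib_left
    by (intro sum.cong refl) (simp add: c_coeff_eq)
  finally show ?thesis .
qed

text \<open>For use outside [-pi, pi]: there z \<ge> 1, so every lower power of z is dominated by z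
  ^ Suc K, and the majorant has the same shape as the error inside.\<close>

lemma correction_bound:
  assumes "0 \<le> s" "1 \<le> z"
  shows "\<bar>correction K s z\<bar> \<le> (\<Sum>m=1..K. \<Sum>n\<le>K. \<bar>fps_nth (symbol_fps ^ m) n\<bar>) * (z ^ Suc K * (\<Sum>m\<le>Suc K. s ^ m))"
proof -
  have "\<bar>correction K s z\<bar> \<le> (\<Sum>m=1..K. \<bar>s ^ m / fact m * (\<Sum>n\<le>K. fps_nth (symbol_fps ^ m) n * z ^ n)\<bar>)"
    unfolding correction_def by (rule sum_abs)
  also have "\<dots> \<le> (\<Sum>m=1..K. (\<Sum>n\<le>K. \<bar>fps_nth (symbol_fps ^ m) n\<bar>) * (z ^ Suc K * (\<Sum>m\<le>Suc K. s ^ m)))"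
  proof (intro sum_mono)
    fix m assume m: "m \<in> {1..K}"
    have "s ^ m / fact m \<le> s ^ m / 1"
      using assms by (intro divide_left_mono fact_ge_1) auto
    also have "s ^ m \<le> (\<Sum>m\<le>Suc K. s ^ m)"
      using m assms by (intro member_le_sum) auto
    finally have 1: "\<bar>s ^ m / fact m\<bar> \<le> (\<Sum>m\<le>Suc K. s ^ m)" using assms by simp
    have "\<bar>\<Sum>n\<le>K. fps_nth (symbol_fps ^ m) n * z ^ n\<bar> \<le> (\<Sum>n\<le>K. \<bar>fps_nth (symbol_fps ^ m) n\<bar> * z ^ Suc K)"
      using assms by (intro order_trans[OF sum_abs sum_mono])
        (auto simp: abs_mult simp del: power_Suc intro!: mult_left_mono power_increasing)
    then have 2: "\<bar>\<Sum>n\<le>K. fps_nth (symbol_fps ^ m) n * z ^ n\<bar> \<le> (\<Sum>n\<le>K. \<bar>fps_nth (symbol_fps ^ m) n\<bar>) * z ^ Suc K"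
      by (simp only: sum_distrib_right)
    show "\<bar>s ^ m / fact m * (\<Sum>n\<le>K. fps_nth (symbol_fps ^ m) n * z ^ n)\<bar>
        \<le> (\<Sum>n\<le>K. \<bar>fps_nth (symbol_fps ^ m) n\<bar>) * (z ^ Suc K * (\<Sum>m\<le>Suc K. s ^ m))"
    proof -
      have "0 \<le> (\<Sum>m\<le>Suc K. s ^ m)" using assms by (intro sum_nonneg) auto
      from mult_mono[OF 1 2 this] show ?thesis unfolding abs_mult by (simp only: mult_ac abs_ge_zero)
    qed
  qed
  finally show ?thesis by (simp only: sum_distrib_right)
qed

text \<open>With \<open>s = t \<theta>\<^sup>2\<close> and \<open>B\<close> the defect, \<open>exp (- t A) = exp (- s) exp (s B)\<close>. The second factor
  is expanded up to order \<open>K\<close>, where the remainder is absorbed by \<open>exp (- t A) \<le> exp (- c s)\<close>, and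
  then the powers of \<open>B\<close> are expanded.\<close>

lemma exp_symbol_expansion_inside:
  assumes c: "c > 0" "c \<le> 1" "\<And>\<theta>. \<bar>\<theta>\<bar> \<le> pi \<Longrightarrow> c * \<theta>\<^sup>2 \<le> A \<theta>"
  shows "\<exists>C\<ge>0. \<forall>t>0. \<forall>\<theta>. \<bar>\<theta>\<bar> \<le> pi \<longrightarrow>
    \<bar>exp (- (t * A \<theta>)) - exp (- (t * \<theta>\<^sup>2)) * (1 + correction K (t * \<theta>\<^sup>2) (\<theta>\<^sup>2))\<bar>
     \<le> C * ((\<theta>\<^sup>2) ^ Suc K * (\<Sum>m\<le>Suc K. (t * \<theta>\<^sup>2) ^ m)) * exp (- (c * (t * \<theta>\<^sup>2)))"
proof -
  let ?B = symbol_defect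
  let ?X = "{-pi..pi}"
  have range: "0 \<le> \<theta>\<^sup>2 \<and> \<theta>\<^sup>2 \<le> pi\<^sup>2" if "\<theta> \<in> ?X" for \<theta> :: real
    using that by (auto simp: abs_le_square_iff[symmetric])
  have approx: "fps_approx ?X power2 k ?B symbol_fps" for k
    using fps_approx_symbol_defect[of k] unfolding fps_approx_def by blast
  have "\<exists>D. \<forall>m. D m \<ge> 0 \<and> (\<forall>\<theta>\<in>?X. \<bar>?B \<theta> ^ m - (\<Sum>n\<le>K. fps_nth (symbol_fps ^ m) n * (\<theta>\<^sup>2) ^ n)\<bar> \<le> D m * (\<theta>\<^sup>2) ^ Suc K)"
    using fps_approx_power[OF range _ approx[of K]] unfolding fps_approx_def
    by (intro choice) auto
  then obtain D where D: "\<And>m. D m \<ge> 0"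
    "\<And>m \<theta>. \<theta> \<in> ?X \<Longrightarrow> \<bar>?B \<theta> ^ m - (\<Sum>n\<le>K. fps_nth (symbol_fps ^ m) n * (\<theta>\<^sup>2) ^ n)\<bar> \<le> D m * (\<theta>\<^sup>2) ^ Suc K"
    by blast
  \<comment> \<open>Order K = 0: the constant coefficient of the series is zero because N \<ge> 1,
    so B itself is bounded by a multiple of \<theta>^2.\<close>
  obtain E where E: "E \<ge> 0" "\<And>\<theta>. \<theta> \<in> ?X \<Longrightarrow> \<bar>?B \<theta>\<bar> \<le> E * \<theta>\<^sup>2"
    using approx[of 0] N_pos unfolding fps_approx_def by (auto simp: symbol_fps_def)
  show ?thesis
  proof (intro exI conjI allI impI)
    show "E ^ Suc K + (\<Sum>m=1..K. D m) \<ge> 0"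
      using E(1) D(1) by (intro add_nonneg_nonneg sum_nonneg) auto
    fix t \<theta> :: real assume t: "t > 0" and \<theta>: "\<bar>\<theta>\<bar> \<le> pi"
    then have X: "\<theta> \<in> ?X" by auto
    define s where "s = t * \<theta>\<^sup>2"
    define z where "z = \<theta>\<^sup>2"
    define B where "B = ?B \<theta>"
    \<comment> \<open>Since s \<ge> 0, this sum dominates each single power of s up to Suc K, so one
      majorant covers both sources of error.\<close>
    define S where "S = (\<Sum>m\<le>Suc K. s ^ m)"
    have s0: "s \<ge> 0" and z0: "z \<ge> 0" using t by (auto simp: s_def z_def)
    have tA: "t * A \<theta> = s - s * B" by (simp add: A_eq s_def B_def algebra_simps)
    have cs: "c * s \<le> t * A \<theta>"
      using mult_left_mono[OF c(3)[OF \<theta>], of t] t by (simp add: s_def mult_ac)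
    have s_le: "s ^ m \<le> S" if "m \<le> Suc K" for m
      unfolding S_def using that s0 by (intro member_le_sum) auto
    have S0: "S \<ge> 0" unfolding S_def using s0 by (intro sum_nonneg) auto
    have ecs: "exp (- s) \<le> exp (- (c * s))"
      using mult_right_mono[OF c(2) s0] by simp
    let ?E = "\<Sum>m<Suc K. (s * B) ^ m / fact m"
    have "\<bar>exp (- s) * (exp (s * B) - ?E)\<bar> \<le> exp (- s) * (\<bar>s * B\<bar> ^ Suc K * exp (max 0 (s * B)))"
      using exp_taylor_bound[of "s * B" "Suc K"] by (simp only: abs_mult abs_exp_cancel) (intro mult_left_mono, auto)
    also have "\<dots> = \<bar>s * B\<bar> ^ Suc K * exp (max 0 (s * B) - s)"
      by (simp add: exp_diff exp_minus divide_inverse mult_ac)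
    also have "\<dots> \<le> (S * (E ^ Suc K * z ^ Suc K)) * exp (- (c * s))"
    proof (intro mult_mono)
      have "\<bar>s * B\<bar> ^ Suc K = s ^ Suc K * \<bar>B\<bar> ^ Suc K"
        using s0 by (simp only: abs_mult power_mult_distrib abs_of_nonneg)
      also have "\<dots> \<le> S * (E * z) ^ Suc K"
        using E(2)[OF X] s0 S0 s_le[of "Suc K"] unfolding B_def z_def
        by (intro mult_mono power_mono) auto
      finally show "\<bar>s * B\<bar> ^ Suc K \<le> S * (E ^ Suc K * z ^ Suc K)"
        by (simp only: power_mult_distrib)
      \<comment> \<open>The exponent is either - s or s B - s = - t A; both are at most - c
        s.\<close>
      show "exp (max 0 (s * B) - s) \<le> exp (- (c * s))"
        using tA cs mult_right_mono[OF c(2) s0] by (auto simp: max_def)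
      show "0 \<le> S * (E ^ Suc K * z ^ Suc K)"
        using S0 E(1) z0 by (intro mult_nonneg_nonneg zero_le_power) auto
    qed auto
    finally have 1: "\<bar>exp (- s) * (exp (s * B) - ?E)\<bar> \<le> E ^ Suc K * (z ^ Suc K * S) * exp (- (c * s))"
      by (simp only: mult_ac)
    let ?T = "\<lambda>m. \<Sum>n\<le>K. fps_nth (symbol_fps ^ m) n * z ^ n"
    have "?E = 1 + (\<Sum>m=1..K. (s * B) ^ m / fact m)"
      unfolding lessThan_Suc_atMost atLeast0AtMost[symmetric] by (subst sum.atLeast_Suc_atMost) auto
    then have E_diff: "?E - (1 + correction K s z) = (\<Sum>m=1..K. s ^ m / fact m * (B ^ m - ?T m))"
      unfolding correction_def by (simp add: right_diff_distrib sum_subtractf power_mult_distrib)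
    have "\<bar>?E - (1 + correction K s z)\<bar> \<le> (\<Sum>m=1..K. D m * (z ^ Suc K * S))"
      unfolding E_diff
    proof (intro order_trans[OF sum_abs sum_mono])
      fix m assume m: "m \<in> {1..K}"
      have "s ^ m / fact m \<le> s ^ m / 1"
        using s0 by (intro divide_left_mono fact_ge_1) auto
      then have "\<bar>s ^ m / fact m\<bar> \<le> S" using s_le[of m] m s0 by simp
      then have "\<bar>s ^ m / fact m * (B ^ m - ?T m)\<bar> \<le> S * (D m * z ^ Suc K)"
        unfolding abs_mult using D(2)[OF X, of m] S0 unfolding B_def z_def by (intro mult_mono) auto
      then show "\<bar>s ^ m / fact m * (B ^ m - ?T m)\<bar> \<le> D m * (z ^ Suc K * S)"
        by (simp only: mult_ac)
    qed
    then have "\<bar>exp (- s) * (?E - (1 + correction K s z))\<bar> \<le> exp (- (c * s)) * (\<Sum>m=1..K. D m * (z ^ Suc K * S))"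
      unfolding abs_mult abs_exp_cancel using ecs by (intro mult_mono) auto
    then have 2: "\<bar>exp (- s) * (?E - (1 + correction K s z))\<bar> \<le> (\<Sum>m=1..K. D m) * (z ^ Suc K * S) * exp (- (c * s))"
      unfolding sum_distrib_right[symmetric] by (simp only: mult_ac)
    have "exp (- (t * A \<theta>)) = exp (- s) * exp (s * B)"
      unfolding tA mult_exp_exp by simp
    then have "exp (- (t * A \<theta>)) - exp (- s) * (1 + correction K s z)
       = exp (- s) * (exp (s * B) - ?E) + exp (- s) * (?E - (1 + correction K s z))"
      by (simp only: right_diff_distrib)
    then have "\<bar>exp (- (t * A \<theta>)) - exp (- s) * (1 + correction K s z)\<bar>
      \<le> E ^ Suc K * (z ^ Suc K * S) * exp (- (c * s)) + (\<Sum>m=1..K. D m) * (z ^ Suc K * S) * exp (- (c * s))"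
      using 1 2 by linarith
    also have "\<dots> = (E ^ Suc K + (\<Sum>m=1..K. D m)) * (z ^ Suc K * S) * exp (- (c * s))"
      by (simp only: distrib_right)
    finally show "\<bar>exp (- (t * A \<theta>)) - exp (- (t * \<theta>\<^sup>2)) * (1 + correction K (t * \<theta>\<^sup>2) (\<theta>\<^sup>2))\<bar>
     \<le> (E ^ Suc K + (\<Sum>m=1..K. D m)) * ((\<theta>\<^sup>2) ^ Suc K * (\<Sum>m\<le>Suc K. (t * \<theta>\<^sup>2) ^ m)) * exp (- (c * (t * \<theta>\<^sup>2)))"
      unfolding s_def z_def S_def .
  qed
qed

text \<open>Outside [-pi, pi] the whole Gaussian approximation counts as error, but there \<theta>^2
  \<ge> 1 and the same majorant absorbs it. Extending to the real line lets the main terms become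
  full Gaussian integrals.\<close>

lemma exp_symbol_expansion:
  "\<exists>c C. c > 0 \<and> C \<ge> 0 \<and> (\<forall>t>0. \<forall>\<theta>.
    \<bar>indicator {-pi..pi} \<theta> * exp (- (t * A \<theta>)) - exp (- (t * \<theta>\<^sup>2)) * (1 + correction K (t * \<theta>\<^sup>2) (\<theta>\<^sup>2))\<bar>
     \<le> C * ((\<theta>\<^sup>2) ^ Suc K * (\<Sum>m\<le>Suc K. (t * \<theta>\<^sup>2) ^ m)) * exp (- (c * (t * \<theta>\<^sup>2))))"
proof -
  obtain c where c: "c > 0" "c \<le> 1" "\<And>\<theta>. \<bar>\<theta>\<bar> \<le> pi \<Longrightarrow> c * \<theta>\<^sup>2 \<le> A \<theta>"
    using A_lower by blast
  obtain C where C: "C \<ge> 0" "\<And>t \<theta>. t > 0 \<Longrightarrow> \<bar>\<theta>\<bar> \<le> pi \<Longrightarrow>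
    \<bar>exp (- (t * A \<theta>)) - exp (- (t * \<theta>\<^sup>2)) * (1 + correction K (t * \<theta>\<^sup>2) (\<theta>\<^sup>2))\<bar>
     \<le> C * ((\<theta>\<^sup>2) ^ Suc K * (\<Sum>m\<le>Suc K. (t * \<theta>\<^sup>2) ^ m)) * exp (- (c * (t * \<theta>\<^sup>2)))"
    using exp_symbol_expansion_inside[OF c, of K] by blast
  define W where "W = (\<Sum>m=1..K. \<Sum>n\<le>K. \<bar>fps_nth (symbol_fps ^ m) n\<bar>)"
  have "W \<ge> 0" unfolding W_def by (intro sum_nonneg) auto
  have "\<bar>indicator {-pi..pi} \<theta> * exp (- (t * A \<theta>)) - exp (- (t * \<theta>\<^sup>2)) * (1 + correction K (t * \<theta>\<^sup>2) (\<theta>\<^sup>2))\<bar>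
     \<le> (C + (1 + W)) * ((\<theta>\<^sup>2) ^ Suc K * (\<Sum>m\<le>Suc K. (t * \<theta>\<^sup>2) ^ m)) * exp (- (c * (t * \<theta>\<^sup>2)))"
    if t: "t > 0" for t \<theta>
  proof -
    define P where "P = (\<theta>\<^sup>2) ^ Suc K * (\<Sum>m\<le>Suc K. (t * \<theta>\<^sup>2) ^ m)"
    define e where "e = exp (- (c * (t * \<theta>\<^sup>2)))"
    have P0: "P \<ge> 0" unfolding P_def using t by (intro mult_nonneg_nonneg sum_nonneg) auto
    show ?thesis
    proof (cases "\<bar>\<theta>\<bar> \<le> pi")
      case True
      then have "\<bar>indicator {-pi..pi} \<theta> * exp (- (t * A \<theta>)) - exp (- (t * \<theta>\<^sup>2)) * (1 + correction K (t * \<theta>\<^sup>2) (\<theta>\<^sup>2))\<bar>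
         \<le> C * P * e"
        using C(2)[OF t True] unfolding P_def e_def by (auto simp: indicator_def abs_le_iff)
      also have "\<dots> \<le> (C + (1 + W)) * P * e"
        using \<open>W \<ge> 0\<close> P0 by (intro mult_right_mono) (auto simp: e_def)
      finally show ?thesis unfolding P_def e_def .
    next
      case False
      then have "1 \<le> \<bar>\<theta>\<bar>" using pi_gt3 by linarith
      then have z: "1 \<le> \<theta>\<^sup>2" by (metis one_le_power power2_abs)
      have "1 * 1 \<le> P"
        unfolding P_def
      proof (intro mult_mono)
        show "1 \<le> (\<theta>\<^sup>2) ^ Suc K" using z by (rule one_le_power)
        show "1 \<le> (\<Sum>m\<le>Suc K. (t * \<theta>\<^sup>2) ^ m)"
          using t member_le_sum[of 0 "{..Suc K}" "\<lambda>m. (t * \<theta>\<^sup>2) ^ m"] by auto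
      qed auto
      then have 1: "\<bar>1 + correction K (t * \<theta>\<^sup>2) (\<theta>\<^sup>2)\<bar> \<le> (1 + W) * P"
        using correction_bound[of "t * \<theta>\<^sup>2" "\<theta>\<^sup>2" K] z t unfolding P_def[symmetric] W_def[symmetric]
        by (simp add: distrib_right)
      have "c * (t * \<theta>\<^sup>2) \<le> 1 * (t * \<theta>\<^sup>2)" using c(2) t by (intro mult_right_mono) auto
      then have 2: "exp (- (t * \<theta>\<^sup>2)) \<le> e" unfolding e_def by simp
      have "\<bar>indicator {-pi..pi} \<theta> * exp (- (t * A \<theta>)) - exp (- (t * \<theta>\<^sup>2)) * (1 + correction K (t * \<theta>\<^sup>2) (\<theta>\<^sup>2))\<bar>
         = exp (- (t * \<theta>\<^sup>2)) * \<bar>1 + correction K (t * \<theta>\<^sup>2) (\<theta>\<^sup>2)\<bar>"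
        using False by (auto simp: indicator_def abs_mult)
      also have "\<dots> \<le> e * ((1 + W) * P)"
        using 1 2 by (intro mult_mono) (auto simp: e_def)
      also have "\<dots> \<le> (C + (1 + W)) * P * e"
        using C(1) P0 by (simp add: e_def algebra_simps)
      finally show ?thesis unfolding P_def e_def .
    qed
  qed
  then show ?thesis using c(1) C(1) \<open>W \<ge> 0\<close> by (intro exI[of _ c] exI[of _ "C + (1 + W)"]) auto
qed

lemma first_green_eq_lborel:
  "first_green x t = 1 / (2 * pi) * (LINT \<theta>|lborel. indicator {-pi..pi} \<theta> * exp (- (t * A \<theta>)) * cos (x * \<theta>))"
  and integrable_first_green:
  "integrable lborel (\<lambda>\<theta>. indicator {-pi..pi} \<theta> * exp (- (t * A \<theta>)) * cos (x * \<theta>))"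
proof -
  have *: "set_integrable lborel {-pi..pi} (\<lambda>\<theta>. exp (- (t * A \<theta>)) * cos (x * \<theta>))"
    by (intro borel_integrable_atLeastAtMost' continuous_intros continuous_on_A)
  then show "integrable lborel (\<lambda>\<theta>. indicator {-pi..pi} \<theta> * exp (- (t * A \<theta>)) * cos (x * \<theta>))"
    by (simp add: set_integrable_def mult.assoc)
  show "first_green x t = 1 / (2 * pi) * (LINT \<theta>|lborel. indicator {-pi..pi} \<theta> * exp (- (t * A \<theta>)) * cos (x * \<theta>))"
    using set_borel_integral_eq_integral(2)[OF *]
    by (simp add: first_green_def set_lebesgue_integral_def mult.assoc)
qed

lemma heat_expansion_integral:
  assumes "t > 0"
  shows "(heat_kernel (x / sqrt t) + (\<Sum>n=N..K. h0 N a n (x / sqrt t) / t ^ n)) / sqrt t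
     = 1 / (2 * pi) * (LINT \<theta>|lborel. exp (- (t * \<theta>\<^sup>2)) * (1 + correction K (t * \<theta>\<^sup>2) (\<theta>\<^sup>2)) * cos (x * \<theta>))"
    and "integrable lborel (\<lambda>\<theta>. exp (- (t * \<theta>\<^sup>2)) * (1 + correction K (t * \<theta>\<^sup>2) (\<theta>\<^sup>2)) * cos (x * \<theta>))"
proof -
  define y where "y = x / sqrt t"
  define e where "e \<xi> = exp (- \<xi>\<^sup>2) * cos (y * \<xi>)" for \<xi>
  define q where "q n \<xi> = poly (P_poly N a n) \<xi> * exp (- \<xi>\<^sup>2) * cos (y * \<xi>)" for n \<xi>
  have int_e: "integrable lborel e"
    using integrable_gauss_cos[of 0 y 0] by (simp add: e_def[abs_def])
  have int_q: "integrable lborel (q n)" for n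
    using integrable_h0_integrand unfolding q_def[abs_def] .
  define f where "f \<xi> = e \<xi> + (\<Sum>n=N..K. q n \<xi> / t ^ n)" for \<xi>
  have int_f: "integrable lborel f"
    unfolding f_def[abs_def] using int_e int_q by auto
  have "(LINT \<xi>|lborel. f \<xi>) = (LINT \<xi>|lborel. e \<xi>) + (\<Sum>n=N..K. (LINT \<xi>|lborel. q n \<xi>) / t ^ n)"
    unfolding f_def[abs_def] using int_e int_q by simp
  also have "\<dots> = 2 * pi * (heat_kernel y + (\<Sum>n=N..K. h0 N a n y / t ^ n))"
    unfolding heat_kernel_eq_integral h0_eq_integral e_def q_def
    by (simp add: distrib_left sum_distrib_left)
  finally have f_int: "(LINT \<xi>|lborel. f \<xi>) = 2 * pi * (heat_kernel y + (\<Sum>n=N..K. h0 N a n y / t ^ n))" .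
  have f_eq: "f (0 + sqrt t * \<theta>) = exp (- (t * \<theta>\<^sup>2)) * (1 + correction K (t * \<theta>\<^sup>2) (\<theta>\<^sup>2)) * cos (x * \<theta>)" for \<theta>
  proof -
    have scale: "y * (sqrt t * \<theta>) = x * \<theta>" "(sqrt t * \<theta>)\<^sup>2 = t * \<theta>\<^sup>2"
      using assms by (auto simp: y_def power_mult_distrib)
    show ?thesis
      unfolding f_def e_def q_def add_0 scale correction_eq[OF assms, symmetric]
      by (simp add: distrib_left distrib_right sum_distrib_left sum_distrib_right mult_ac)
  qed
  have sq: "sqrt t \<noteq> 0" using assms by simp
  show "integrable lborel (\<lambda>\<theta>. exp (- (t * \<theta>\<^sup>2)) * (1 + correction K (t * \<theta>\<^sup>2) (\<theta>\<^sup>2)) * cos (x * \<theta>))"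
    using lborel_integrable_real_affine[OF int_f sq, of 0] unfolding f_eq .
  have "(LINT \<xi>|lborel. f \<xi>) = \<bar>sqrt t\<bar> *\<^sub>R (LINT \<theta>|lborel. f (0 + sqrt t * \<theta>))"
    using sq by (rule lborel_integral_real_affine)
  then show "(heat_kernel (x / sqrt t) + (\<Sum>n=N..K. h0 N a n (x / sqrt t) / t ^ n)) / sqrt t
     = 1 / (2 * pi) * (LINT \<theta>|lborel. exp (- (t * \<theta>\<^sup>2)) * (1 + correction K (t * \<theta>\<^sup>2) (\<theta>\<^sup>2)) * cos (x * \<theta>))"
    using assms unfolding f_eq f_int y_def[symmetric] by (simp add: field_simps)
qed

text \<open>Substituting \<xi> = sqrt t * \<theta>: the factor (\<theta>^2) ^ Suc K gives the
  integer power of t, the differential gives sqrt t, and the powers of t \<theta>^2 are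
  invariant.\<close>

lemma scaled_majorant:
  assumes "c > 0" "t > 0"
  shows "integrable lborel (\<lambda>\<theta>::real. (\<theta>\<^sup>2) ^ Suc K * (\<Sum>m\<le>Suc K. (t * \<theta>\<^sup>2) ^ m) * exp (- (c * (t * \<theta>\<^sup>2))))"
    and "(LINT \<theta>::real|lborel. (\<theta>\<^sup>2) ^ Suc K * (\<Sum>m\<le>Suc K. (t * \<theta>\<^sup>2) ^ m) * exp (- (c * (t * \<theta>\<^sup>2))))
     = (LINT \<xi>::real|lborel. (\<xi>\<^sup>2) ^ Suc K * (\<Sum>m\<le>Suc K. (\<xi>\<^sup>2) ^ m) * exp (- (c * \<xi>\<^sup>2))) / (t ^ Suc K * sqrt t)"
proof -
  define f :: "real \<Rightarrow> real" where "f \<xi> = (\<xi>\<^sup>2) ^ Suc K * (\<Sum>m\<le>Suc K. (\<xi>\<^sup>2) ^ m) * exp (- (c * \<xi>\<^sup>2))" for \<xi>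
  have "f = (\<lambda>\<xi>. \<Sum>m\<le>Suc K. \<bar>\<xi>\<bar> ^ (2 * (Suc K + m)) * exp (- (c * \<xi>\<^sup>2)))"
    unfolding f_def[abs_def] sum_distrib_left sum_distrib_right
    by (intro ext sum.cong refl) (simp only: power_mult power2_abs power_add)
  moreover have "integrable lborel (\<lambda>\<xi>::real. \<Sum>m\<le>Suc K. \<bar>\<xi>\<bar> ^ (2 * (Suc K + m)) * exp (- (c * \<xi>\<^sup>2)))"
    by (intro Bochner_Integration.integrable_sum integrable_gauss_moment assms)
  ultimately have int_f: "integrable lborel f" by simp
  have f_eq: "f (0 + sqrt t * \<theta>) / t ^ Suc K = (\<theta>\<^sup>2) ^ Suc K * (\<Sum>m\<le>Suc K. (t * \<theta>\<^sup>2) ^ m) * exp (- (c * (t * \<theta>\<^sup>2)))" for \<theta>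
  proof -
    have "(0 + sqrt t * \<theta>)\<^sup>2 = t * \<theta>\<^sup>2" using assms by (simp add: power_mult_distrib)
    then show ?thesis
      unfolding f_def using assms by (simp only: power_mult_distrib[of t "\<theta>\<^sup>2" "Suc K"]) (simp del: power_Suc sum.atMost_Suc)
  qed
  have sq: "sqrt t \<noteq> 0" using assms by simp
  show "integrable lborel (\<lambda>\<theta>::real. (\<theta>\<^sup>2) ^ Suc K * (\<Sum>m\<le>Suc K. (t * \<theta>\<^sup>2) ^ m) * exp (- (c * (t * \<theta>\<^sup>2))))"
    using integrable_divide[OF lborel_integrable_real_affine[OF int_f sq, of 0], of "t ^ Suc K"] unfolding f_eq by simp
  have "(LINT \<xi>|lborel. f \<xi>) = \<bar>sqrt t\<bar> *\<^sub>R (LINT \<theta>|lborel. f (0 + sqrt t * \<theta>))"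
    using sq by (rule lborel_integral_real_affine)
  moreover have "(LINT \<theta>|lborel. f (0 + sqrt t * \<theta>) / t ^ Suc K) = (LINT \<theta>|lborel. f (0 + sqrt t * \<theta>)) / t ^ Suc K"
    by (rule integral_divide_zero)
  ultimately show "(LINT \<theta>::real|lborel. (\<theta>\<^sup>2) ^ Suc K * (\<Sum>m\<le>Suc K. (t * \<theta>\<^sup>2) ^ m) * exp (- (c * (t * \<theta>\<^sup>2))))
     = (LINT \<xi>::real|lborel. (\<xi>\<^sup>2) ^ Suc K * (\<Sum>m\<le>Suc K. (\<xi>\<^sup>2) ^ m) * exp (- (c * \<xi>\<^sup>2))) / (t ^ Suc K * sqrt t)"
    unfolding f_eq f_def[symmetric] using assms by (simp add: field_simps)
qed

text \<open>Uniform in \<open>x\<close>, since \<open>x\<close> enters the error integrand only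
  through a cosine bounded by 1.\<close>

lemma first_green_expansion:
  "\<exists>C\<ge>0. \<forall>x. \<forall>t>0. \<bar>first_green x t
      - (heat_kernel (x / sqrt t) + (\<Sum>n=N..K. h0 N a n (x / sqrt t) / t ^ n)) / sqrt t\<bar>
     \<le> C / (t ^ Suc K * sqrt t)"
proof -
  obtain c C where c: "c > 0" and C: "C \<ge> 0" "\<And>t \<theta>. t > 0 \<Longrightarrow>
    \<bar>indicator {-pi..pi} \<theta> * exp (- (t * A \<theta>)) - exp (- (t * \<theta>\<^sup>2)) * (1 + correction K (t * \<theta>\<^sup>2) (\<theta>\<^sup>2))\<bar>
     \<le> C * ((\<theta>\<^sup>2) ^ Suc K * (\<Sum>m\<le>Suc K. (t * \<theta>\<^sup>2) ^ m)) * exp (- (c * (t * \<theta>\<^sup>2)))"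
    using exp_symbol_expansion[of K] by blast
  define I where "I = (LINT \<xi>::real|lborel. (\<xi>\<^sup>2) ^ Suc K * (\<Sum>m\<le>Suc K. (\<xi>\<^sup>2) ^ m) * exp (- (c * \<xi>\<^sup>2)))"
  have "I \<ge> 0"
    unfolding I_def by (intro Bochner_Integration.integral_nonneg mult_nonneg_nonneg sum_nonneg) auto
  show ?thesis
  proof (intro exI conjI allI impI)
    show "1 / (2 * pi) * (C * I) \<ge> 0" using C(1) \<open>I \<ge> 0\<close> by simp
    fix x t :: real assume t: "t > 0"
    let ?u = "\<lambda>\<theta>. indicator {-pi..pi} \<theta> * exp (- (t * A \<theta>)) * cos (x * \<theta>)"
    let ?w = "\<lambda>\<theta>. exp (- (t * \<theta>\<^sup>2)) * (1 + correction K (t * \<theta>\<^sup>2) (\<theta>\<^sup>2)) * cos (x * \<theta>)"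
    let ?m = "\<lambda>\<theta>::real. (\<theta>\<^sup>2) ^ Suc K * (\<Sum>m\<le>Suc K. (t * \<theta>\<^sup>2) ^ m) * exp (- (c * (t * \<theta>\<^sup>2)))"
    have diff: "first_green x t - (heat_kernel (x / sqrt t) + (\<Sum>n=N..K. h0 N a n (x / sqrt t) / t ^ n)) / sqrt t
       = 1 / (2 * pi) * (LINT \<theta>|lborel. ?u \<theta> - ?w \<theta>)"
      unfolding first_green_eq_lborel heat_expansion_integral(1)[OF t]
        Bochner_Integration.integral_diff[OF integrable_first_green heat_expansion_integral(2)[OF t]]
      by (rule right_diff_distrib[symmetric])
    have "\<bar>LINT \<theta>|lborel. ?u \<theta> - ?w \<theta>\<bar> \<le> (LINT \<theta>|lborel. C * ?m \<theta>)"
    proof (rule integral_abs_bound_integral)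
      show "integrable lborel (\<lambda>\<theta>. ?u \<theta> - ?w \<theta>)"
        by (rule Bochner_Integration.integrable_diff[OF integrable_first_green heat_expansion_integral(2)[OF t]])
      show "integrable lborel (\<lambda>\<theta>. C * ?m \<theta>)"
        by (rule integrable_mult_right[OF scaled_majorant(1)[OF c t]])
      fix \<theta>
      have "\<bar>?u \<theta> - ?w \<theta>\<bar> = \<bar>indicator {-pi..pi} \<theta> * exp (- (t * A \<theta>))
          - exp (- (t * \<theta>\<^sup>2)) * (1 + correction K (t * \<theta>\<^sup>2) (\<theta>\<^sup>2))\<bar> * \<bar>cos (x * \<theta>)\<bar>"
        unfolding abs_mult[symmetric] by (simp only: left_diff_distrib)
      also have "\<dots> \<le> (C * ((\<theta>\<^sup>2) ^ Suc K * (\<Sum>m\<le>Suc K. (t * \<theta>\<^sup>2) ^ m)) * exp (- (c * (t * \<theta>\<^sup>2)))) * 1"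
        using C(2)[OF t, of \<theta>] by (intro mult_mono) (auto intro: order_trans[OF abs_ge_zero])
      finally show "\<bar>?u \<theta> - ?w \<theta>\<bar> \<le> C * ?m \<theta>" by (simp only: mult_ac mult_1_right)
    qed
    also have "\<dots> = C * (I / (t ^ Suc K * sqrt t))"
      unfolding I_def scaled_majorant(2)[OF c t, symmetric] by (rule integral_mult_right_zero)
    finally have "1 / (2 * pi) * \<bar>LINT \<theta>|lborel. ?u \<theta> - ?w \<theta>\<bar> \<le> 1 / (2 * pi) * (C * (I / (t ^ Suc K * sqrt t)))"
      by (intro mult_left_mono) auto
    then show "\<bar>first_green x t
      - (heat_kernel (x / sqrt t) + (\<Sum>n=N..K. h0 N a n (x / sqrt t) / t ^ n)) / sqrt t\<bar>
     \<le> 1 / (2 * pi) * (C * I) / (t ^ Suc K * sqrt t)"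
      unfolding diff abs_mult by (simp only: abs_of_pos times_divide_eq_right pi_gt_zero zero_less_divide_1_iff zero_less_mult_iff zero_less_numeral simp_thms)
  qed
qed

end

section \<open>The terms of the expansion\<close>

text \<open>For y \<ge> 0 this is erf (y / 2) / 2.\<close>

definition heat_primitive :: "real \<Rightarrow> real" where
  "heat_primitive y = integral {0..y} heat_kernel"

lemma continuous_on_heat_kernel: "continuous_on S heat_kernel"
  unfolding heat_kernel_def by (intro continuous_intros) auto

lemma heat_kernel_pos: "heat_kernel y > 0"
  by (simp add: heat_kernel_def)

lemma heat_kernel_le_1: "heat_kernel y \<le> 1"
proof -
  have "1 \<le> sqrt pi" using pi_gt3 by (intro real_sqrt_ge_one) simp
  then have "1 \<le> 2 * sqrt pi" by linarith
  then have "1 / (2 * sqrt pi) * exp (- (y ^ 2 / 4)) \<le> 1 * 1"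
    by (intro mult_mono) auto
  then show ?thesis by (simp add: heat_kernel_def)
qed

lemma integral_indefinite_deriv:
  fixes g :: "real \<Rightarrow> real"
  assumes "continuous_on {0..} g" "y > 0"
  shows "((\<lambda>y. integral {0..y} g) has_real_derivative g y) (at y)"
proof -
  have "((\<lambda>y. integral {0..y} g) has_real_derivative g y) (at y within {0..y+1})"
    using assms by (intro integral_has_real_derivative continuous_on_subset[OF assms(1)]) auto
  moreover have "y \<in> interior {0..y+1}" using assms by simp
  ultimately show ?thesis by (simp only: at_within_interior)
qed

lemma integral_indefinite_tendsto_0:
  fixes g :: "real \<Rightarrow> real"
  assumes "continuous_on {0..} g"
  shows "((\<lambda>y. integral {0..y} g) \<longlongrightarrow> 0) (at_right 0)"
proof -
  have "continuous_on {0..1} (\<lambda>y. integral {0..y} g)"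
    using assms by (intro indefinite_integral_continuous_1 integrable_continuous_real continuous_on_subset[OF assms]) auto
  then have "((\<lambda>y. integral {0..y} g) \<longlongrightarrow> integral {0..0} g) (at 0 within {0..1})"
    by (rule continuous_on_def[THEN iffD1, THEN bspec]) simp
  then have "((\<lambda>y. integral {0..y} g) \<longlongrightarrow> 0) (at 0 within {0..1})" by simp
  then show ?thesis by (simp add: at_within_Icc_at_right)
qed

lemma heat_primitive_deriv: "y > 0 \<Longrightarrow> (heat_primitive has_real_derivative heat_kernel y) (at y)"
  unfolding heat_primitive_def[abs_def]
  by (intro integral_indefinite_deriv continuous_on_heat_kernel)

lemma heat_primitive_bound:
  assumes "y \<ge> 0"
  shows "\<bar>heat_primitive y\<bar> \<le> y"
proof -
  have "norm (integral {0..y} heat_kernel) \<le> 1 * (y - 0)"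
    using heat_kernel_le_1 heat_kernel_pos less_imp_le[OF heat_kernel_pos]
    by (intro integral_bound assms continuous_on_heat_kernel) auto
  then show ?thesis by (simp add: heat_primitive_def)
qed

lemma set_integrable_heat_kernel: "set_integrable lborel {0..} heat_kernel"
  and integral_heat_kernel: "(LINT \<rho>:{0..}|lborel. heat_kernel \<rho>) = 1 / 2"
proof -
  define f :: "real \<Rightarrow> real" where "f x = indicator {0..} x *\<^sub>R exp (- x\<^sup>2)" for x
  have f: "integrable lborel f" "(LINT x|lborel. f x) = sqrt pi / 2"
    using gaussian_moment_0 unfolding f_def by (auto simp: has_bochner_integral_iff)
  have f_eq: "1 / (2 * sqrt pi) * f (0 + (1/2) * \<rho>) = indicator {0..} \<rho> *\<^sub>R heat_kernel \<rho>" for \<rho>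
    by (simp add: f_def heat_kernel_def indicator_def power_divide)
  have "integrable lborel (\<lambda>\<rho>. 1 / (2 * sqrt pi) * f (0 + (1/2) * \<rho>))"
    by (intro integrable_mult_right lborel_integrable_real_affine f) auto
  then show "set_integrable lborel {0..} heat_kernel"
    unfolding set_integrable_def f_eq .
  have "(LINT x|lborel. f x) = \<bar>1/2\<bar> *\<^sub>R (LINT \<rho>|lborel. f (0 + (1/2) * \<rho>))"
    by (rule lborel_integral_real_affine) simp
  then have "(LINT \<rho>|lborel. f (0 + (1/2) * \<rho>)) = sqrt pi"
    unfolding f by simp
  then have "(LINT \<rho>|lborel. 1 / (2 * sqrt pi) * f (0 + (1/2) * \<rho>)) = 1 / 2"
    unfolding integral_mult_right_zero by simp
  then show "(LINT \<rho>:{0..}|lborel. heat_kernel \<rho>) = 1 / 2"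
    unfolding set_lebesgue_integral_def f_eq .
qed

lemma heat_primitive_at_top: "(heat_primitive \<longlongrightarrow> 1 / 2) at_top"
proof -
  have "((\<lambda>b. LINT \<rho>:{0..b}|lborel. heat_kernel \<rho>) \<longlongrightarrow> (LINT \<rho>:{0..}|lborel. heat_kernel \<rho>)) at_top"
    by (intro tendsto_set_lebesgue_integral_at_top set_integrable_heat_kernel) auto
  moreover have "(LINT \<rho>:{0..b}|lborel. heat_kernel \<rho>) = heat_primitive b" for b
    unfolding heat_primitive_def
    by (intro set_borel_integral_eq_integral borel_integrable_atLeastAtMost' continuous_on_heat_kernel)
  ultimately show ?thesis by (simp add: integral_heat_kernel)
qed

lemma integral_heat_kernel_over_square:
  assumes "y > 0"
  shows "integral {y..} (\<lambda>\<rho>. heat_kernel \<rho> / \<rho>\<^sup>2) = heat_kernel y / y + heat_primitive y / 2 - 1 / 4"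
proof -
  let ?f = "\<lambda>\<rho>. heat_kernel \<rho> / \<rho>\<^sup>2"
  \<comment> \<open>Integration by parts with h' = - (\<rho> / 2) h. The limit - 1 / 4 of
    \<open>G\<close> at infinity is half the mass 1 / 2 of the heat kernel on the half line,
    negated.\<close>
  define G where "G \<rho> = - heat_kernel \<rho> / \<rho> - heat_primitive \<rho> / 2" for \<rho>
  have int: "set_integrable lborel {y..} ?f"
  proof (rule set_integrable_bound)
    have "set_integrable lborel {y..} heat_kernel"
      using assms by (intro set_integrable_subset[OF set_integrable_heat_kernel]) auto
    then show "set_integrable lborel {y..} (\<lambda>\<rho>. heat_kernel \<rho> / y\<^sup>2)"
      by (rule set_integrable_divide)
    have [measurable]: "heat_kernel \<in> borel_measurable borel"
      using borel_measurable_continuous_onI[OF continuous_on_heat_kernel] .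
    show "set_borel_measurable lborel {y..} ?f"
      unfolding set_borel_measurable_def by measurable
    show "AE \<rho> in lborel. \<rho> \<in> {y..} \<longrightarrow> norm (?f \<rho>) \<le> norm (heat_kernel \<rho> / y\<^sup>2)"
      using assms heat_kernel_pos
      by (intro AE_I2) (auto simp: abs_divide intro!: divide_left_mono power_mono)
  qed
  have G_deriv: "(G has_real_derivative ?f \<rho>) (at \<rho>)" if "\<rho> \<ge> y" for \<rho>
    unfolding G_def using that assms
    by (auto intro!: derivative_eq_intros heat_kernel_deriv heat_primitive_deriv simp: field_simps power2_eq_square)
  have "((\<lambda>b. LINT \<rho>:{y..b}|lborel. ?f \<rho>) \<longlongrightarrow> (LINT \<rho>:{y..}|lborel. ?f \<rho>)) at_top"
    by (intro tendsto_set_lebesgue_integral_at_top int) auto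
  moreover have "eventually (\<lambda>b. (LINT \<rho>:{y..b}|lborel. ?f \<rho>) = G b - G y) at_top"
    using eventually_ge_at_top[of y]
  proof eventually_elim
    case (elim b)
    have "(?f has_integral (G b - G y)) {y..b}"
      using elim G_deriv
      by (intro fundamental_theorem_of_calculus)
         (auto simp: has_real_derivative_iff_has_vector_derivative[symmetric] intro: DERIV_subset)
    moreover have "(LINT \<rho>:{y..b}|lborel. ?f \<rho>) = integral {y..b} ?f"
      by (intro set_borel_integral_eq_integral set_integrable_subset[OF int]) auto
    ultimately show ?case by (simp add: integral_unique)
  qed
  ultimately have lim1: "((\<lambda>b. G b - G y) \<longlongrightarrow> (LINT \<rho>:{y..}|lborel. ?f \<rho>)) at_top"
    by (rule Lim_transform_eventually)
  have lim2: "((\<lambda>b. G b - G y) \<longlongrightarrow> (- 0 - (1/2) / 2) - G y) at_top"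
    unfolding G_def minus_divide_left[symmetric]
  proof (intro tendsto_intros heat_primitive_at_top)
    show "((\<lambda>b. heat_kernel b / b) \<longlongrightarrow> 0) at_top"
    proof (rule Lim_null_comparison)
      show "eventually (\<lambda>b. norm (heat_kernel b / b) \<le> 1 / b) at_top"
        using eventually_gt_at_top[of 0]
        by eventually_elim (use heat_kernel_le_1 heat_kernel_pos in \<open>auto simp: divide_right_mono less_imp_le\<close>)
      show "((\<lambda>b::real. 1 / b) \<longlongrightarrow> 0) at_top"
        by (intro tendsto_divide_0[OF tendsto_const] filterlim_at_top_imp_at_infinity filterlim_ident)
    qed
  qed auto
  show ?thesis
    using tendsto_unique[OF trivial_limit_at_top_linorder lim1 lim2]
    unfolding set_borel_integral_eq_integral(2)[OF int] by (simp add: G_def)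
qed

text \<open>A closed form without singularity, which also settles the limit at 0. The value 2 h(0) =
  1 / sqrt pi there is the source of the growth sqrt t / sqrt pi.\<close>

lemma f_zero_eq:
  assumes "y \<ge> 0"
  shows "f_zero y = 2 * heat_kernel y + y * (heat_primitive y - 1 / 2)"
proof -
  have pos: "2 * y * integral {y..} (\<lambda>\<rho>. heat_kernel \<rho> / \<rho>\<^sup>2) = 2 * heat_kernel y + y * (heat_primitive y - 1 / 2)"
    if "y > 0" for y
    unfolding integral_heat_kernel_over_square[OF that] using that by (simp add: field_simps)
  show ?thesis
  proof (cases "y = 0")
    case True
    have "((\<lambda>y. 2 * heat_kernel y + y * (heat_primitive y - 1 / 2)) \<longlongrightarrow> 2 * heat_kernel 0 + 0 * (0 - 1 / 2)) (at_right 0)"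
      unfolding heat_primitive_def
      by (intro tendsto_intros integral_indefinite_tendsto_0 continuous_on_heat_kernel
            tendsto_within_subset[OF isContD[OF DERIV_isCont[OF heat_kernel_deriv]]]) auto
    then have "((\<lambda>y. 2 * heat_kernel y + y * (heat_primitive y - 1 / 2)) \<longlongrightarrow> 2 * heat_kernel 0) (at_right 0)"
      by simp
    then have "((\<lambda>y. 2 * y * integral {y..} (\<lambda>\<rho>. heat_kernel \<rho> / \<rho>\<^sup>2)) \<longlongrightarrow> 2 * heat_kernel 0) (at_right 0)"
      by (rule Lim_transform_eventually)
         (auto simp: pos eventually_at_filter)
    then have "Lim (at_right 0) (\<lambda>y. 2 * y * integral {y..} (\<lambda>\<rho>. heat_kernel \<rho> / \<rho>\<^sup>2)) = 2 * heat_kernel 0"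
      by (intro tendsto_Lim) auto
    with True show ?thesis by (simp add: f_zero_def extend_at_0_def)
  next
    case False
    with pos[of y] assms show ?thesis by (simp add: f_zero_def extend_at_0_def)
  qed
qed

lemma scaled_f_zero_eq:
  assumes "x \<ge> 0" "t > 0"
  shows "sqrt t * f_zero (x / sqrt t) = 2 * sqrt t * heat_kernel (x / sqrt t) + x * (heat_primitive (x / sqrt t) - 1 / 2)"
  using assms by (simp add: f_zero_eq distrib_left)

lemma div_sqrt_deriv:
  assumes "t > 0"
  shows "((\<lambda>t. x / sqrt t) has_real_derivative - (x / sqrt t) / (2 * t)) (at t)"
  using assms by (auto intro!: derivative_eq_intros simp: field_simps power2_eq_square)

lemma scaled_f_zero_deriv:
  assumes "x \<ge> 0" "t > 0"
  shows "((\<lambda>t. sqrt t * f_zero (x / sqrt t)) has_real_derivative heat_kernel (x / sqrt t) / sqrt t) (at t)"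
proof -
  let ?F = "\<lambda>t. 2 * sqrt t * heat_kernel (x / sqrt t) + x * (heat_primitive (x / sqrt t) - 1 / 2)"
  have "(?F has_real_derivative heat_kernel (x / sqrt t) / sqrt t) (at t)"
  \<comment> \<open>\<open>heat_primitive\<close> is 0 on negative arguments, hence has no two-sided
    derivative at 0; for x = 0 its term drops out.\<close>
  proof (cases "x = 0")
    case True
    then show ?thesis using assms
      by (auto intro!: derivative_eq_intros simp: field_simps)
  next
    case False
    define y where "y = x / sqrt t"
    have y: "y > 0" "x = y * sqrt t" using False assms by (auto simp: y_def)
    have d: "((\<lambda>t. heat_kernel (x / sqrt t)) has_real_derivative - (y / 2) * heat_kernel y * (- y / (2 * t))) (at t)"
      using DERIV_chain2[OF heat_kernel_deriv div_sqrt_deriv[OF assms(2)]] by (simp add: y_def)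
    have e: "((\<lambda>t. heat_primitive (x / sqrt t)) has_real_derivative heat_kernel y * (- y / (2 * t))) (at t)"
      using DERIV_chain2[OF heat_primitive_deriv div_sqrt_deriv[OF assms(2)]] y(1) by (simp add: y_def)
    have "(?F has_real_derivative (2 * (inverse (sqrt t) / 2) * heat_kernel y + 2 * sqrt t * (- (y / 2) * heat_kernel y * (- y / (2 * t)))
        + x * (heat_kernel y * (- y / (2 * t))))) (at t)"
      by (rule derivative_eq_intros d e DERIV_real_sqrt assms(2) refl | simp add: y_def[symmetric])+
    also have "2 * (inverse (sqrt t) / 2) * heat_kernel y + 2 * sqrt t * (- (y / 2) * heat_kernel y * (- y / (2 * t)))
        + x * (heat_kernel y * (- y / (2 * t))) = heat_kernel y / sqrt t"
      unfolding y(2) using assms(2) by (simp add: field_simps)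
    finally show ?thesis by (simp add: y_def)
  qed
  moreover have "eventually (\<lambda>s. s > 0) (nhds t)"
    using assms(2) eventually_nhds_in_open[of "{0<..}" t] by auto
  then have "eventually (\<lambda>s. sqrt s * f_zero (x / sqrt s) = ?F s) (nhds t)"
    by eventually_elim (rule scaled_f_zero_eq[OF assms(1)])
  ultimately show ?thesis by (subst DERIV_cong_ev[OF refl _ refl])
qed

text \<open>With y = x / sqrt t, both 1 - exp (- y^2 / 4) and the primitive are small in y, which
  leaves an error of order x^2 / sqrt t. It is not uniform in \<open>x\<close>, but only the limit
  for fixed \<open>x\<close> is used.\<close>

lemma scaled_f_zero_limit:
  assumes "x \<ge> 0"
  shows "((\<lambda>t. sqrt t * f_zero (x / sqrt t) - sqrt t / sqrt pi) \<longlongrightarrow> - x / 2) at_top"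
proof (rule LIM_zero_cancel, rule Lim_null_comparison)
  show "eventually (\<lambda>t. norm (sqrt t * f_zero (x / sqrt t) - sqrt t / sqrt pi - - x / 2) \<le> 2 * x\<^sup>2 / sqrt t) at_top"
    using eventually_gt_at_top[of 0]
  proof eventually_elim
    case (elim t)
    define y where "y = x / sqrt t"
    have y: "y \<ge> 0" "x = y * sqrt t" using elim assms by (auto simp: y_def)
    have heat: "2 * sqrt t * heat_kernel y = sqrt t / sqrt pi * exp (- (y\<^sup>2 / 4))" by (simp add: heat_kernel_def)
    have eq: "sqrt t * f_zero (x / sqrt t) - sqrt t / sqrt pi - - x / 2
       = - (sqrt t / sqrt pi * (1 - exp (- (y\<^sup>2 / 4)))) + x * heat_primitive y"
      using scaled_f_zero_eq[OF assms elim] unfolding y_def[symmetric] heat right_diff_distrib by linarith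
    have "1 - exp (- (y\<^sup>2 / 4)) \<le> y\<^sup>2 / 4" using exp_ge_add_one_self[of "- (y\<^sup>2 / 4)"] by simp
    moreover have "0 \<le> 1 - exp (- (y\<^sup>2 / 4))" by simp
    moreover have "sqrt t / sqrt pi \<le> sqrt t"
      using pi_gt3 elim by (simp add: field_simps)
    ultimately have "sqrt t / sqrt pi * (1 - exp (- (y\<^sup>2 / 4))) \<le> sqrt t * (y\<^sup>2 / 4)"
      using elim by (intro mult_mono) auto
    moreover have "0 \<le> sqrt t / sqrt pi * (1 - exp (- (y\<^sup>2 / 4)))"
      using elim \<open>0 \<le> 1 - exp (- (y\<^sup>2 / 4))\<close> by (intro mult_nonneg_nonneg) auto
    moreover have "\<bar>x * heat_primitive y\<bar> \<le> x * y"
      unfolding abs_mult using heat_primitive_bound[OF y(1)] assms by (simp add: mult_left_mono)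
    ultimately have "\<bar>- (sqrt t / sqrt pi * (1 - exp (- (y\<^sup>2 / 4)))) + x * heat_primitive y\<bar> \<le> sqrt t * (y\<^sup>2 / 4) + x * y"
      by linarith
    also have "\<dots> \<le> 2 * (y\<^sup>2 * sqrt t)"
      using y elim by (simp add: power2_eq_square mult_ac)
    also have "\<dots> = 2 * x\<^sup>2 / sqrt t"
      using elim unfolding y(2) by (simp add: power2_eq_square field_simps)
    finally show ?case unfolding eq by simp
  qed
  show "((\<lambda>t. 2 * x\<^sup>2 / sqrt t) \<longlongrightarrow> 0) at_top"
    by (intro tendsto_divide_0[OF tendsto_const] filterlim_at_top_imp_at_infinity sqrt_at_top)
qed

section \<open>Half-integer powers of t and the terms f_n\<close>

lemma inverse_half_power_eq:
  "t > 0 \<Longrightarrow> 1 / (t ^ k * sqrt t) = t powr (- (real k + 1 / 2))"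
  unfolding powr_minus powr_add by (simp add: powr_realpow powr_half_sqrt inverse_eq_divide)

lemma inverse_half_power_deriv:
  assumes "t > 0"
  shows "((\<lambda>t. 1 / (t ^ k * sqrt t)) has_real_derivative - (real k + 1 / 2) * (1 / (t ^ Suc k * sqrt t))) (at t)"
proof -
  have "((\<lambda>t. t powr (- (real k + 1 / 2))) has_real_derivative - (real k + 1 / 2) * t powr (- (real k + 1 / 2) - 1)) (at t)"
    using assms by (intro has_real_derivative_powr)
  moreover have "- (real k + 1 / 2) - 1 = - (real (Suc k) + 1 / 2)" by simp
  ultimately have "((\<lambda>t. t powr (- (real k + 1 / 2))) has_real_derivative - (real k + 1 / 2) * (1 / (t ^ Suc k * sqrt t))) (at t)"
    by (simp only: inverse_half_power_eq[OF assms])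
  moreover have "eventually (\<lambda>s. s > 0) (nhds t)"
    using assms eventually_nhds_in_open[of "{0<..}" t] by auto
  then have "eventually (\<lambda>s. 1 / (s ^ k * sqrt s) = s powr (- (real k + 1 / 2))) (nhds t)"
    by eventually_elim (rule inverse_half_power_eq)
  ultimately show ?thesis by (subst DERIV_cong_ev[OF refl _ refl])
qed

lemma inverse_half_power_at_top: "((\<lambda>t. 1 / (t ^ k * sqrt t)) \<longlongrightarrow> 0) at_top"
proof -
  have "((\<lambda>t. t powr (- (real k + 1 / 2))) \<longlongrightarrow> 0) at_top"
    by (intro tendsto_neg_powr filterlim_ident) auto
  then show ?thesis
    by (rule Lim_transform_eventually)
       (use eventually_gt_at_top[of 0] in \<open>eventually_elim, simp only: inverse_half_power_eq\<close>)
qed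

text \<open>Indexed by k = n - 1, so that the exponents 2n - 2 and 2n - 1 of \<open>f_term\<close>
  become 2 * k and 2 * k + 1 without subtraction.\<close>

definition h0_moment :: "nat \<Rightarrow> (nat \<Rightarrow> real) \<Rightarrow> nat \<Rightarrow> real \<Rightarrow> real" where
  "h0_moment N a k y = integral {0..y} (\<lambda>\<rho>. \<rho> ^ (2 * k) * h0 N a (Suc k) \<rho>)"

lemma h0_moment_deriv:
  "y > 0 \<Longrightarrow> (h0_moment N a k has_real_derivative y ^ (2 * k) * h0 N a (Suc k) y) (at y)"
  unfolding h0_moment_def[abs_def]
  by (intro integral_indefinite_deriv continuous_intros continuous_on_h0)

lemma h0_moment_tendsto_0: "(h0_moment N a k \<longlongrightarrow> 0) (at_right 0)"
  unfolding h0_moment_def[abs_def]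
  by (intro integral_indefinite_tendsto_0 continuous_intros continuous_on_h0)

lemma f_term_pos:
  "y > 0 \<Longrightarrow> f_term N a (Suc k) y = - (2 / y ^ (2 * k + 1)) * h0_moment N a k y"
  by (simp add: f_term_def extend_at_0_def h0_moment_def)

text \<open>By l'Hopital's rule. The denominator 2k + 1 is what later cancels the factor k + 1/2
  from differentiating the power of t at x = 0.\<close>

lemma f_term_0: "f_term N a (Suc k) 0 = - 2 * (h0 N a (Suc k) 0 / (2 * real k + 1))"
proof -
  have pos: "eventually (\<lambda>y. y > (0::real)) (at_right 0)"
    by (auto simp: eventually_at_filter)
  have "((\<lambda>y. h0_moment N a k y / y ^ (2 * k + 1)) \<longlongrightarrow> h0 N a (Suc k) 0 / (2 * real k + 1)) (at_right 0)"
  proof (rule lhopital_right_0[where f' = "\<lambda>y. y ^ (2 * k) * h0 N a (Suc k) y"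
        and g' = "\<lambda>y. (2 * real k + 1) * y ^ (2 * k)"])
    show "(h0_moment N a k \<longlongrightarrow> 0) (at_right 0)" by (rule h0_moment_tendsto_0)
    have "((\<lambda>y::real. y ^ (2 * k + 1)) \<longlongrightarrow> 0 ^ (2 * k + 1)) (at_right 0)"
      by (intro tendsto_intros)
    then show "((\<lambda>y::real. y ^ (2 * k + 1)) \<longlongrightarrow> 0) (at_right 0)" by simp
    show "eventually (\<lambda>y::real. y ^ (2 * k + 1) \<noteq> 0) (at_right 0)"
      using pos by eventually_elim simp
    show "eventually (\<lambda>y. (2 * real k + 1) * y ^ (2 * k) \<noteq> 0) (at_right 0)"
      using pos by eventually_elim (simp add: add_nonneg_eq_0_iff)
    show "eventually (\<lambda>y. (h0_moment N a k has_real_derivative y ^ (2 * k) * h0 N a (Suc k) y) (at y)) (at_right 0)"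
      using pos by eventually_elim (rule h0_moment_deriv)
    show "eventually (\<lambda>y. ((\<lambda>y. y ^ (2 * k + 1)) has_real_derivative (2 * real k + 1) * y ^ (2 * k)) (at y)) (at_right 0)"
      using DERIV_pow[of "2 * k + 1"] by (intro always_eventually allI) (simp add: add.commute)
    have "((\<lambda>y. h0 N a (Suc k) y / (2 * real k + 1)) \<longlongrightarrow> h0 N a (Suc k) 0 / (2 * real k + 1)) (at 0)"
      using continuous_on_h0[of UNIV N a "Suc k"]
      by (intro tendsto_divide tendsto_const) (auto simp: continuous_on_def)
    then have "((\<lambda>y. h0 N a (Suc k) y / (2 * real k + 1)) \<longlongrightarrow> h0 N a (Suc k) 0 / (2 * real k + 1)) (at_right 0)"
      by (rule tendsto_within_subset) simp
    then show "((\<lambda>y. y ^ (2 * k) * h0 N a (Suc k) y / ((2 * real k + 1) * y ^ (2 * k))) \<longlongrightarrow> h0 N a (Suc k) 0 / (2 * real k + 1)) (at_right 0)"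
      by (rule Lim_transform_eventually) (use pos in \<open>eventually_elim, simp\<close>)
  qed
  then have "((\<lambda>y. - 2 * (h0_moment N a k y / y ^ (2 * k + 1))) \<longlongrightarrow> - 2 * (h0 N a (Suc k) 0 / (2 * real k + 1))) (at_right 0)"
    by (rule tendsto_mult[OF tendsto_const])
  then have "Lim (at_right 0) (\<lambda>y. - 2 * (h0_moment N a k y / y ^ (2 * k + 1))) = - 2 * (h0 N a (Suc k) 0 / (2 * real k + 1))"
    by (intro tendsto_Lim) auto
  then show ?thesis by (simp add: f_term_def extend_at_0_def h0_moment_def)
qed

text \<open>The explicit powers of t cancel for x > 0, and t survives only in the upper limit of
  integration. The derivative in t and the limit at infinity can then be read off.\<close>

lemma scaled_f_term_eq:
  assumes "x > 0" "t > 0"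
  shows "1 / (t ^ k * sqrt t) * f_term N a (Suc k) (x / sqrt t) = - (2 / x ^ (2 * k + 1)) * h0_moment N a k (x / sqrt t)"
proof -
  have "(x / sqrt t) ^ (2 * k + 1) = x ^ (2 * k + 1) / (t ^ k * sqrt t)"
    using assms by (simp add: power_divide power_mult)
  then show ?thesis using assms by (simp add: f_term_pos)
qed

lemma scaled_f_term_deriv:
  assumes "x \<ge> 0" "t > 0"
  shows "((\<lambda>t. 1 / (t ^ k * sqrt t) * f_term N a (Suc k) (x / sqrt t)) has_real_derivative
     h0 N a (Suc k) (x / sqrt t) / (t ^ Suc k * sqrt t)) (at t)"
proof (cases "x = 0")
  case True
  have "((\<lambda>t. 1 / (t ^ k * sqrt t) * f_term N a (Suc k) 0) has_real_derivative
     - (real k + 1 / 2) * (1 / (t ^ Suc k * sqrt t)) * f_term N a (Suc k) 0) (at t)"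
    by (intro DERIV_cmult_right inverse_half_power_deriv assms)
  also have "- (real k + 1 / 2) * (1 / (t ^ Suc k * sqrt t)) * f_term N a (Suc k) 0 = h0 N a (Suc k) 0 / (t ^ Suc k * sqrt t)"
  proof -
    have "2 * real k + 1 \<noteq> 0" by (simp add: add_nonneg_eq_0_iff)
    then have *: "- (real k + 1 / 2) * X * (- 2 * (h / (2 * real k + 1))) = h * X" for h X
      by (simp add: field_simps)
    show ?thesis unfolding f_term_0 * by simp
  qed
  finally show ?thesis using True by simp
next
  case False
  with assms have x: "x > 0" by simp
  define y where "y = x / sqrt t"
  have y: "y > 0" using x assms by (simp add: y_def)
  have "((\<lambda>t. - (2 / x ^ (2 * k + 1)) * h0_moment N a k (x / sqrt t)) has_real_derivative
     - (2 / x ^ (2 * k + 1)) * (y ^ (2 * k) * h0 N a (Suc k) y * (- y / (2 * t)))) (at t)"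
    unfolding y_def using y[unfolded y_def]
    by (intro DERIV_cmult DERIV_chain2[OF h0_moment_deriv div_sqrt_deriv] assms)
       (simp add: minus_divide_left)
  also have "- (2 / x ^ (2 * k + 1)) * (y ^ (2 * k) * h0 N a (Suc k) y * (- y / (2 * t)))
     = y ^ (2 * k + 1) / x ^ (2 * k + 1) * (h0 N a (Suc k) y / t)"
    by (simp add: mult_ac)
  also have "y ^ (2 * k + 1) / x ^ (2 * k + 1) = 1 / (t ^ k * sqrt t)"
    unfolding y_def using x assms by (simp add: power_divide power_mult)
  also have "1 / (t ^ k * sqrt t) * (h0 N a (Suc k) y / t) = h0 N a (Suc k) (x / sqrt t) / (t ^ Suc k * sqrt t)"
    unfolding y_def by simp
  finally have deriv: "((\<lambda>t. - (2 / x ^ (2 * k + 1)) * h0_moment N a k (x / sqrt t)) has_real_derivative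
     h0 N a (Suc k) (x / sqrt t) / (t ^ Suc k * sqrt t)) (at t)" .
  have "eventually (\<lambda>s. s > 0) (nhds t)"
    using assms(2) eventually_nhds_in_open[of "{0<..}" t] by auto
  then have "eventually (\<lambda>s. 1 / (s ^ k * sqrt s) * f_term N a (Suc k) (x / sqrt s)
      = - (2 / x ^ (2 * k + 1)) * h0_moment N a k (x / sqrt s)) (nhds t)"
    by eventually_elim (rule scaled_f_term_eq[OF x])
  with deriv show ?thesis by (subst DERIV_cong_ev[OF refl _ refl])
qed

lemma scaled_f_term_limit:
  assumes "x \<ge> 0"
  shows "((\<lambda>t. 1 / (t ^ k * sqrt t) * f_term N a (Suc k) (x / sqrt t)) \<longlongrightarrow> 0) at_top"
proof (cases "x = 0")
  case True
  have "((\<lambda>t. 1 / (t ^ k * sqrt t) * f_term N a (Suc k) 0) \<longlongrightarrow> 0) at_top"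
    by (intro tendsto_mult_left_zero inverse_half_power_at_top)
  with True show ?thesis by simp
next
  case False
  with assms have x: "x > 0" by simp
  have "filterlim (\<lambda>t. x / sqrt t) (at_right 0) at_top"
    unfolding filterlim_at
  proof
    show "((\<lambda>t. x / sqrt t) \<longlongrightarrow> 0) at_top"
      by (intro tendsto_divide_0[OF tendsto_const] filterlim_at_top_imp_at_infinity sqrt_at_top)
    show "eventually (\<lambda>t. x / sqrt t \<in> {0<..} \<and> x / sqrt t \<noteq> 0) at_top"
      using eventually_gt_at_top[of 0] by eventually_elim (use x in auto)
  qed
  then have "((\<lambda>t. - (2 / x ^ (2 * k + 1)) * h0_moment N a k (x / sqrt t)) \<longlongrightarrow> - (2 / x ^ (2 * k + 1)) * 0) at_top"
    by (intro tendsto_mult tendsto_const filterlim_compose[OF h0_moment_tendsto_0])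
  then have "((\<lambda>t. - (2 / x ^ (2 * k + 1)) * h0_moment N a k (x / sqrt t)) \<longlongrightarrow> 0) at_top" by simp
  then show ?thesis
    by (rule Lim_transform_eventually)
       (use eventually_gt_at_top[of 0] in \<open>eventually_elim, simp only: scaled_f_term_eq[OF x]\<close>)
qed

section \<open>The constant term\<close>

context stencil
begin

text \<open>Splitting off (cos - 1) / A leaves 1 / A - 1 / \<xi>^2; in each piece the numerator
  compensates for the vanishing denominator.\<close>

lemma omega_integrand_bounded:
  "\<exists>B. \<forall>\<xi>. \<bar>\<xi>\<bar> \<le> pi \<longrightarrow> \<bar>cos (x * \<xi>) / A \<xi> - 1 / \<xi>\<^sup>2\<bar> \<le> B"
proof -
  obtain c where c: "c > 0" "\<And>\<theta>. \<bar>\<theta>\<bar> \<le> pi \<Longrightarrow> c * \<theta>\<^sup>2 \<le> A \<theta>" using A_lower by blast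
  obtain C where C: "C \<ge> 0" "\<And>\<theta>. \<bar>A \<theta> - \<theta>\<^sup>2\<bar> \<le> C * \<theta> ^ 4" using A_near by blast
  have "\<bar>cos (x * \<xi>) / A \<xi> - 1 / \<xi>\<^sup>2\<bar> \<le> x\<^sup>2 / c + C / c" if \<xi>: "\<bar>\<xi>\<bar> \<le> pi" for \<xi>
  proof (cases "\<xi> = 0")
    \<comment> \<open>At the origin both quotients have denominator 0 and hence the value 0.\<close>
    case True
    then show ?thesis using c(1) C(1) by simp
  next
    case False
    then have z: "\<xi>\<^sup>2 > 0" by simp
    have A: "A \<xi> > 0" "A \<xi> \<ge> c * \<xi>\<^sup>2" using A_pos[OF False \<xi>] c(2)[OF \<xi>] by auto
    have "\<bar>cos (x * \<xi>) - 1\<bar> \<le> (x * \<xi>)\<^sup>2 / 2"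
      using cos_taylor[of "x * \<xi>" 1] by simp
    then have "\<bar>cos (x * \<xi>) - 1\<bar> \<le> (x * \<xi>)\<^sup>2"
      using zero_le_power2[of "x * \<xi>"] by linarith
    then have "\<bar>cos (x * \<xi>) - 1\<bar> / A \<xi> \<le> (x\<^sup>2 * \<xi>\<^sup>2) / (c * \<xi>\<^sup>2)"
      using A c(1) z by (intro frac_le) (auto simp: power_mult_distrib)
    then have 1: "\<bar>(cos (x * \<xi>) - 1) / A \<xi>\<bar> \<le> x\<^sup>2 / c" using z A by simp
    have "\<bar>A \<xi> - \<xi>\<^sup>2\<bar> / (A \<xi> * \<xi>\<^sup>2) \<le> (C * \<xi> ^ 4) / ((c * \<xi>\<^sup>2) * \<xi>\<^sup>2)"
      using A c(1) z C by (intro frac_le mult_right_mono) auto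
    also have "\<dots> = C / c" using False by (simp add: power2_eq_square power4_eq_xxxx)
    finally have 2: "\<bar>1 / A \<xi> - 1 / \<xi>\<^sup>2\<bar> \<le> C / c"
      using A z by (simp add: diff_frac_eq abs_divide abs_mult abs_minus_commute)
    have "cos (x * \<xi>) / A \<xi> - 1 / \<xi>\<^sup>2 = (cos (x * \<xi>) - 1) / A \<xi> + (1 / A \<xi> - 1 / \<xi>\<^sup>2)"
      by (simp add: diff_divide_distrib)
    then show ?thesis using 1 2 by linarith
  qed
  then show ?thesis by blast
qed

lemma omega_integrand_integrable:
  "(\<lambda>\<xi>. cos (x * \<xi>) / A \<xi> - 1 / \<xi>\<^sup>2) integrable_on {-pi..pi}"
proof -
  obtain B where B: "\<And>\<xi>. \<bar>\<xi>\<bar> \<le> pi \<Longrightarrow> \<bar>cos (x * \<xi>) / A \<xi> - 1 / \<xi>\<^sup>2\<bar> \<le> B"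
    using omega_integrand_bounded by blast
  have [measurable]: "A \<in> borel_measurable borel"
    using borel_measurable_continuous_onI[OF continuous_on_A] .
  have "set_integrable lborel {-pi..pi} (\<lambda>\<xi>. cos (x * \<xi>) / A \<xi> - 1 / \<xi>\<^sup>2)"
    unfolding set_integrable_def
  proof (rule integrableI_bounded_set_indicator[where B = B])
    show "(\<lambda>\<xi>. cos (x * \<xi>) / A \<xi> - 1 / \<xi>\<^sup>2) \<in> borel_measurable lborel" by measurable
  qed (use B in \<open>auto simp: abs_le_iff\<close>)
  then show ?thesis by (rule set_borel_integral_eq_integral(1))
qed

text \<open>For N = 1 the only weight is 1, so the plain second difference has symbol
  \<open>A\<close>; the denominators cancel and the 1 / \<xi>^2 terms add up to zero.\<close>

lemma omega_integral_second_difference: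
  assumes "N = 1"
  shows "integral {-pi..pi} (\<lambda>\<xi>. cos ((x - 1) * \<xi>) / A \<xi> - 1 / \<xi>\<^sup>2)
     - 2 * integral {-pi..pi} (\<lambda>\<xi>. cos (x * \<xi>) / A \<xi> - 1 / \<xi>\<^sup>2)
     + integral {-pi..pi} (\<lambda>\<xi>. cos ((x + 1) * \<xi>) / A \<xi> - 1 / \<xi>\<^sup>2)
    = - integral {-pi..pi} (\<lambda>\<xi>. cos (x * \<xi>))" (is "?I (x - 1) - 2 * ?I x + ?I (x + 1) = _")
proof -
  let ?f = "\<lambda>x \<xi>. cos (x * \<xi>) / A \<xi> - 1 / \<xi>\<^sup>2"
  have a1: "a 1 = 1" using moment_1 by (simp add: assms)
  have "((\<lambda>\<xi>. ?f (x - 1) \<xi> - 2 * ?f x \<xi> + ?f (x + 1) \<xi>) has_integral (?I (x - 1) - 2 * ?I x + ?I (x + 1))) {-pi..pi}"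
    by (intro has_integral_add has_integral_diff has_integral_mult_right integrable_integral omega_integrand_integrable)
  moreover have "((\<lambda>\<xi>. ?f (x - 1) \<xi> - 2 * ?f x \<xi> + ?f (x + 1) \<xi>) has_integral (- integral {-pi..pi} (\<lambda>\<xi>. cos (x * \<xi>)))) {-pi..pi}"
  \<comment> \<open>At \<xi> = 0 division by zero makes the left integrand 0 instead of -1, so that
    point is excluded.\<close>
  proof (rule has_integral_spike_finite[of "{0}"])
    show "((\<lambda>\<xi>. - cos (x * \<xi>)) has_integral (- integral {-pi..pi} (\<lambda>\<xi>. cos (x * \<xi>)))) {-pi..pi}"
      by (intro has_integral_neg integrable_integral integrable_continuous_real continuous_intros)
    fix \<xi> assume "\<xi> \<in> {-pi..pi} - {0}"
    then have "\<xi> \<noteq> 0" "\<bar>\<xi>\<bar> \<le> pi" by auto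
    then have "A \<xi> \<noteq> 0" using A_pos[of \<xi>] by auto
    have "?f (x - 1) \<xi> - 2 * ?f x \<xi> + ?f (x + 1) \<xi> = (cos ((x - 1) * \<xi>) - 2 * cos (x * \<xi>) + cos ((x + 1) * \<xi>)) / A \<xi>"
      by (simp add: add_divide_distrib diff_divide_distrib)
    also have "cos ((x - 1) * \<xi>) - 2 * cos (x * \<xi>) + cos ((x + 1) * \<xi>) = - A \<xi> * cos (x * \<xi>)"
      using laplacian_cos[of x \<xi>] a1 by (simp add: assms)
    finally show "?f (x - 1) \<xi> - 2 * ?f x \<xi> + ?f (x + 1) \<xi> = - cos (x * \<xi>)"
      using \<open>A \<xi> \<noteq> 0\<close> by simp
  qed simp
  ultimately show ?thesis using has_integral_unique by blast
qed

text \<open>Here A = 4 sin^2 (\<xi> / 2), and 1 / \<xi> - cot (\<xi> / 2) / 2 is a primitive that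
  extends continuously by 0. The cotangent vanishes at the ends, each of which contributes 1 /
  pi.\<close>

lemma omega_integral_0:
  assumes "N = 1"
  shows "integral {-pi..pi} (\<lambda>\<xi>. cos (0 * \<xi>) / A \<xi> - 1 / \<xi>\<^sup>2) = 2 / pi"
proof -
  define F :: "real \<Rightarrow> real" where "F \<xi> = (if \<xi> = 0 then 0 else 1 / \<xi> - cos (\<xi> / 2) / (2 * sin (\<xi> / 2)))" for \<xi>
  have sin_nz: "sin (\<xi> / 2) \<noteq> 0" if "\<xi> \<noteq> 0" "\<bar>\<xi>\<bar> \<le> pi" for \<xi>
    using sin_gt_zero[of "\<xi> / 2"] sin_gt_zero[of "- \<xi> / 2"] that by (cases "\<xi> > 0") auto
  have A: "A \<xi> = 4 * (sin (\<xi> / 2))\<^sup>2" for \<xi>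
    using cos_double_sin[of "\<xi> / 2"] moment_1 by (simp add: laplacian_symbol_def assms)
  have deriv: "(F has_real_derivative (cos (0 * \<xi>) / A \<xi> - 1 / \<xi>\<^sup>2)) (at \<xi>)" if "\<xi> \<noteq> 0" "\<bar>\<xi>\<bar> \<le> pi" for \<xi>
  proof -
    have "((\<lambda>\<xi>. 1 / \<xi> - cos (\<xi> / 2) / (2 * sin (\<xi> / 2))) has_real_derivative
       (- (1 / \<xi>\<^sup>2) - (- sin (\<xi> / 2) / 2 * (2 * sin (\<xi> / 2)) - cos (\<xi> / 2) * cos (\<xi> / 2)) / (2 * sin (\<xi> / 2))\<^sup>2)) (at \<xi>)"
      using that sin_nz[OF that] by (auto intro!: derivative_eq_intros simp: power2_eq_square)
    also have "- (1 / \<xi>\<^sup>2) - (- sin (\<xi> / 2) / 2 * (2 * sin (\<xi> / 2)) - cos (\<xi> / 2) * cos (\<xi> / 2)) / (2 * sin (\<xi> / 2))\<^sup>2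
       = cos (0 * \<xi>) / A \<xi> - 1 / \<xi>\<^sup>2"
    proof -
      have "- sin (\<xi> / 2) / 2 * (2 * sin (\<xi> / 2)) - cos (\<xi> / 2) * cos (\<xi> / 2) = - 1"
        using sin_cos_squared_add[of "\<xi> / 2"] by (simp add: power2_eq_square)
      then show ?thesis unfolding A by (simp add: power_mult_distrib)
    qed
    finally have *: "((\<lambda>\<xi>. 1 / \<xi> - cos (\<xi> / 2) / (2 * sin (\<xi> / 2))) has_real_derivative (cos (0 * \<xi>) / A \<xi> - 1 / \<xi>\<^sup>2)) (at \<xi>)" .
    have "eventually (\<lambda>s. s \<noteq> 0) (nhds \<xi>)" using that(1) t1_space_nhds by blast
    then have "eventually (\<lambda>s. F s = 1 / s - cos (s / 2) / (2 * sin (s / 2))) (nhds \<xi>)"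
      by eventually_elim (simp add: F_def)
    with * show ?thesis by (subst DERIV_cong_ev[OF refl _ refl])
  qed
  have "isCont F \<xi>" if "\<bar>\<xi>\<bar> \<le> pi" for \<xi>
  proof (cases "\<xi> = 0")
    case True
    have "((\<lambda>\<xi>::real. 1 / \<xi> - cos (\<xi> / 2) / (2 * sin (\<xi> / 2))) \<longlongrightarrow> 0) (at 0)"
      by real_asymp
    then have "(F \<longlongrightarrow> 0) (at 0)"
      by (rule Lim_transform_eventually) (auto simp: F_def eventually_at_filter)
    with True show ?thesis by (simp add: isCont_def F_def)
  next
    case False
    then show ?thesis using DERIV_isCont[OF deriv[OF _ that]] by simp
  qed
  then have cont: "continuous_on {-pi..pi} F"
    by (intro continuous_at_imp_continuous_on) auto
  have "((\<lambda>\<xi>. cos (0 * \<xi>) / A \<xi> - 1 / \<xi>\<^sup>2) has_integral (F pi - F (- pi))) {-pi..pi}"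
    using deriv cont
    by (intro fundamental_theorem_of_calculus_interior_strong[of "{0}"])
       (auto simp: has_real_derivative_iff_has_vector_derivative[symmetric])
  then have "integral {-pi..pi} (\<lambda>\<xi>. cos (0 * \<xi>) / A \<xi> - 1 / \<xi>\<^sup>2) = F pi - F (- pi)"
    by (rule integral_unique)
  also have "\<dots> = 2 / pi" by (simp add: F_def)
  finally show ?thesis .
qed

lemma Omega_eq_0:
  assumes "N = 1" "x \<ge> 0"
  shows "Omega N a x = 0"
proof -
  define I where "I x = integral {-pi..pi} (\<lambda>\<xi>. cos (x * \<xi>) / A \<xi> - 1 / \<xi>\<^sup>2)" for x
  have I0: "I 0 = 2 / pi" unfolding I_def by (rule omega_integral_0[OF assms(1)])
  have rec: "I (real_of_int k - 1) - 2 * I (real_of_int k) + I (real_of_int k + 1) = - (if k = 0 then 2 * pi else 0)" for k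
    unfolding I_def omega_integral_second_difference[OF assms(1)] integral_cos_int ..
  \<comment> \<open>Evenness turns the relation at k = 0 into the second initial value; from there
    on the vanishing second difference makes \<open>I\<close> linear.\<close>
  have "I (- 1) = I 1" by (simp add: I_def)
  then have I1: "I 1 = 2 / pi - pi" using rec[of 0] I0 by simp
  have "I (real n) = 2 / pi - pi * real n \<and> I (real (Suc n)) = 2 / pi - pi * real (Suc n)" for n
  proof (induction n)
    case 0
    then show ?case using I0 I1 by simp
  next
    case (Suc n)
    then show ?case using rec[of "int (Suc n)"] by (simp add: algebra_simps)
  qed
  from this[of "nat x"] have "I (real_of_int x) = 2 / pi - pi * real_of_int x" using assms(2) by simp
  then show ?thesis unfolding Omega_def I_def by simp
qed

end

section \<open>Limit of the Green integral for large times\<close>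

lemma exp_diff_bound:
  fixes p q m :: real
  assumes "m \<le> p" "m \<le> q"
  shows "\<bar>exp (- p) - exp (- q)\<bar> \<le> \<bar>p - q\<bar> * exp (- m)"
proof -
  have *: "exp (- p) - exp (- q) \<le> (q - p) * exp (- m)" if "p \<le> q" "m \<le> p" for p q :: real
  proof -
    have "exp (- p) - exp (- q) = exp (- p) * (1 - exp (- (q - p)))"
      by (simp add: right_diff_distrib mult_exp_exp)
    also have "\<dots> \<le> exp (- m) * (q - p)"
    proof (rule mult_mono)
      show "1 - exp (- (q - p)) \<le> q - p" using exp_ge_add_one_self[of "- (q - p)"] by linarith
    qed (use that in auto)
    finally show ?thesis by (simp add: mult.commute)
  qed
  show ?thesis
    using *[of p q] *[of q p] assms by (cases "p \<le> q") auto
qed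

context stencil
begin

lemma gauss_integral_interval:
  "\<exists>M. \<forall>t>0. \<bar>integral {-pi..pi} (\<lambda>\<theta>. exp (- (t * \<theta>\<^sup>2))) - sqrt (pi / t)\<bar> \<le> M / (t\<^sup>2 * sqrt t)"
proof (intro exI allI impI)
  fix t :: real assume t: "t > 0"
  let ?f = "\<lambda>\<theta>. exp (- (t * \<theta>\<^sup>2))"
  \<comment> \<open>The earlier majorant with K = 1 and c = 1. It decays like t^(-5/2), which beats
    the factor t multiplying this difference in the limit below.\<close>
  let ?m = "\<lambda>\<theta>::real. (\<theta>\<^sup>2) ^ Suc 1 * (\<Sum>m\<le>Suc 1. (t * \<theta>\<^sup>2) ^ m) * exp (- (1 * (t * \<theta>\<^sup>2)))"
  have set_int: "set_integrable lborel {-pi..pi} ?f"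
    by (intro borel_integrable_atLeastAtMost' continuous_intros)
  have int: "integrable lborel ?f"
    using integrable_gauss_moment[OF t, of 0] by simp
  have total: "(LINT \<theta>|lborel. ?f \<theta>) = sqrt (pi / t)"
  proof -
    have "sqrt pi = (LINT \<xi>|lborel. exp (- \<xi>\<^sup>2))"
      using gauss_cos_0_0[of 0] by (simp add: gauss_cos_def heat_kernel_def real_div_sqrt)
    also have "\<dots> = \<bar>sqrt t\<bar> *\<^sub>R (LINT \<theta>|lborel. exp (- (0 + sqrt t * \<theta>)\<^sup>2))"
      using t by (intro lborel_integral_real_affine) simp
    also have "\<dots> = sqrt t * (LINT \<theta>|lborel. ?f \<theta>)"
      using t by (simp add: power_mult_distrib)
    finally show ?thesis using t by (simp add: real_sqrt_divide field_simps)
  qed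
  have part: "integral {-pi..pi} ?f = (LINT \<theta>|lborel. indicator {-pi..pi} \<theta> * ?f \<theta>)"
    using set_borel_integral_eq_integral(2)[OF set_int] by (simp add: set_lebesgue_integral_def)
  have int_part: "integrable lborel (\<lambda>\<theta>. indicator {-pi..pi} \<theta> * ?f \<theta>)"
    using set_int by (simp add: set_integrable_def)
  have eq: "integral {-pi..pi} ?f - sqrt (pi / t) = (LINT \<theta>|lborel. indicator {-pi..pi} \<theta> * ?f \<theta> - ?f \<theta>)"
    unfolding part total[symmetric] Bochner_Integration.integral_diff[OF int_part int] ..
  have "\<bar>integral {-pi..pi} ?f - sqrt (pi / t)\<bar> \<le> (LINT \<theta>|lborel. ?m \<theta>)"
    unfolding eq
  proof (rule integral_abs_bound_integral[OF Bochner_Integration.integrable_diff[OF int_part int]])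
    show "integrable lborel ?m" by (rule scaled_majorant(1)[OF zero_less_one t])
    fix \<theta>
    show "\<bar>indicator {-pi..pi} \<theta> * ?f \<theta> - ?f \<theta>\<bar> \<le> ?m \<theta>"
    proof (cases "\<theta> \<in> {-pi..pi}")
      case True
      then show ?thesis using t by (auto intro!: mult_nonneg_nonneg sum_nonneg simp del: power_Suc sum.atMost_Suc)
    next
      case False
      then have "1 \<le> \<bar>\<theta>\<bar>" using pi_gt3 by auto
      then have "1 \<le> \<theta>\<^sup>2" by (metis one_le_power power2_abs)
      then have "1 * 1 \<le> (\<theta>\<^sup>2) ^ Suc 1 * (\<Sum>m\<le>Suc 1. (t * \<theta>\<^sup>2) ^ m)"
        using t member_le_sum[of 0 "{..Suc 1}" "\<lambda>m. (t * \<theta>\<^sup>2) ^ m"]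
        by (intro mult_mono one_le_power[OF \<open>1 \<le> \<theta>\<^sup>2\<close>]) auto
      from mult_right_mono[OF this, of "?f \<theta>"] False show ?thesis by simp
    qed
  qed
  also have "\<dots> = (LINT \<xi>::real|lborel. (\<xi>\<^sup>2) ^ Suc 1 * (\<Sum>m\<le>Suc 1. (\<xi>\<^sup>2) ^ m) * exp (- (1 * \<xi>\<^sup>2))) / (t ^ Suc 1 * sqrt t)"
    by (rule scaled_majorant(2)[OF zero_less_one t])
  also have "t ^ Suc 1 = t\<^sup>2" by (simp add: power2_eq_square)
  finally show "\<bar>integral {-pi..pi} ?f - sqrt (pi / t)\<bar>
    \<le> (LINT \<xi>::real|lborel. (\<xi>\<^sup>2) ^ Suc 1 * (\<Sum>m\<le>Suc 1. (\<xi>\<^sup>2) ^ m) * exp (- (1 * \<xi>\<^sup>2))) / (t\<^sup>2 * sqrt t)" .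
qed

text \<open>Integration by parts with - \<theta> times the kernel. The boundary terms at - pi and pi
  produce the - 2 / pi of \<Omega> in the limit.\<close>

lemma integral_exp_kernel_square:
  assumes "t > 0"
  shows "integral {-pi..pi} (\<lambda>\<theta>. exp_kernel t (\<theta>\<^sup>2))
    = 2 * t * integral {-pi..pi} (\<lambda>\<theta>. exp (- (t * \<theta>\<^sup>2))) - 2 * (1 - exp (- (t * pi\<^sup>2))) / pi"
proof -
  have cont: "continuous_on {-pi..pi} (\<lambda>\<theta>. exp_kernel t (\<theta>\<^sup>2))"
    by (rule continuous_on_compose2[OF continuous_on_exp_kernel[of UNIV]]) (auto intro!: continuous_intros)
  have deriv: "((\<lambda>\<theta>. - \<theta> * exp_kernel t (\<theta>\<^sup>2)) has_real_derivative exp_kernel t (\<theta>\<^sup>2) - 2 * t * exp (- (t * \<theta>\<^sup>2))) (at \<theta>)"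
    if "\<theta> \<noteq> 0" for \<theta>
  proof -
    have "((\<lambda>\<theta>. - ((1 - exp (- (t * \<theta>\<^sup>2))) / \<theta>)) has_real_derivative exp_kernel t (\<theta>\<^sup>2) - 2 * t * exp (- (t * \<theta>\<^sup>2))) (at \<theta>)"
      using that by (auto intro!: derivative_eq_intros simp: exp_kernel_def field_simps power2_eq_square)
    moreover have "- \<theta> * exp_kernel t (\<theta>\<^sup>2) = - ((1 - exp (- (t * \<theta>\<^sup>2))) / \<theta>)" for \<theta>
      by (simp add: exp_kernel_def power2_eq_square)
    ultimately show ?thesis by simp
  qed
  have "((\<lambda>\<theta>. exp_kernel t (\<theta>\<^sup>2) - 2 * t * exp (- (t * \<theta>\<^sup>2))) has_integral
     (- pi * exp_kernel t (pi\<^sup>2) - - (- pi) * exp_kernel t ((- pi)\<^sup>2))) {-pi..pi}"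
    using cont deriv
    by (intro fundamental_theorem_of_calculus_interior_strong[of "{0}"] continuous_intros)
       (auto simp: has_real_derivative_iff_has_vector_derivative[symmetric])
  moreover have "((\<lambda>\<theta>. exp_kernel t (\<theta>\<^sup>2) - 2 * t * exp (- (t * \<theta>\<^sup>2))) has_integral
     (integral {-pi..pi} (\<lambda>\<theta>. exp_kernel t (\<theta>\<^sup>2)) - 2 * t * integral {-pi..pi} (\<lambda>\<theta>. exp (- (t * \<theta>\<^sup>2))))) {-pi..pi}"
    by (intro has_integral_diff has_integral_mult_right integrable_integral integrable_continuous_real cont continuous_intros)
  ultimately have "integral {-pi..pi} (\<lambda>\<theta>. exp_kernel t (\<theta>\<^sup>2)) - 2 * t * integral {-pi..pi} (\<lambda>\<theta>. exp (- (t * \<theta>\<^sup>2)))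
     = - pi * exp_kernel t (pi\<^sup>2) - - (- pi) * exp_kernel t ((- pi)\<^sup>2)"
    using has_integral_unique by blast
  also have "\<dots> = - (2 * (1 - exp (- (t * pi\<^sup>2))) / pi)"
  proof -
    have kernel: "exp_kernel t (pi\<^sup>2) = (1 - exp (- (t * pi\<^sup>2))) / pi\<^sup>2"
      by (simp add: exp_kernel_def)
    have "- pi * (X / pi\<^sup>2) - - (- pi) * (X / pi\<^sup>2) = - (2 * X / pi)" for X
      by (simp add: power2_eq_square)
    then show ?thesis unfolding power2_minus kernel .
  qed
  finally show ?thesis by linarith
qed

lemma integral_exp_kernel_square_limit:
  "((\<lambda>t. integral {-pi..pi} (\<lambda>\<theta>. exp_kernel t (\<theta>\<^sup>2)) - 2 * sqrt pi * sqrt t) \<longlongrightarrow> - 2 / pi) at_top"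
proof -
  obtain M where M: "\<And>t. t > 0 \<Longrightarrow> \<bar>integral {-pi..pi} (\<lambda>\<theta>. exp (- (t * \<theta>\<^sup>2))) - sqrt (pi / t)\<bar> \<le> M / (t\<^sup>2 * sqrt t)"
    using gauss_integral_interval by blast
  have "((\<lambda>t. 2 * t * (integral {-pi..pi} (\<lambda>\<theta>. exp (- (t * \<theta>\<^sup>2))) - sqrt (pi / t))) \<longlongrightarrow> 0) at_top"
  proof (rule Lim_null_comparison)
    show "((\<lambda>t. 1 / (t ^ 1 * sqrt t) * (2 * M)) \<longlongrightarrow> 0) at_top"
      by (intro tendsto_mult_left_zero inverse_half_power_at_top)
    show "eventually (\<lambda>t. norm (2 * t * (integral {-pi..pi} (\<lambda>\<theta>. exp (- (t * \<theta>\<^sup>2))) - sqrt (pi / t)))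
        \<le> 1 / (t ^ 1 * sqrt t) * (2 * M)) at_top"
      using eventually_gt_at_top[of 0]
    proof eventually_elim
      case (elim t)
      have "norm (2 * t * (integral {-pi..pi} (\<lambda>\<theta>. exp (- (t * \<theta>\<^sup>2))) - sqrt (pi / t))) \<le> 2 * t * (M / (t\<^sup>2 * sqrt t))"
        using mult_left_mono[OF M[OF elim], of "2 * t"] elim by (simp add: abs_mult)
      also have "\<dots> = 1 / (t ^ 1 * sqrt t) * (2 * M)" using elim by (simp add: power2_eq_square)
      finally show ?case .
    qed
  qed
  moreover have "((\<lambda>t. 2 * (1 - exp (- (t * pi\<^sup>2))) / pi) \<longlongrightarrow> 2 * (1 - 0) / pi) at_top"
  proof (intro tendsto_intros)
    have "filterlim (\<lambda>t. t * pi\<^sup>2) at_top at_top"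
      by (rule filterlim_at_top_mult_tendsto_pos[OF tendsto_const _ filterlim_ident]) simp
    then show "((\<lambda>t. exp (- (t * pi\<^sup>2))) \<longlongrightarrow> 0) at_top"
      by (intro filterlim_compose[OF exp_at_bot] filterlim_compose[OF filterlim_uminus_at_bot_at_top])
  qed simp
  ultimately have "((\<lambda>t. 2 * t * (integral {-pi..pi} (\<lambda>\<theta>. exp (- (t * \<theta>\<^sup>2))) - sqrt (pi / t))
      - 2 * (1 - exp (- (t * pi\<^sup>2))) / pi) \<longlongrightarrow> 0 - 2 * (1 - 0) / pi) at_top"
    by (rule tendsto_diff)
  then have "((\<lambda>t. 2 * t * (integral {-pi..pi} (\<lambda>\<theta>. exp (- (t * \<theta>\<^sup>2))) - sqrt (pi / t))
      - 2 * (1 - exp (- (t * pi\<^sup>2))) / pi) \<longlongrightarrow> - 2 / pi) at_top" by simp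
  then show ?thesis
  proof (rule Lim_transform_eventually)
    show "eventually (\<lambda>t. 2 * t * (integral {-pi..pi} (\<lambda>\<theta>. exp (- (t * \<theta>\<^sup>2))) - sqrt (pi / t))
      - 2 * (1 - exp (- (t * pi\<^sup>2))) / pi
      = integral {-pi..pi} (\<lambda>\<theta>. exp_kernel t (\<theta>\<^sup>2)) - 2 * sqrt pi * sqrt t) at_top"
      using eventually_gt_at_top[of 0]
    proof eventually_elim
      case (elim t)
      have "2 * t * sqrt (pi / t) = 2 * sqrt pi * (t / sqrt t)"
        by (simp add: real_sqrt_divide)
      also have "t / sqrt t = sqrt t" using elim by (simp add: real_div_sqrt)
      finally have "2 * t * sqrt (pi / t) = 2 * sqrt pi * sqrt t" .
      then show ?case
        unfolding integral_exp_kernel_square[OF elim] right_diff_distrib by linarith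
    qed
  qed
qed

text \<open>The dominating constant, uniform in t. The difference splits into a bounded multiple of
  the \<Omega> integrand and a difference of exponentials over \<theta>^2; there the growth t
  \<theta>^2 is paid for by exp (- c t \<theta>^2), as u exp (- u) \<le> 1.\<close>

lemma kernel_difference_bound:
  "\<exists>B. \<forall>t>0. \<forall>\<theta>. \<bar>\<theta>\<bar> \<le> pi \<longrightarrow> \<bar>exp_kernel t (A \<theta>) * cos (x * \<theta>) - exp_kernel t (\<theta>\<^sup>2)\<bar> \<le> B"
proof -
  obtain B where B: "\<And>\<xi>. \<bar>\<xi>\<bar> \<le> pi \<Longrightarrow> \<bar>cos (x * \<xi>) / A \<xi> - 1 / \<xi>\<^sup>2\<bar> \<le> B"
    using omega_integrand_bounded by blast
  obtain c where c: "c > 0" "c \<le> 1" "\<And>\<theta>. \<bar>\<theta>\<bar> \<le> pi \<Longrightarrow> c * \<theta>\<^sup>2 \<le> A \<theta>" using A_lower by blast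
  obtain C where C: "C \<ge> 0" "\<And>\<theta>. \<bar>A \<theta> - \<theta>\<^sup>2\<bar> \<le> C * \<theta> ^ 4" using A_near by blast
  have "B \<ge> 0" using B[of 0] by auto
  have "\<bar>exp_kernel t (A \<theta>) * cos (x * \<theta>) - exp_kernel t (\<theta>\<^sup>2)\<bar> \<le> B + C / c"
    if t: "t > 0" and \<theta>: "\<bar>\<theta>\<bar> \<le> pi" for t \<theta>
  proof (cases "\<theta> = 0")
    case True
    then show ?thesis using \<open>B \<ge> 0\<close> C(1) c(1) by (simp add: exp_kernel_def)
  next
    case False
    define z where "z = \<theta>\<^sup>2"
    have z: "z > 0" using False by (simp add: z_def)
    have A: "A \<theta> > 0" using A_pos[OF False \<theta>] .
    have eq: "exp_kernel t (A \<theta>) * cos (x * \<theta>) - exp_kernel t (\<theta>\<^sup>2)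
      = (1 - exp (- (t * A \<theta>))) * (cos (x * \<theta>) / A \<theta> - 1 / \<theta>\<^sup>2) + (exp (- (t * z)) - exp (- (t * A \<theta>))) / z"
      using A z unfolding z_def exp_kernel_def by (simp add: field_simps)
    have "\<bar>1 - exp (- (t * A \<theta>))\<bar> \<le> 1" using A t by auto
    then have 1: "\<bar>(1 - exp (- (t * A \<theta>))) * (cos (x * \<theta>) / A \<theta> - 1 / \<theta>\<^sup>2)\<bar> \<le> 1 * B"
      unfolding abs_mult using B[OF \<theta>] by (intro mult_mono) auto
    have "\<bar>exp (- (t * z)) - exp (- (t * A \<theta>))\<bar> \<le> \<bar>t * z - t * A \<theta>\<bar> * exp (- (c * (t * z)))"
    proof (rule exp_diff_bound)
      show "c * (t * z) \<le> t * z" using mult_right_mono[OF c(2), of "t * z"] t z by simp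
      show "c * (t * z) \<le> t * A \<theta>" using mult_left_mono[OF c(3)[OF \<theta>], of t] t by (simp add: z_def mult_ac)
    qed
    also have "\<dots> \<le> (t * (C * z\<^sup>2)) * exp (- (c * (t * z)))"
    proof (rule mult_right_mono)
      have "\<bar>z - A \<theta>\<bar> \<le> C * z\<^sup>2" using C(2)[of \<theta>] by (simp add: z_def abs_minus_commute)
      then show "\<bar>t * z - t * A \<theta>\<bar> \<le> t * (C * z\<^sup>2)"
        using t by (simp add: right_diff_distrib[symmetric] abs_mult)
    qed simp
    finally have "\<bar>exp (- (t * z)) - exp (- (t * A \<theta>))\<bar> / z \<le> (t * (C * z\<^sup>2)) * exp (- (c * (t * z))) / z"
      using z by (intro divide_right_mono) auto
    also have "\<dots> = C / c * ((c * (t * z)) * exp (- (c * (t * z))))"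
      using z c(1) by (simp add: power2_eq_square)
    also have "\<dots> \<le> C / c * 1"
    proof (rule mult_left_mono)
      have "c * (t * z) \<le> exp (c * (t * z))" using exp_ge_add_one_self[of "c * (t * z)"] by linarith
      then show "(c * (t * z)) * exp (- (c * (t * z))) \<le> 1"
        by (simp add: exp_minus divide_inverse[symmetric])
    qed (use C c in simp)
    finally have 2: "\<bar>(exp (- (t * z)) - exp (- (t * A \<theta>))) / z\<bar> \<le> C / c" using z by simp
    show ?thesis unfolding eq using 1 2 by linarith
  qed
  then show ?thesis by blast
qed

text \<open>At \<theta> = 0 both kernels equal n and cancel, in agreement with the value 0 that
  division by zero gives to the right-hand side.\<close>

lemma kernel_difference_tendsto:
  assumes "\<bar>\<theta>\<bar> \<le> pi"
  shows "(\<lambda>n. exp_kernel (real n) (A \<theta>) * cos (x * \<theta>) - exp_kernel (real n) (\<theta>\<^sup>2)) \<longlonglongrightarrow> cos (x * \<theta>) / A \<theta> - 1 / \<theta>\<^sup>2"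
proof (cases "\<theta> = 0")
  case False
  have lim: "(\<lambda>n. exp_kernel (real n) z) \<longlonglongrightarrow> 1 / z" if "z > 0" for z
  proof -
    have "(\<lambda>n. (1 - exp (- z) ^ n) / z) \<longlonglongrightarrow> (1 - 0) / z"
      using that by (intro tendsto_intros LIMSEQ_power_zero) auto
    moreover have "exp_kernel (real n) z = (1 - exp (- z) ^ n) / z" for n
      using that by (simp add: exp_kernel_def exp_of_nat_mult[symmetric])
    ultimately show ?thesis by simp
  qed
  have "(\<lambda>n. exp_kernel (real n) (A \<theta>) * cos (x * \<theta>) - exp_kernel (real n) (\<theta>\<^sup>2)) \<longlonglongrightarrow> 1 / A \<theta> * cos (x * \<theta>) - 1 / \<theta>\<^sup>2"
    using False A_pos[OF False assms] by (intro tendsto_intros lim) auto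
  then show ?thesis by simp
qed (simp add: exp_kernel_def)

text \<open>Subtracting the kernel with \<open>A\<close> replaced by \<theta>^2 removes the growth
  and leaves a dominated integrand; the subtracted integral is known explicitly.\<close>

lemma green_integral_limit:
  "(\<lambda>n. green_integral x (real n) - sqrt (real n) / sqrt pi)
    \<longlonglongrightarrow> 1 / (2 * pi) * (integral {-pi..pi} (\<lambda>\<xi>. cos (x * \<xi>) / A \<xi> - 1 / \<xi>\<^sup>2) - 2 / pi)"
proof -
  let ?d = "\<lambda>t \<theta>. exp_kernel t (A \<theta>) * cos (x * \<theta>) - exp_kernel t (\<theta>\<^sup>2)"
  obtain B where B: "\<And>t \<theta>. t > 0 \<Longrightarrow> \<bar>\<theta>\<bar> \<le> pi \<Longrightarrow> \<bar>?d t \<theta>\<bar> \<le> B"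
    using kernel_difference_bound by blast
  have cont: "continuous_on {-pi..pi} (\<lambda>\<theta>. exp_kernel t (\<theta>\<^sup>2))" for t
    by (rule continuous_on_compose2[OF continuous_on_exp_kernel[of UNIV]]) (auto intro!: continuous_intros)
  have int: "(\<lambda>\<theta>. exp_kernel t (\<theta>\<^sup>2)) integrable_on {-pi..pi}" for t
    by (rule integrable_continuous_real[OF cont])
  have "(\<lambda>n. integral {-pi..pi} (?d (real n))) \<longlonglongrightarrow> integral {-pi..pi} (\<lambda>\<xi>. cos (x * \<xi>) / A \<xi> - 1 / \<xi>\<^sup>2)"
  proof (rule dominated_convergence(2))
    show "?d (real n) integrable_on {-pi..pi}" for n
      by (intro integrable_diff integrable_exp_kernel_A int)
    show "(\<lambda>_. B) integrable_on {-pi..pi}" by (rule integrable_continuous_real[OF continuous_on_const])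
    \<comment> \<open>The bound is available for positive times only. For n = 0 the kernels vanish,
      and the instance at time 1 shows that \<open>B\<close> is nonnegative.\<close>
    show "norm (?d (real n) \<theta>) \<le> B" if "\<theta> \<in> {-pi..pi}" for n \<theta>
      using B[of "real n" \<theta>] B[of 1 \<theta>] that by (cases "n = 0") (auto simp: abs_le_iff)
    show "(\<lambda>n. ?d (real n) \<theta>) \<longlonglongrightarrow> cos (x * \<theta>) / A \<theta> - 1 / \<theta>\<^sup>2" if "\<theta> \<in> {-pi..pi}" for \<theta>
      using that by (intro kernel_difference_tendsto) auto
  qed
  moreover have "(\<lambda>n. integral {-pi..pi} (\<lambda>\<theta>. exp_kernel (real n) (\<theta>\<^sup>2)) - 2 * sqrt pi * sqrt (real n)) \<longlonglongrightarrow> - 2 / pi"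
    by (rule filterlim_compose[OF integral_exp_kernel_square_limit filterlim_real_sequentially])
  ultimately have lim: "(\<lambda>n. 1 / (2 * pi) * (integral {-pi..pi} (?d (real n))
        + (integral {-pi..pi} (\<lambda>\<theta>. exp_kernel (real n) (\<theta>\<^sup>2)) - 2 * sqrt pi * sqrt (real n))))
     \<longlonglongrightarrow> 1 / (2 * pi) * (integral {-pi..pi} (\<lambda>\<xi>. cos (x * \<xi>) / A \<xi> - 1 / \<xi>\<^sup>2) + - 2 / pi)"
    by (intro tendsto_mult tendsto_add tendsto_const)
  have eq: "1 / (2 * pi) * (integral {-pi..pi} (?d t)
        + (integral {-pi..pi} (\<lambda>\<theta>. exp_kernel t (\<theta>\<^sup>2)) - 2 * sqrt pi * sqrt t))
      = green_integral x t - sqrt t / sqrt pi" for t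
  proof -
    have "1 / (2 * pi) * (2 * sqrt pi * sqrt t) = sqrt pi / pi * sqrt t" by simp
    also have "sqrt pi / pi = inverse (sqrt pi)" by (intro sqrt_divide_self_eq) simp
    also have "inverse (sqrt pi) * sqrt t = sqrt t / sqrt pi" by (simp add: divide_inverse)
    finally have "1 / (2 * pi) * (2 * sqrt pi * sqrt t) = sqrt t / sqrt pi" .
    then show ?thesis
      unfolding green_integral_def Henstock_Kurzweil_Integration.integral_diff[OF integrable_exp_kernel_A int]
      by (simp add: distrib_left right_diff_distrib)
  qed
  show ?thesis using lim unfolding eq by simp
qed

end

section \<open>The expansion of the second Green function\<close>

text \<open>\<open>D t + c / (t ^ k * sqrt t)\<close> is nonincreasing and \<open>D t - c / (t ^ k * sqrt t)\<close> is
  nondecreasing for the constant \<open>c\<close> of the bound.\<close>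

lemma tail_bound:
  fixes D e :: "real \<Rightarrow> real"
  assumes deriv: "\<And>t. t > 0 \<Longrightarrow> (D has_real_derivative e t) (at t)"
    and e: "\<And>t. t > 0 \<Longrightarrow> \<bar>e t\<bar> \<le> C / (t ^ Suc k * sqrt t)"
    and lim: "(\<lambda>n. D (real n)) \<longlonglongrightarrow> L" and "t > 0"
  shows "\<bar>D t - L\<bar> \<le> C / (real k + 1 / 2) / (t ^ k * sqrt t)"
proof -
  \<comment> \<open>Scaled so that c / (t ^ k * sqrt t) has derivative exactly minus the bound on
    \<open>e\<close>.\<close>
  define c where "c = C / (real k + 1 / 2)"
  let ?p = "\<lambda>t. 1 / (t ^ k * sqrt t)"
  have kpos: "real k + 1 / 2 > 0" by simp
  have p_deriv: "((\<lambda>t. c * ?p t) has_real_derivative - (C / (s ^ Suc k * sqrt s))) (at s)" if "s > 0" for s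
  proof -
    have "C / q * (- q * (1 / y)) = - (C / y)" if "q > 0" for q y :: real
      using that by simp
    from this[OF kpos] have "c * (- (real k + 1 / 2) * (1 / (s ^ Suc k * sqrt s))) = - (C / (s ^ Suc k * sqrt s))"
      unfolding c_def .
    with DERIV_cmult[OF inverse_half_power_deriv[OF that], of c k] show ?thesis by (simp only:)
  qed
  have upper: "D s + c * ?p s \<le> D t + c * ?p t" if "t \<le> s" for s
  proof (rule DERIV_nonpos_imp_nonincreasing[OF that])
    fix r assume "t \<le> r" "r \<le> s"
    with \<open>t > 0\<close> have "r > 0" by simp
    then show "\<exists>y. ((\<lambda>s. D s + c * ?p s) has_real_derivative y) (at r) \<and> y \<le> 0"
      using DERIV_add[OF deriv p_deriv, of r] e[of r] by (auto simp: abs_le_iff simp del: power_Suc)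
  qed
  have lower: "D t - c * ?p t \<le> D s - c * ?p s" if "t \<le> s" for s
  proof (rule DERIV_nonneg_imp_nondecreasing[OF that])
    fix r assume "t \<le> r" "r \<le> s"
    with \<open>t > 0\<close> have "r > 0" by simp
    then show "\<exists>y. ((\<lambda>s. D s - c * ?p s) has_real_derivative y) (at r) \<and> y \<ge> 0"
      using DERIV_diff[OF deriv p_deriv, of r] e[of r] by (auto simp: abs_le_iff simp del: power_Suc)
  qed
  have p_lim: "(\<lambda>n. c * ?p (real n)) \<longlonglongrightarrow> c * 0"
    by (intro tendsto_mult tendsto_const filterlim_compose[OF inverse_half_power_at_top filterlim_real_sequentially])
  have ev: "eventually (\<lambda>n. t \<le> real n) sequentially"
    using filterlim_real_sequentially by (simp add: filterlim_at_top)
  have "L + c * 0 \<le> D t + c * ?p t"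
    using ev upper by (intro tendsto_upperbound[OF tendsto_add[OF lim p_lim]]) (auto elim: eventually_mono)
  moreover have "D t - c * ?p t \<le> L - c * 0"
    using ev lower by (intro tendsto_lowerbound[OF tendsto_diff[OF lim p_lim]]) (auto elim: eventually_mono)
  ultimately have "\<bar>D t - L\<bar> \<le> c * ?p t" by (simp add: abs_le_iff)
  then show ?thesis by (simp add: c_def)
qed

context stencil
begin

lemma green_integral_expansion:
  "\<exists>R\<ge>0. \<forall>x\<ge>0. \<forall>t>0. \<bar>green_integral (real_of_int x) t - sqrt t * f_zero (real_of_int x / sqrt t)
      - (\<Sum>n=N..K. 1 / (t ^ (n - 1) * sqrt t) * f_term N a n (real_of_int x / sqrt t)) - Omega N a x\<bar>
    \<le> R / (t ^ K * sqrt t)"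
proof -
  obtain C where C: "C \<ge> 0" "\<And>x t. t > 0 \<Longrightarrow> \<bar>first_green x t
      - (heat_kernel (x / sqrt t) + (\<Sum>n=N..K. h0 N a n (x / sqrt t) / t ^ n)) / sqrt t\<bar> \<le> C / (t ^ Suc K * sqrt t)"
    using first_green_expansion by blast
  show ?thesis
  proof (intro exI conjI allI impI)
    show "C / (real K + 1 / 2) \<ge> 0" using C(1) by simp
    fix x :: int and t :: real assume x: "x \<ge> 0" and t: "t > 0"
    let ?x = "real_of_int x"
    have x0: "?x \<ge> 0" using x by simp
    define D where "D t = green_integral ?x t - sqrt t * f_zero (?x / sqrt t)
      - (\<Sum>n=N..K. 1 / (t ^ (n - 1) * sqrt t) * f_term N a n (?x / sqrt t))" for t
    define e where "e t = first_green ?x t - heat_kernel (?x / sqrt t) / sqrt t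
      - (\<Sum>n=N..K. h0 N a n (?x / sqrt t) / (t ^ n * sqrt t))" for t
    \<comment> \<open>Links the exponent n - 1 of the theorem with the lemmas stated for
      \<open>Suc k\<close>.\<close>
    have Suc: "n = Suc (n - 1)" if "n \<in> {N..K}" for n using that N_pos by auto
    have "\<bar>D t - Omega N a x\<bar> \<le> C / (real K + 1 / 2) / (t ^ K * sqrt t)"
    proof (rule tail_bound[OF _ _ _ t])
      fix s :: real assume s: "s > 0"
      have "((\<lambda>t. 1 / (t ^ (n - 1) * sqrt t) * f_term N a n (?x / sqrt t)) has_real_derivative
          h0 N a n (?x / sqrt s) / (s ^ n * sqrt s)) (at s)" if "n \<in> {N..K}" for n
        using scaled_f_term_deriv[OF x0 s, of "n - 1"] by (simp only: Suc[OF that, symmetric])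
      then show "(D has_real_derivative e s) (at s)"
        unfolding D_def[abs_def] e_def
        by (intro DERIV_diff green_integral_deriv scaled_f_zero_deriv DERIV_sum x0 s)
      have "e s = first_green ?x s - (heat_kernel (?x / sqrt s) + (\<Sum>n=N..K. h0 N a n (?x / sqrt s) / s ^ n)) / sqrt s"
        unfolding e_def by (simp add: add_divide_distrib sum_divide_distrib)
      then show "\<bar>e s\<bar> \<le> C / (s ^ Suc K * sqrt s)" using C(2)[OF s, of ?x] by simp
    next
      have "((\<lambda>t. 1 / (t ^ (n - 1) * sqrt t) * f_term N a n (?x / sqrt t)) \<longlongrightarrow> 0) at_top" if "n \<in> {N..K}" for n
        using scaled_f_term_limit[OF x0, of "n - 1" N a] by (simp only: Suc[OF that, symmetric])
      then have "((\<lambda>t. (sqrt t * f_zero (?x / sqrt t) - sqrt t / sqrt pi)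
         + (\<Sum>n=N..K. 1 / (t ^ (n - 1) * sqrt t) * f_term N a n (?x / sqrt t))) \<longlongrightarrow> - ?x / 2 + 0) at_top"
        by (intro tendsto_add scaled_f_zero_limit x0 tendsto_null_sum)
      \<comment> \<open>The growth sqrt t / sqrt pi cancels in the difference of the two limits, and
        subtracting - x / 2 supplies the last summand of \<Omega>.\<close>
      from tendsto_diff[OF green_integral_limit[of ?x] filterlim_compose[OF this filterlim_real_sequentially]]
      show "(\<lambda>n. D (real n)) \<longlonglongrightarrow> Omega N a x"
        unfolding D_def Omega_def by (simp add: algebra_simps)
    qed
    then show "\<bar>green_integral ?x t - sqrt t * f_zero (?x / sqrt t)
      - (\<Sum>n=N..K. 1 / (t ^ (n - 1) * sqrt t) * f_term N a n (?x / sqrt t)) - Omega N a x\<bar>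
    \<le> C / (real K + 1 / 2) / (t ^ K * sqrt t)"
      unfolding D_def .
  qed
qed

end

theorem theorem6p2:
  fixes N :: nat and a :: "nat \<Rightarrow> real" and v :: "int \<Rightarrow> real \<Rightarrow> real"
  assumes "N \<ge> 1"
    and "stencil_weights N a"
    and "second_green_function N a v"
  shows "(\<forall>t0>0. \<forall>K1\<ge>N. \<exists>r R. R \<ge> 0 \<and>
            (\<forall>x. \<forall>t\<ge>t0.
               (x \<ge> 0 \<longrightarrow>
                  v x t = sqrt t * f_zero (real_of_int x / sqrt t) + Omega N a x
                    + (\<Sum>n=N..K1. 1 / (t ^ (n - 1) * sqrt t) * f_term N a n (real_of_int x / sqrt t))
                    + r x t
                  \<and> \<bar>r x t\<bar> \<le> R / (t ^ K1 * sqrt t))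
               \<and> (x \<le> -1 \<longrightarrow> v x t = v (- x) t)))
         \<and> (N = 1 \<longrightarrow> (\<forall>x\<ge>0. Omega N a x = 0))"
proof -
  interpret stencil N a by unfold_locales fact+
  note v_eq = second_green_function_eq[OF assms(3)]
  have "\<exists>r R. R \<ge> 0 \<and>
            (\<forall>x. \<forall>t\<ge>t0.
               (x \<ge> 0 \<longrightarrow>
                  v x t = sqrt t * f_zero (real_of_int x / sqrt t) + Omega N a x
                    + (\<Sum>n=N..K1. 1 / (t ^ (n - 1) * sqrt t) * f_term N a n (real_of_int x / sqrt t))
                    + r x t
                  \<and> \<bar>r x t\<bar> \<le> R / (t ^ K1 * sqrt t))
               \<and> (x \<le> -1 \<longrightarrow> v x t = v (- x) t))" if "t0 > 0" for t0 :: real and K1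
  proof -
    obtain R where R: "R \<ge> 0" "\<And>x t. x \<ge> 0 \<Longrightarrow> t > 0 \<Longrightarrow>
      \<bar>green_integral (real_of_int x) t - sqrt t * f_zero (real_of_int x / sqrt t)
      - (\<Sum>n=N..K1. 1 / (t ^ (n - 1) * sqrt t) * f_term N a n (real_of_int x / sqrt t)) - Omega N a x\<bar>
      \<le> R / (t ^ K1 * sqrt t)"
      using green_integral_expansion[of K1] by blast
    define r where "r x t = v x t - sqrt t * f_zero (real_of_int x / sqrt t)
      - (\<Sum>n=N..K1. 1 / (t ^ (n - 1) * sqrt t) * f_term N a n (real_of_int x / sqrt t)) - Omega N a x" for x t
    show ?thesis
    proof (intro exI conjI allI impI)
      fix x t assume "t \<ge> t0"
      with that have t: "t > 0" by simp
      show "v x t = sqrt t * f_zero (real_of_int x / sqrt t) + Omega N a x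
                    + (\<Sum>n=N..K1. 1 / (t ^ (n - 1) * sqrt t) * f_term N a n (real_of_int x / sqrt t))
                    + r x t"
        by (simp add: r_def)
      show "\<bar>r x t\<bar> \<le> R / (t ^ K1 * sqrt t)" if "x \<ge> 0"
        using R(2)[OF that t] t unfolding r_def by (simp only: v_eq less_imp_le)
      show "v x t = v (- x) t"
        \<comment> \<open>Uniqueness has identified \<open>v\<close> with the Fourier integral,
          which is even in \<open>x\<close>.\<close>
        using t by (simp add: v_eq green_integral_minus)
    qed (rule R(1))
  qed
  moreover have "Omega N a x = 0" if "N = 1" "x \<ge> 0" for x
    using Omega_eq_0[OF that] .
  ultimately show ?thesis by blast
qed

end
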